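(* Let $A$, $H$, $\mathcal H$, $\mathcal A_0$, $\mathcal B$, $\mathcal A_{\mathcal B}=\mathcal A_0-\mathcal B$, $\lambda_k$, $V_k$, $P^N$, $(\nu_k,U_k)$ and $\eta_k^N$ be as defined in the context. Assume that: (H1) $\mathcal A_0:\mathcal D(\mathcal A_0)\subset\mathcal H\to\mathcal H$ is skew-adjoint with simple eigenvalues $\{\lambda_n\}_{n\in\mathbb Z^*}$. (H2) $|\lambda_{j+1}-\lambda_j|>2\|\mathcal B\|$ for all $j\in\mathbb Z^*$ with $j+1\in\mathbb Z^*$. (H3) $\|\mathcal B\|\le|\lambda_1|$. (H4) The eigenvectors $\{U_j\}_{j\in\mathbb Z^*}$ of $\mathcal A_{\mathcal B}$ constitute a Riesz basis of $\mathcal H$, i.e. there exist constants $m,M>0$ such that $$m\sum_{j\in\mathbb Z^*}|c_j|^2\le\Big\|\sum_{j\in\mathbb Z^*}c_jU_j\Big\|_{\mathcal H}^2\le M\sum_{j\in\mathbb Z^*}|c_j|^2\quad\text{for all }\{c_j\}\in\ell^2(\mathbb Z^* ).$$ (H5) For each $\varepsilon>0$ there exists $r_1>0$ such that $$\max_{|i|\le p}\ \sum_{|j|\ge p+r_1}|\langle\mathcal BV_i,V_j\rangle_{\mathcal H}|^2<\varepsilon\quad\text{for all integers }p>0,$$ where $i,j$ range over $\mathbb Z^*$. Then, given $\varepsilon>0$, there exists an integer $r>0$, independent of $N$, such that for all integers $N>r$ $$\min_{j\in\mathbb Z^*}|\eta_p^N-\nu_j|\le2\varepsilon\quad\text{for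 all }p\in\mathbb Z^*\text{ with }|p|\le N-r,$$ $$\min_{j\in\mathbb Z^*,\,|j|\le N}|\eta_j^N-\nu_p|\le2\varepsilon\quad\text{for all }p\in\mathbb Z^*\text{ with }|p|\le N-r.$$
   Context: $\mathbb Z^*=\mathbb Z\setminus\{0\}$ and $\mathbb N^*=\{1,2,\dots\}$. $H$ is an infinite-dimensional complex Hilbert space and $A$ is an unbounded self-adjoint, positive operator on $H$ with domain $\mathcal D(A)$ and compact inverse. Its eigenvalues $\{\mu_k\}_{k\ge1}$ are assumed simple and are ordered increasingly, $0<\mu_1<\mu_2<\cdots\to+\infty$; $\{v_k\}_{k\ge1}$ are associated eigenvectors normalized in $H$. $H_{1/2}=\mathcal D(A^{1/2})$ has the norm $\|z\|_{1/2}=\|A^{1/2}z\|_H$, and $\mathcal H=H_{1/2}\times H$ has the inner product $\langle[f,g],[u,v]\rangle_{\mathcal H}=\langle A^{1/2}f,A^{1/2}u\rangle_H+\langle g,v\rangle_H$. $\|\cdot\|$ denotes the norm of $\mathcal H$ or the operator norm of $\mathcal L(\mathcal H)$. $\mathcal A_0=\begin{pmatrix}0&I\\-A&0\end{pmatrix}$ with domain $\mathcal D(\mathcal A_0)=\mathcal D(A)\times H_{1/2}$. $\mathcal B\in\mathcal L(\mathcal H)$ is a bounded operator with $\langle\mathcal BY,Y\rangle_{\mathcal H}\ge0$ for all $Y\in\mathcal H$, and $\mathcal A_{\mathcal B}=\mathcal A_0-\mathcal B$ with domain $\mathcal D(\mathcal A_{\mathcal B})=\mathcal D(\mathcal A_0)$.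 The eigenvalues of $\mathcal A_0$ are $\lambda_{\pm n}=\pm i\sqrt{\mu_n}$, $n\in\mathbb N^*$, with eigenvectors $V_k=\frac{1}{\sqrt2}\big[\frac{1}{\lambda_k}v_k,\,v_k\big]$, $k\in\mathbb Z^*$, where $v_{-n}=v_n$; $\{V_k\}_{k\in\mathbb Z^*}$ is an orthonormal basis of $\mathcal H$. For $N\in\mathbb N^*$, $\mathcal H^N=\mathrm{span}\{V_k: k\in\mathbb Z^*,\ |k|\le N\}$, $P^N:\mathcal H\to\mathcal H^N$ is the orthogonal projection, and $P^N\mathcal A_{\mathcal B}$ is regarded as an operator on the $2N$-dimensional space $\mathcal H^N$ (its eigenvalues are the $\lambda\in\mathbb C$ for which there is $W\in\mathcal H^N$, $W\ne0$, with $P^N\mathcal A_{\mathcal B}W=\lambda W$). $\{(\nu_k,U_k)\}_{k\in\mathbb Z^*}$ denote the eigenvalues and associated normalized eigenvectors of $\mathcal A_{\mathcal B}$, and $\{\eta_k^N\}_{k\in\mathbb Z^*,\,|k|\le N}$ the $2N$ eigenvalues (counted with multiplicity) of $P^N\mathcal A_{\mathcal B}$. They are ordered by nondecreasing imaginary part as the index increases through $\mathbb Z^*$ (the successor of $-1$ being $1$): $\mathrm{Im}(\nu_k)\le\mathrm{Im}(\nu_{k+1})$ and, when equal, $|\nu_{k+1}|\le|\nu_k|$; likewise $\mathrm{Im}(\eta_k^N)\le\mathrm{Im}(\eta_{k+1}^N)$. This is the same ordering as for $\{\lambda_k\}_{k\in\mathbb Z^*}$. *)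

theory Defs
  imports "HOL-Analysis.Analysis"
begin

section \<open>Complex vector spaces and complex Hilbert spaces\<close>

class complex_vector = ab_group_add +
  fixes scaleC :: "complex \<Rightarrow> 'a \<Rightarrow> 'a" (infixr "*\<^sub>C" 75)
  assumes scaleC_add_right: "a *\<^sub>C (x + y) = a *\<^sub>C x + a *\<^sub>C y"
    and scaleC_add_left: "(a + b) *\<^sub>C x = a *\<^sub>C x + b *\<^sub>C x"
    and scaleC_scaleC: "a *\<^sub>C (b *\<^sub>C x) = (a * b) *\<^sub>C x"
    and scaleC_one: "1 *\<^sub>C x = x"

global_interpretation complex_vector: vector_space "scaleC :: complex \<Rightarrow> 'a \<Rightarrow> 'a::complex_vector"
  defines csubspace = complex_vector.subspace
    and cspan = complex_vector.span
    and cdim = complex_vector.dim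
  by unfold_locales
    (simp_all add: scaleC_add_right scaleC_add_left scaleC_scaleC scaleC_one)

instantiation prod :: (complex_vector, complex_vector) complex_vector
begin

definition scaleC_prod_def: "a *\<^sub>C x = (a *\<^sub>C fst x, a *\<^sub>C snd x)"

instance
  by standard
    (simp_all add: scaleC_prod_def scaleC_add_right scaleC_add_left scaleC_scaleC scaleC_one)

end

text \<open>
  The complex inner product is linear in its first argument. Norm, distance and topology are those
  of the underlying real inner product, which is its real part.
\<close>

class complex_inner = complex_vector + real_inner +
  fixes cinner :: "'a \<Rightarrow> 'a \<Rightarrow> complex"
  assumes scaleR_scaleC: "scaleR r x = complex_of_real r *\<^sub>C x"
    and cinner_add_left: "cinner (x + y) z = cinner x z + cinner y z"
    and cinner_scaleC_left: "cinner (a *\<^sub>C x) y = a * cinner x y"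
    and cinner_commute: "cinner x y = cnj (cinner y x)"
    and Re_cinner: "Re (cinner x y) = inner x y"

class complex_hilbert = complex_inner + complete_space

section \<open>Operators on an inner product space given by a carrier\<close>

text \<open>
  The form domain of an unbounded operator carries a norm that is not the norm of the ambient
  type. The notions below therefore refer to a carrier \<open>X\<close> and an inner product \<open>ip\<close> on it. Operators
  are total functions, of which only the values on the stated domain matter.
\<close>

definition ip_norm :: "('v \<Rightarrow> 'v \<Rightarrow> complex) \<Rightarrow> 'v \<Rightarrow> real" where
  "ip_norm ip x = sqrt (Re (ip x x))"

definition dense_in :: "'v::complex_vector set \<Rightarrow> ('v \<Rightarrow> 'v \<Rightarrow> complex) \<Rightarrow> 'v set \<Rightarrow> bool" where
  "dense_in X ip D \<longleftrightarrow> D \<subseteq> X \<and> (\<forall>x\<in>X. \<forall>e>0. \<exists>y\<in>D. ip_norm ip (x - y) < e)"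

definition linear_op :: "'v::complex_vector set \<Rightarrow> 'v set \<Rightarrow> ('v \<Rightarrow> 'v) \<Rightarrow> bool" where
  "linear_op X D T \<longleftrightarrow> csubspace D \<and> D \<subseteq> X \<and> T ` D \<subseteq> X \<and>
     (\<forall>x\<in>D. \<forall>y\<in>D. T (x + y) = T x + T y) \<and> (\<forall>a. \<forall>x\<in>D. T (a *\<^sub>C x) = a *\<^sub>C T x)"

definition bounded_op :: "'v::complex_vector set \<Rightarrow> ('v \<Rightarrow> 'v \<Rightarrow> complex) \<Rightarrow> ('v \<Rightarrow> 'v) \<Rightarrow> bool" where
  "bounded_op X ip T \<longleftrightarrow> linear_op X X T \<and> (\<exists>K. \<forall>x\<in>X. ip_norm ip (T x) \<le> K * ip_norm ip x)"

definition op_norm :: "'v::complex_vector set \<Rightarrow> ('v \<Rightarrow> 'v \<Rightarrow> complex) \<Rightarrow> ('v \<Rightarrow> 'v) \<Rightarrow> real" where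
  "op_norm X ip T = (SUP x\<in>{x\<in>X. ip_norm ip x \<le> 1}. ip_norm ip (T x))"

definition adjoint_graph ::
  "'v::complex_vector set \<Rightarrow> ('v \<Rightarrow> 'v \<Rightarrow> complex) \<Rightarrow> 'v set \<Rightarrow> ('v \<Rightarrow> 'v) \<Rightarrow> ('v \<times> 'v) set" where
  "adjoint_graph X ip D T = {(y, z). y \<in> X \<and> z \<in> X \<and> (\<forall>x\<in>D. ip (T x) y = ip x z)}"

definition self_adjoint_op ::
  "'v::complex_vector set \<Rightarrow> ('v \<Rightarrow> 'v \<Rightarrow> complex) \<Rightarrow> 'v set \<Rightarrow> ('v \<Rightarrow> 'v) \<Rightarrow> bool" where
  "self_adjoint_op X ip D T \<longleftrightarrow> linear_op X D T \<and> dense_in X ip D \<and>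
     adjoint_graph X ip D T = {(x, T x) |x. x \<in> D}"

definition skew_adjoint_op ::
  "'v::complex_vector set \<Rightarrow> ('v \<Rightarrow> 'v \<Rightarrow> complex) \<Rightarrow> 'v set \<Rightarrow> ('v \<Rightarrow> 'v) \<Rightarrow> bool" where
  "skew_adjoint_op X ip D T \<longleftrightarrow> linear_op X D T \<and> dense_in X ip D \<and>
     adjoint_graph X ip D T = {(x, - T x) |x. x \<in> D}"

definition positive_op :: "('v \<Rightarrow> 'v \<Rightarrow> complex) \<Rightarrow> 'v set \<Rightarrow> ('v \<Rightarrow> 'v) \<Rightarrow> bool" where
  "positive_op ip D T \<longleftrightarrow> (\<forall>x\<in>D. ip (T x) x \<in> \<real> \<and> 0 \<le> Re (ip (T x) x))"

definition eigvals :: "'v::complex_vector set \<Rightarrow> ('v \<Rightarrow> 'v) \<Rightarrow> complex set" where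
  "eigvals D T = {z. \<exists>x\<in>D. x \<noteq> 0 \<and> T x = z *\<^sub>C x}"

text \<open>\<open>gen_kernel D T z n\<close> is the kernel of \<open>(T - z)\<^sup>n\<close>, with the domain of the power built in.\<close>

primrec gen_kernel ::
  "'v::complex_vector set \<Rightarrow> ('v \<Rightarrow> 'v) \<Rightarrow> complex \<Rightarrow> nat \<Rightarrow> 'v set" where
  "gen_kernel D T z 0 = {0}"
| "gen_kernel D T z (Suc n) = {x\<in>D. T x - z *\<^sub>C x \<in> gen_kernel D T z n}"

text \<open>Algebraic multiplicity (\<open>0\<close> if \<open>z\<close> is not an eigenvalue).\<close>

definition alg_mult :: "'v::complex_vector set \<Rightarrow> ('v \<Rightarrow> 'v) \<Rightarrow> complex \<Rightarrow> nat" where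
  "alg_mult D T z = cdim (\<Union>n. gen_kernel D T z n)"

definition ortho_proj ::
  "('v::complex_vector \<Rightarrow> 'v \<Rightarrow> complex) \<Rightarrow> 'v set \<Rightarrow> 'v \<Rightarrow> 'v" where
  "ortho_proj ip M x = (THE y. y \<in> M \<and> (\<forall>z\<in>M. ip (x - y) z = 0))"

text \<open>Unconditional convergence of a series to \<open>Y\<close> in the norm of \<open>ip\<close>.\<close>

definition ip_has_sum ::
  "'v::complex_vector set \<Rightarrow> ('v \<Rightarrow> 'v \<Rightarrow> complex) \<Rightarrow> ('i \<Rightarrow> 'v) \<Rightarrow> 'i set \<Rightarrow> 'v \<Rightarrow> bool" where
  "ip_has_sum X ip f I Y \<longleftrightarrow> Y \<in> X \<and>
     ((\<lambda>F. ip_norm ip (Y - (\<Sum>j\<in>F. f j))) \<longlongrightarrow> 0) (finite_subsets_at_top I)"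

text \<open>
  Density of the span is what distinguishes a Riesz basis of \<open>X\<close> from a mere Riesz sequence, which
  the two-sided inequality alone describes.
\<close>

definition riesz_basis ::
  "'v::complex_vector set \<Rightarrow> ('v \<Rightarrow> 'v \<Rightarrow> complex) \<Rightarrow> 'i set \<Rightarrow> ('i \<Rightarrow> 'v) \<Rightarrow> bool" where
  "riesz_basis X ip I U \<longleftrightarrow> U ` I \<subseteq> X \<and> dense_in X ip (cspan (U ` I)) \<and>
     (\<exists>m>0. \<exists>M>0. \<forall>c::'i \<Rightarrow> complex. (\<lambda>j. (cmod (c j))\<^sup>2) summable_on I \<longrightarrow>
        (\<exists>Y. ip_has_sum X ip (\<lambda>j. c j *\<^sub>C U j) I Y \<and>
             m * (\<Sum>\<^sub>\<infinity>j\<in>I. (cmod (c j))\<^sup>2) \<le> (ip_norm ip Y)\<^sup>2 \<and>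
             (ip_norm ip Y)\<^sup>2 \<le> M * (\<Sum>\<^sub>\<infinity>j\<in>I. (cmod (c j))\<^sup>2)))"

section \<open>The operators on the Hilbert space\<close>

definition unbounded_op :: "'h::complex_inner set \<Rightarrow> ('h \<Rightarrow> 'h) \<Rightarrow> bool" where
  "unbounded_op D A \<longleftrightarrow> \<not> (\<exists>K. \<forall>x\<in>D. norm (A x) \<le> K * norm x)"

definition compact_inverse :: "'h::complex_inner set \<Rightarrow> ('h \<Rightarrow> 'h) \<Rightarrow> bool" where
  "compact_inverse D A \<longleftrightarrow> bij_betw A D UNIV \<and> compact (closure (inv_into D A ` cball 0 1))"

text \<open>
  \<open>S\<close> with domain \<open>DS\<close> is the square root of the positive self-adjoint operator \<open>A\<close> with domain \<open>D\<close>,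
  that is, the unique positive self-adjoint operator with \<open>S \<circ> S = A\<close>, domains included.
\<close>

definition is_sqrt_op ::
  "'h::complex_inner set \<Rightarrow> ('h \<Rightarrow> 'h) \<Rightarrow> 'h set \<Rightarrow> ('h \<Rightarrow> 'h) \<Rightarrow> bool" where
  "is_sqrt_op DS S D A \<longleftrightarrow> self_adjoint_op UNIV cinner DS S \<and> positive_op cinner DS S \<and>
     D = {x\<in>DS. S x \<in> DS} \<and> (\<forall>x\<in>D. A x = S (S x))"

text \<open>
  \<open>\<mu>\<close> and \<open>v\<close> are indexed from \<open>1\<close>; their values at \<open>0\<close> are irrelevant.
\<close>

definition eigen_sequence ::
  "'h::complex_inner set \<Rightarrow> ('h \<Rightarrow> 'h) \<Rightarrow> (nat \<Rightarrow> real) \<Rightarrow> (nat \<Rightarrow> 'h) \<Rightarrow> bool" where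
  "eigen_sequence D A \<mu> v \<longleftrightarrow>
     eigvals D A = (\<lambda>k. complex_of_real (\<mu> k)) ` {1..} \<and>
     (\<forall>k\<ge>1. alg_mult D A (complex_of_real (\<mu> k)) = 1) \<and>
     0 < \<mu> 1 \<and> strict_mono_on {1..} \<mu> \<and> filterlim \<mu> at_top sequentially \<and>
     (\<forall>k\<ge>1. v k \<in> D \<and> norm (v k) = 1 \<and> A (v k) = complex_of_real (\<mu> k) *\<^sub>C v k)"

section \<open>The energy space, the damped system and its Galerkin truncation\<close>

text \<open>Here \<open>S\<close> is the square root of \<open>A\<close> and \<open>DS\<close> is the domain of \<open>S\<close>.\<close>

definition energy_space :: "'h set \<Rightarrow> ('h \<times> 'h) set" where
  "energy_space DS = DS \<times> UNIV"

definition energy_ip :: "('h::complex_inner \<Rightarrow> 'h) \<Rightarrow> 'h \<times> 'h \<Rightarrow> 'h \<times> 'h \<Rightarrow> complex" where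
  "energy_ip S Y Z = cinner (S (fst Y)) (S (fst Z)) + cinner (snd Y) (snd Z)"

definition wave_dom :: "'h set \<Rightarrow> 'h set \<Rightarrow> ('h \<times> 'h) set" where
  "wave_dom D DS = D \<times> DS"

definition wave_op :: "('h::complex_inner \<Rightarrow> 'h) \<Rightarrow> 'h \<times> 'h \<Rightarrow> 'h \<times> 'h" where
  "wave_op A Y = (snd Y, - A (fst Y))"

definition damped_op ::
  "('h::complex_inner \<Rightarrow> 'h) \<Rightarrow> ('h \<times> 'h \<Rightarrow> 'h \<times> 'h) \<Rightarrow> 'h \<times> 'h \<Rightarrow> 'h \<times> 'h" where
  "damped_op A B Y = wave_op A Y - B Y"

definition Zs :: "int set" where
  "Zs = {k. k \<noteq> 0}"

definition ZsN :: "nat \<Rightarrow> int set" where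
  "ZsN N = {k\<in>Zs. \<bar>k\<bar> \<le> int N}"

definition zsucc :: "int \<Rightarrow> int" where
  "zsucc k = (if k = -1 then 1 else k + 1)"

definition freq :: "(nat \<Rightarrow> real) \<Rightarrow> int \<Rightarrow> complex" where
  "freq \<mu> k = \<i> * of_int (sgn k) * complex_of_real (sqrt (\<mu> (nat \<bar>k\<bar>)))"

definition wave_mode ::
  "(nat \<Rightarrow> real) \<Rightarrow> (nat \<Rightarrow> 'h::complex_inner) \<Rightarrow> int \<Rightarrow> 'h \<times> 'h" where
  "wave_mode \<mu> v k =
     complex_of_real (1 / sqrt 2) *\<^sub>C ((1 / freq \<mu> k) *\<^sub>C v (nat \<bar>k\<bar>), v (nat \<bar>k\<bar>))"

definition galerkin_space ::
  "(nat \<Rightarrow> real) \<Rightarrow> (nat \<Rightarrow> 'h::complex_inner) \<Rightarrow> nat \<Rightarrow> ('h \<times> 'h) set" where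
  "galerkin_space \<mu> v N = cspan (wave_mode \<mu> v ` ZsN N)"

definition galerkin_op ::
  "('h::complex_inner \<Rightarrow> 'h) \<Rightarrow> ('h \<Rightarrow> 'h) \<Rightarrow> ('h \<times> 'h \<Rightarrow> 'h \<times> 'h) \<Rightarrow>
   (nat \<Rightarrow> real) \<Rightarrow> (nat \<Rightarrow> 'h) \<Rightarrow> nat \<Rightarrow> 'h \<times> 'h \<Rightarrow> 'h \<times> 'h" where
  "galerkin_op A S B \<mu> v N W =
     ortho_proj (energy_ip S) (galerkin_space \<mu> v N) (damped_op A B W)"

definition damped_spectrum ::
  "'h::complex_inner set \<Rightarrow> ('h \<Rightarrow> 'h) \<Rightarrow> 'h set \<Rightarrow> ('h \<Rightarrow> 'h) \<Rightarrow> ('h \<times> 'h \<Rightarrow> 'h \<times> 'h) \<Rightarrow>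
   (int \<Rightarrow> complex) \<Rightarrow> (int \<Rightarrow> 'h \<times> 'h) \<Rightarrow> bool" where
  "damped_spectrum D A DS S B \<nu> U \<longleftrightarrow>
     eigvals (wave_dom D DS) (damped_op A B) = \<nu> ` Zs \<and>
     (\<forall>k\<in>Zs. U k \<in> wave_dom D DS \<and> ip_norm (energy_ip S) (U k) = 1 \<and>
              damped_op A B (U k) = \<nu> k *\<^sub>C U k) \<and>
     (\<forall>k\<in>Zs. Im (\<nu> k) \<le> Im (\<nu> (zsucc k)) \<and>
              (Im (\<nu> k) = Im (\<nu> (zsucc k)) \<longrightarrow> cmod (\<nu> (zsucc k)) \<le> cmod (\<nu> k)))"

definition galerkin_spectrum ::
  "('h::complex_inner \<Rightarrow> 'h) \<Rightarrow> ('h \<Rightarrow> 'h) \<Rightarrow> ('h \<times> 'h \<Rightarrow> 'h \<times> 'h) \<Rightarrow>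
   (nat \<Rightarrow> real) \<Rightarrow> (nat \<Rightarrow> 'h) \<Rightarrow> nat \<Rightarrow> (int \<Rightarrow> complex) \<Rightarrow> bool" where
  "galerkin_spectrum A S B \<mu> v N \<eta> \<longleftrightarrow>
     (\<forall>z. card {k\<in>ZsN N. \<eta> k = z} = alg_mult (galerkin_space \<mu> v N) (galerkin_op A S B \<mu> v N) z) \<and>
     (\<forall>k\<in>ZsN N. zsucc k \<in> ZsN N \<longrightarrow> Im (\<eta> k) \<le> Im (\<eta> (zsucc k)))"

end

theory Submission
  imports Defs
begin

text \<open>
  Write \<open>\<beta>\<close> for the norm of the damping, and \<open>\<lambda>\<^sub>k\<close> for the undamped eigenvalues. The square root of
  \<open>A\<close> identifies the energy space isometrically with \<open>H \<times> H\<close>, and there the modes become an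
  orthonormal basis: completeness is inherited from the eigenvectors of \<open>A\<close>, which are total because
  \<open>A\<close> has a compact inverse (\<open>eigen_sequence_total\<close>). In these coordinates the wave operator is
  diagonal and only the bounded damping couples the modes.

  Localisation. A nonnegative quadratic form on a complex space belongs to a self-adjoint operator, so
  \<open>B - \<beta>/2\<close> has norm at most \<open>\<beta>/2\<close>. An eigenvalue of the damped operator, or of a Galerkin
  truncation, therefore lies in one of the closed discs of radius \<open>3\<beta>/4\<close> about \<open>\<lambda>\<^sub>k - \<beta>/2\<close>
  (\<open>eigenvalue_in_disc\<close>). The \<open>\<lambda>\<^sub>k\<close> are at least \<open>2\<beta>\<close> apart, so different discs are separated by
  \<open>\<beta>/2\<close>. No disc holds two eigenvalues, even counted with multiplicity
  (\<open>at_most_one_eigenvalue_per_disc\<close>): a two-dimensional invariant subspace with spectrum in one disc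
  would be negative for the form \<open>\<parallel>x\<parallel>\<^sup>2 - 2\<bar>\<langle>x, e\<^sub>k\<rangle>\<bar>\<^sup>2\<close>, yet it contains a vector orthogonal to \<open>e\<^sub>k\<close>.
  By counting and ordering, the Galerkin eigenvalue with index \<open>p\<close> sits in the disc with index \<open>p\<close>.

  Approximation. An eigenvector of the truncation for the index \<open>p\<close> is concentrated on modes near \<open>p\<close>,
  because the other frequencies are far from the eigenvalue. If \<open>p\<close> stays away from the truncation
  index \<open>N\<close>, the off-diagonal decay of the damping makes the neglected component beyond \<open>N\<close> small
  (\<open>galerkin_residual_small\<close>). A Riesz basis of eigenvectors turns a small residual into a small
  distance to the spectrum (\<open>resolvent_bound_riesz_basis\<close>). This gives the first claim.

  Reversal. A distance of at most \<open>\<beta>/4\<close> forces both eigenvalues into the same disc, which contains a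
  single \<open>\<nu>\<close>. So the pairing works in both directions, once indices are matched: \<open>\<nu>\<^sub>j\<close> lies in the disc
  with some index \<open>\<sigma>(j)\<close>, where \<open>\<sigma>\<close> is monotone and onto, and such a map moves indices away from \<open>0\<close>
  by a bounded amount only. This bound is absorbed in \<open>r\<close>.

  All estimates are proportional to \<open>\<beta>\<close>, so that the undamped case, where discs degenerate to points
  and the gaps between them need not have a positive lower bound, is covered as well.
\<close>

section \<open>Complex inner product spaces\<close>

lemma cinner_add_right: "cinner x (y + z) = cinner x y + cinner x (z::'a::complex_inner)"
  by (metis cinner_add_left cinner_commute complex_cnj_add)

lemma cinner_scaleC_right: "cinner x (a *\<^sub>C y) = cnj a * cinner x (y::'a::complex_inner)"
  by (metis cinner_commute cinner_scaleC_left complex_cnj_mult)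

lemma cinner_zero_left [simp]: "cinner 0 (x::'a::complex_inner) = 0"
  by (metis add_cancel_right_left cinner_add_left)

lemma cinner_zero_right [simp]: "cinner (x::'a::complex_inner) 0 = 0"
  by (metis cinner_commute cinner_zero_left complex_cnj_zero)

lemma cinner_minus_left: "cinner (- x) (y::'a::complex_inner) = - cinner x y"
  by (metis add.right_inverse cinner_add_left cinner_zero_left add_eq_0_iff)

lemma cinner_minus_right: "cinner x (- y) = - cinner x (y::'a::complex_inner)"
  by (metis cinner_commute cinner_minus_left complex_cnj_minus)

lemma cinner_diff_left: "cinner (x - y) (z::'a::complex_inner) = cinner x z - cinner y z"
  by (metis cinner_add_left cinner_minus_left diff_conv_add_uminus)

lemma cinner_diff_right: "cinner x (y - z) = cinner x y - cinner x (z::'a::complex_inner)"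
  by (metis cinner_add_right cinner_minus_right diff_conv_add_uminus)

lemmas cinner_expand = cinner_add_left cinner_add_right cinner_diff_left cinner_diff_right
  cinner_scaleC_left cinner_scaleC_right

lemma cinner_sum_left: "cinner (\<Sum>i\<in>I. f i) (y::'a::complex_inner) = (\<Sum>i\<in>I. cinner (f i) y)"
  by (induction I rule: infinite_finite_induct) (auto simp: cinner_add_left)

lemma cinner_self: "cinner x x = complex_of_real ((norm (x::'a::complex_inner))\<^sup>2)"
proof (rule complex_eqI)
  show "Re (cinner x x) = Re (complex_of_real ((norm x)\<^sup>2))"
    by (simp add: Re_cinner power2_norm_eq_inner)
  have "Im (cinner x x) = - Im (cinner x x)"
    by (metis cinner_commute cnj.simps(2))
  then show "Im (cinner x x) = Im (complex_of_real ((norm x)\<^sup>2))" by simp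
qed

lemma norm_scaleC: "norm (a *\<^sub>C x) = cmod a * norm (x::'a::complex_inner)"
proof -
  have "complex_of_real ((norm (a *\<^sub>C x))\<^sup>2) = cinner (a *\<^sub>C x) (a *\<^sub>C x)"
    by (rule cinner_self[symmetric])
  also have "\<dots> = complex_of_real ((cmod a * norm x)\<^sup>2)"
    unfolding cinner_scaleC_left cinner_scaleC_right cinner_self[of x]
    using complex_norm_square[of a] by (simp add: power_mult_distrib mult_ac)
  finally have "complex_of_real ((norm (a *\<^sub>C x))\<^sup>2) = complex_of_real ((cmod a * norm x)\<^sup>2)" .
  then show ?thesis
    by (metis norm_ge_zero of_real_eq_iff power2_eq_imp_eq zero_le_mult_iff)
qed

lemma cmod_cinner_le: "cmod (cinner x y) \<le> norm x * norm (y::'a::complex_inner)"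
proof (cases "cinner x y = 0")
  case False
  define u where "u = cnj (cinner x y) / complex_of_real (cmod (cinner x y))"
  have u: "cmod u = 1" using False by (simp add: u_def norm_divide)
  have "u * cinner x y = complex_of_real (cmod (cinner x y))"
    using False complex_norm_square[of "cinner x y"]
    by (simp add: u_def field_simps power2_eq_square)
  then have "cmod (cinner x y) = Re (cinner (u *\<^sub>C x) y)"
    by (simp add: cinner_scaleC_left)
  also have "\<dots> \<le> norm (u *\<^sub>C x) * norm y" unfolding Re_cinner by (rule norm_cauchy_schwarz)
  finally show ?thesis by (simp add: norm_scaleC u)
qed simp

lemma tendsto_cinner_left:
  assumes "(f \<longlongrightarrow> l) F" shows "((\<lambda>n. cinner (f n) (y::'a::complex_inner)) \<longlongrightarrow> cinner l y) F"
proof -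
  have 1: "((\<lambda>n. norm (f n - l) * norm y) \<longlongrightarrow> 0) F"
    using tendsto_mult_left_zero[OF tendsto_norm_zero[OF LIM_zero[OF assms]]] .
  have "((\<lambda>n. cinner (f n) y - cinner l y) \<longlongrightarrow> 0) F"
    by (rule Lim_null_comparison[OF _ 1])
      (simp add: cinner_diff_left[symmetric] cmod_cinner_le)
  then show ?thesis by (rule LIM_zero_cancel)
qed

lemma tendsto_cinner_right:
  assumes "(f \<longlongrightarrow> l) F" shows "((\<lambda>n. cinner (y::'a::complex_inner) (f n)) \<longlongrightarrow> cinner y l) F"
  using tendsto_cnj[OF tendsto_cinner_left[OF assms, of y]] by (simp add: cinner_commute[of y])

instantiation prod :: (complex_inner, complex_inner) complex_inner
begin

definition cinner_prod_def: "cinner x y = cinner (fst x) (fst y) + cinner (snd x) (snd y)"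

instance
proof
  fix x y z :: "'a \<times> 'b" and a :: complex and r :: real
  show "r *\<^sub>R x = complex_of_real r *\<^sub>C x"
    by (simp add: scaleR_prod_def scaleC_prod_def scaleR_scaleC)
  show "cinner (x + y) z = cinner x z + cinner y z"
    by (simp add: cinner_prod_def cinner_add_left)
  show "cinner (a *\<^sub>C x) y = a * cinner x y"
    by (simp add: cinner_prod_def scaleC_prod_def cinner_scaleC_left algebra_simps)
  show "cinner x y = cnj (cinner y x)"
    by (simp add: cinner_prod_def cinner_commute[of "fst x"] cinner_commute[of "snd x"])
  show "Re (cinner x y) = inner x y"
    by (simp add: cinner_prod_def inner_prod_def Re_cinner)
qed

end

instance prod :: (complex_hilbert, complex_hilbert) complex_hilbert ..

section \<open>Positive operators\<close>

text \<open>
  The quadratic form is nonnegative along the line through \<open>x\<close> in the direction of \<open>T x\<close>. Evaluating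
  it at the step \<open>-1/C\<close> gives the estimate.
\<close>

lemma norm_sq_le_psd_form:
  fixes T :: "'a::real_inner \<Rightarrow> 'a"
  assumes M: "subspace M" and TM: "\<And>x. x \<in> M \<Longrightarrow> T x \<in> M"
    and add: "\<And>x y. x \<in> M \<Longrightarrow> y \<in> M \<Longrightarrow> T (x + y) = T x + T y"
    and scale: "\<And>r x. x \<in> M \<Longrightarrow> T (r *\<^sub>R x) = r *\<^sub>R T x"
    and sym: "\<And>x y. x \<in> M \<Longrightarrow> y \<in> M \<Longrightarrow> inner (T x) y = inner x (T y)"
    and pos: "\<And>x. x \<in> M \<Longrightarrow> 0 \<le> inner (T x) x"
    and bd: "\<And>x. x \<in> M \<Longrightarrow> norm (T x) \<le> C * norm x"
    and x: "x \<in> M"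
  shows "(norm (T x))\<^sup>2 \<le> C * inner (T x) x"
proof (cases "C > 0")
  case True
  define y where "y = T x"
  define t where "t = - (1 / C)"
  have y: "y \<in> M" unfolding y_def by (rule TM[OF x])
  have ty: "t *\<^sub>R y \<in> M" using M y by (simp add: subspace_scale)
  have "0 \<le> inner (T (x + t *\<^sub>R y)) (x + t *\<^sub>R y)"
    using M x ty by (intro pos) (simp add: subspace_add)
  also have "\<dots> = inner (T x) x + 2 * t * inner (T x) y + t\<^sup>2 * inner (T y) y"
    using add[OF x ty] scale[OF y, of t] sym[OF x y]
    by (simp add: inner_add_left inner_add_right power2_eq_square inner_commute[of x] algebra_simps)
  also have "inner (T y) y \<le> C * (norm y)\<^sup>2"
    using norm_cauchy_schwarz[of "T y" y] mult_right_mono[OF bd[OF y], of "norm y"]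
    by (simp add: power2_eq_square algebra_simps)
  finally have "0 \<le> inner (T x) x + 2 * t * inner (T x) y + t\<^sup>2 * (C * (norm y)\<^sup>2)"
    by (simp add: mult_left_mono)
  also have "\<dots> = inner (T x) x - (norm y)\<^sup>2 / C"
    using True by (simp add: t_def y_def dot_square_norm field_simps power2_eq_square)
  finally show ?thesis using True by (simp add: y_def field_simps)
next
  case False
  then have "C * norm x \<le> 0" by (simp add: mult_nonpos_nonneg)
  then have "T x = 0" using bd[OF x] by (metis norm_le_zero_iff order_trans)
  then show ?thesis by simp
qed

text \<open>
  Polarisation at \<open>x + \<i>y\<close>; this is where complex scalars matter, since over the reals every quadratic
  form is real.
\<close>

lemma inner_symmetric_if_real_form:
  fixes T :: "'a::complex_inner \<Rightarrow> 'a"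
  assumes add: "\<And>x y. T (x + y) = T x + T y" and scale: "\<And>a x. T (a *\<^sub>C x) = a *\<^sub>C T x"
    and real: "\<And>x. cinner (T x) x \<in> \<real>"
  shows "inner (T x) y = inner x (T y)"
proof -
  have "Im (cinner (T (x + \<i> *\<^sub>C y)) (x + \<i> *\<^sub>C y)) = 0" "Im (cinner (T x) x) = 0" "Im (cinner (T y) y) = 0"
    using real complex_is_Real_iff by blast+
  then have "Re (cinner (T y) x) = Re (cinner (T x) y)"
    by (simp add: add scale cinner_expand)
  then show ?thesis by (simp add: Re_cinner inner_commute)
qed

section \<open>An indefinite form that separates one eigendirection\<close>

text \<open>
  For a unit vector \<open>e\<close> this is the squared norm of the part of \<open>x\<close> orthogonal to \<open>e\<close> minus the squared
  norm of the part along \<open>e\<close>. It is negative definite on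
  subspaces of dimension at most one only.
\<close>

definition cone_form :: "'a::complex_inner \<Rightarrow> 'a \<Rightarrow> real" where
  "cone_form e x = (norm x)\<^sup>2 - 2 * (cmod (cinner x e))\<^sup>2"

text \<open>
  The sesquilinear form whose diagonal is \<open>cone_form e\<close>.
\<close>

definition cone_pairing :: "'a::complex_inner \<Rightarrow> 'a \<Rightarrow> 'a \<Rightarrow> complex" where
  "cone_pairing e x y = cinner x y - 2 * cinner x e * cinner e y"

lemma cone_pairing_self: "cone_pairing e x x = complex_of_real (cone_form e x)"
  unfolding cone_pairing_def cone_form_def
  by (simp add: cinner_self cinner_commute[of e x] complex_norm_square mult.assoc del: of_real_power)

lemma cone_pairing_commute: "cone_pairing e x y = cnj (cone_pairing e y x)"
  unfolding cone_pairing_def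
  by (simp add: cinner_commute[of x y] cinner_commute[of x e] cinner_commute[of e y])

lemma cone_pairing_diff_left: "cone_pairing e (x - a *\<^sub>C y) z = cone_pairing e x z - a * cone_pairing e y z"
  unfolding cone_pairing_def by (simp add: cinner_expand algebra_simps)

lemma cone_form_orthogonal:
  assumes "cone_pairing e x y = 0"
  shows "cone_form e (a *\<^sub>C x + b *\<^sub>C y) = (cmod a)\<^sup>2 * cone_form e x + (cmod b)\<^sup>2 * cone_form e y"
proof -
  have yx: "cone_pairing e y x = 0" using assms cone_pairing_commute[of e y x] by simp
  have "cone_pairing e (a *\<^sub>C x + b *\<^sub>C y) (a *\<^sub>C x + b *\<^sub>C y) =
      a * cnj a * cone_pairing e x x + b * cnj b * cone_pairing e y y
      + a * cnj b * cone_pairing e x y + b * cnj a * cone_pairing e y x"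
    unfolding cone_pairing_def by (simp add: cinner_expand algebra_simps)
  then have "complex_of_real (cone_form e (a *\<^sub>C x + b *\<^sub>C y)) =
     complex_of_real ((cmod a)\<^sup>2 * cone_form e x + (cmod b)\<^sup>2 * cone_form e y)"
    using assms yx by (simp add: cone_pairing_self complex_norm_square del: of_real_power)
  then show ?thesis using of_real_eq_iff by blast
qed

text \<open>
  Here \<open>z\<close> stands for the image of \<open>x\<close> under a normal operator with \<open>e\<close> in its kernel and a spectral gap
  \<open>g\<close> at \<open>0\<close>, and \<open>b\<close> for the image of \<open>x\<close> under a perturbation of norm at most \<open>g/4\<close>. Completing the square
  bounds the form of \<open>z - b\<close> below by \<open>\<parallel>z\<parallel>\<^sup>2/2 - \<parallel>b\<parallel>\<^sup>2\<close>; the constants then leave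
  \<open>3g\<^sup>2\<parallel>x\<parallel>\<^sup>2/16\<close> to spare.
\<close>

lemma cone_form_expansion:
  fixes e x z b :: "'a::complex_inner"
  assumes e: "norm e = 1" and g: "g > 0" and x: "x \<noteq> 0" and ze: "cinner z e = 0"
    and z: "g * norm (x - cinner x e *\<^sub>C e) \<le> norm z" and b: "norm b \<le> g / 4 * norm x"
  shows "(g / 2)\<^sup>2 * cone_form e x < cone_form e (z - b)"
proof -
  have ee: "cinner e e = 1" by (simp add: cinner_self e)
  have split: "(norm (y - cinner y e *\<^sub>C e))\<^sup>2 = (norm y)\<^sup>2 - (cmod (cinner y e))\<^sup>2" for y
  proof -
    have "complex_of_real ((norm (y - cinner y e *\<^sub>C e))\<^sup>2) =
        complex_of_real ((norm y)\<^sup>2 - (cmod (cinner y e))\<^sup>2)"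
      unfolding cinner_self[symmetric] of_real_diff
      by (simp add: cinner_expand ee cinner_commute[of e y] complex_norm_square algebra_simps
          del: of_real_power)
    then show ?thesis using of_real_eq_iff by blast
  qed
  define b' where "b' = b - cinner b e *\<^sub>C e"
  define x' where "x' = x - cinner x e *\<^sub>C e"
  have zb: "inner z b' = inner z b"
  proof -
    have "cinner z b' = cinner z b" by (simp add: b'_def cinner_expand ze)
    then show ?thesis by (metis Re_cinner)
  qed
  have e1: "(norm (z - b))\<^sup>2 = (norm z)\<^sup>2 - 2 * inner z b + (norm b)\<^sup>2"
    by (simp add: power2_norm_eq_inner inner_diff_left inner_diff_right inner_commute[of b z])
  have e2: "(norm (z - 2 *\<^sub>R b'))\<^sup>2 = (norm z)\<^sup>2 - 4 * inner z b' + 4 * (norm b')\<^sup>2"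
    by (simp add: power2_norm_eq_inner inner_diff_left inner_diff_right inner_commute[of b' z])
  have "cone_form e (z - b) = (norm (z - b))\<^sup>2 - 2 * (cmod (cinner b e))\<^sup>2"
    by (simp add: cone_form_def cinner_diff_left ze)
  also have "\<dots> = (norm z)\<^sup>2 / 2 + (norm (z - 2 *\<^sub>R b'))\<^sup>2 / 2 - (norm b)\<^sup>2"
    using split[of b] zb e1 e2 by (simp add: b'_def[symmetric] field_simps)
  also have "\<dots> \<ge> (norm z)\<^sup>2 / 2 - (norm b)\<^sup>2" by simp
  finally have 1: "(norm z)\<^sup>2 / 2 - (norm b)\<^sup>2 \<le> cone_form e (z - b)" .
  have 2: "g\<^sup>2 * (norm x')\<^sup>2 \<le> (norm z)\<^sup>2"
    using power_mono[OF z[folded x'_def], of 2] g by (simp add: power_mult_distrib)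
  have 3: "(norm b)\<^sup>2 \<le> g\<^sup>2 / 16 * (norm x)\<^sup>2"
    using power_mono[OF b, of 2] by (simp add: power_mult_distrib power_divide)
  have x': "(norm x)\<^sup>2 = (norm x')\<^sup>2 + (cmod (cinner x e))\<^sup>2"
    using split[of x] by (simp add: x'_def)
  have "0 < g\<^sup>2 * (norm x)\<^sup>2 * (3 / 16)" using g x by simp
  also have "\<dots> = g\<^sup>2 * (norm x')\<^sup>2 / 2 - g\<^sup>2 / 16 * (norm x)\<^sup>2 - (g / 2)\<^sup>2 * cone_form e x"
    unfolding cone_form_def x' by (simp add: power2_eq_square algebra_simps)
  finally show ?thesis using 1 2 3 by linarith
qed

text \<open>
  The hypotheses describe the plane spanned by \<open>w1\<close> and \<open>w2\<close> as invariant under an operator with upper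
  triangular matrix (diagonal \<open>l1\<close>, \<open>l2\<close>) that expands the form by more than \<open>\<theta>\<^sup>2\<close>. This is a discrete
  Lyapunov argument. An eigenvector with \<open>\<bar>l\<bar> \<le> \<theta>\<close> must have negative form. Replacing \<open>w2\<close> by its
  component orthogonal to \<open>w1\<close> with respect to the form keeps the triangular shape, so the same
  reasoning makes the form negative on the whole plane.
\<close>

lemma no_slow_plane:
  fixes e w1 w2 :: "'a::complex_inner"
  assumes w1: "w1 \<noteq> 0" and w2: "w2 \<notin> cspan {w1}"
    and l1: "cmod l1 \<le> \<theta>" and l2: "cmod l2 \<le> \<theta>"
    and expand: "\<And>a b. a *\<^sub>C w1 + b *\<^sub>C w2 \<noteq> 0 \<Longrightarrow>
        \<theta>\<^sup>2 * cone_form e (a *\<^sub>C w1 + b *\<^sub>C w2)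
          < cone_form e (a *\<^sub>C l1 *\<^sub>C w1 + b *\<^sub>C (l2 *\<^sub>C w2 + c *\<^sub>C w1))"
  shows False
proof -
  have neg: "h < 0" if "cmod l \<le> \<theta>" "k \<le> 0" "\<theta>\<^sup>2 * h < (cmod l)\<^sup>2 * h + k" for l :: complex and h k :: real
  proof (rule ccontr)
    assume "\<not> h < 0"
    then have "(cmod l)\<^sup>2 * h \<le> \<theta>\<^sup>2 * h"
      using that(1) by (intro mult_right_mono power_mono) auto
    then show False using that by linarith
  qed
  have h0: "cone_form e (a *\<^sub>C x) = (cmod a)\<^sup>2 * cone_form e x" for a x
    by (simp add: cone_form_def norm_scaleC cinner_scaleC_left norm_mult power_mult_distrib algebra_simps)
  have h1: "cone_form e w1 < 0"
    using expand[of 1 0] w1 by (intro neg[OF l1, of 0]) (auto simp: scaleC_one h0)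
  define t where "t = cone_pairing e w2 w1 / cone_pairing e w1 w1"
  define u where "u = w2 - t *\<^sub>C w1"
  have u_span: "u \<noteq> 0"
  proof
    assume "u = 0"
    then have "w2 = t *\<^sub>C w1" by (simp add: u_def)
    then show False using w2 complex_vector.span_breakdown_eq complex_vector.span_base complex_vector.span_scale
      by (metis insertI1)
  qed
  have ort: "cone_pairing e u w1 = 0"
    using h1 by (simp add: u_def cone_pairing_diff_left t_def cone_pairing_self)
  have u_eq: "u = (- t) *\<^sub>C w1 + 1 *\<^sub>C w2"
    by (simp add: u_def scaleC_one)
  have Lu: "(- t) *\<^sub>C l1 *\<^sub>C w1 + 1 *\<^sub>C (l2 *\<^sub>C w2 + c *\<^sub>C w1) = l2 *\<^sub>C u + (c + t * l2 - t * l1) *\<^sub>C w1"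
    by (simp add: u_def scaleC_one scaleC_scaleC complex_vector.scale_left_diff_distrib
        complex_vector.scale_right_diff_distrib complex_vector.scale_left_distrib algebra_simps)
  have "\<theta>\<^sup>2 * cone_form e u < cone_form e (l2 *\<^sub>C u + (c + t * l2 - t * l1) *\<^sub>C w1)"
    using expand[of "- t" 1] u_span unfolding u_eq[symmetric] Lu by simp
  then have h2: "cone_form e u < 0"
    using h1 by (intro neg[OF l2, of "(cmod (c + t * l2 - t * l1))\<^sup>2 * cone_form e w1"])
      (auto simp: cone_form_orthogonal[OF ort] mult_nonneg_nonpos)
  \<comment> \<open>The plane meets the orthogonal complement of \<open>e\<close>, where the form is the squared norm.\<close>
  define a where "a = - cinner u e"
  define b where "b = cinner w1 e"
  have b: "b \<noteq> 0" using h1 by (auto simp: b_def cone_form_def)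
  have "cinner (b *\<^sub>C u + a *\<^sub>C w1) e = 0"
    by (simp add: a_def b_def cinner_expand)
  then have "0 \<le> cone_form e (b *\<^sub>C u + a *\<^sub>C w1)" by (simp add: cone_form_def)
  moreover have "(cmod b)\<^sup>2 * cone_form e u < 0" using b h2 by (simp add: mult_pos_neg)
  moreover have "(cmod a)\<^sup>2 * cone_form e w1 \<le> 0" using h1 by (simp add: mult_nonneg_nonpos)
  ultimately show False by (simp add: cone_form_orthogonal[OF ort])
qed

section \<open>The index set of nonzero integers\<close>

lemma finite_ZsN [simp]: "finite (ZsN N)"
  by (rule finite_subset[of _ "{- int N..int N}"]) (auto simp: ZsN_def)

lemma ZsN_subset: "ZsN N \<subseteq> Zs"
  by (auto simp: ZsN_def)

lemma zsucc_in_Zs: "k \<in> Zs \<Longrightarrow> zsucc k \<in> Zs"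
  by (auto simp: zsucc_def Zs_def)

lemma zsucc_gt: "k < zsucc k"
  by (auto simp: zsucc_def)

lemma zsucc_le: "j \<in> Zs \<Longrightarrow> k < j \<Longrightarrow> zsucc k \<le> j"
  by (auto simp: zsucc_def Zs_def)

text \<open>
  Induction along the successor function that jumps over \<open>0\<close>.
\<close>

lemma Zs_interval_induct [consumes 3, case_names base step]:
  assumes "j \<in> Zs" "k \<in> Zs" "j \<le> k" and base: "P j"
    and step: "\<And>i. i \<in> Zs \<Longrightarrow> j \<le> i \<Longrightarrow> i < k \<Longrightarrow> P i \<Longrightarrow> P (zsucc i)"
  shows "P k"
proof -
  have "m \<le> k \<longrightarrow> (m \<noteq> 0 \<longrightarrow> P m) \<and> (m = 0 \<longrightarrow> P (-1))" if "j \<le> m" for m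
    using that
  proof (induction m rule: int_ge_induct)
    case base
    then show ?case using assms(1) \<open>P j\<close> by (auto simp: Zs_def)
  next
    case (step m)
    show ?case
    proof -
      consider "m = 0" | "m = -1" | "m \<noteq> 0" "m \<noteq> -1" by blast
      then show ?thesis
      proof cases
        case 1
        then have "P (zsucc (-1))" if "m + 1 \<le> k"
          using step assms(1) that by (intro assms(5)) (auto simp: Zs_def)
        then show ?thesis using 1 by (auto simp: zsucc_def)
      next
        case 2
        then show ?thesis using step by auto
      next
        case 3
        then have "P (zsucc m)" if "m + 1 \<le> k"
          using step that by (intro assms(5)) (auto simp: Zs_def)
        then show ?thesis using 3 by (auto simp: zsucc_def)
      qed
    qed
  qed
  then show ?thesis using assms(2,3) by (auto simp: Zs_def)
qed

lemma monotone_from_zsucc: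
  fixes f :: "int \<Rightarrow> real"
  assumes "j \<in> Zs" "k \<in> Zs" "j \<le> k"
    and "\<And>i. i \<in> Zs \<Longrightarrow> j \<le> i \<Longrightarrow> i < k \<Longrightarrow> f i \<le> f (zsucc i)"
  shows "f j \<le> f k"
  using assms(1-3) by (induction rule: Zs_interval_induct) (auto intro: assms(4) order_trans)

text \<open>
  If \<open>\<tau>\<close> moved \<open>p\<close> down, it would embed the elements below \<open>p\<close> into the smaller set of elements below
  \<open>\<tau> p\<close>; moving up is excluded symmetrically.
\<close>

lemma strict_mono_self_map_eq_id:
  fixes \<tau> :: "int \<Rightarrow> int"
  assumes F: "finite F" and maps: "\<And>p. p \<in> F \<Longrightarrow> \<tau> p \<in> F"
    and mono: "\<And>p q. p \<in> F \<Longrightarrow> q \<in> F \<Longrightarrow> p < q \<Longrightarrow> \<tau> p < \<tau> q" and p: "p \<in> F"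
  shows "\<tau> p = p"
proof -
  have inj: "inj_on \<tau> F"
    by (rule linorder_inj_onI) (use mono in \<open>auto simp: less_imp_neq\<close>)
  have "\<not> \<tau> p < p"
  proof
    assume l: "\<tau> p < p"
    have "\<tau> ` {q\<in>F. q < p} \<subseteq> {q\<in>F. q < \<tau> p}" using maps mono p by auto
    then have "card {q\<in>F. q < p} \<le> card {q\<in>F. q < \<tau> p}"
      using card_inj_on_le[of \<tau> "{q\<in>F. q < p}"] F inj by (simp add: inj_on_subset)
    moreover have "{q\<in>F. q < \<tau> p} \<subset> {q\<in>F. q < p}" using l maps[OF p] by auto
    then have "card {q\<in>F. q < \<tau> p} < card {q\<in>F. q < p}" using F by (intro psubset_card_mono) auto
    ultimately show False by simp
  qed
  moreover have "\<not> p < \<tau> p"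
  proof
    assume l: "p < \<tau> p"
    have "\<tau> ` {q\<in>F. p < q} \<subseteq> {q\<in>F. \<tau> p < q}" using maps mono p by auto
    then have "card {q\<in>F. p < q} \<le> card {q\<in>F. \<tau> p < q}"
      using card_inj_on_le[of \<tau> "{q\<in>F. p < q}"] F inj by (simp add: inj_on_subset)
    moreover have "{q\<in>F. \<tau> p < q} \<subset> {q\<in>F. p < q}" using l maps[OF p] by auto
    then have "card {q\<in>F. \<tau> p < q} < card {q\<in>F. p < q}" using F by (intro psubset_card_mono) auto
    ultimately show False by simp
  qed
  ultimately show ?thesis by simp
qed

text \<open>
  The values between \<open>\<sigma> p\<close> and \<open>\<sigma> q\<close> are all attained between \<open>p\<close> and \<open>q\<close>, so \<open>\<sigma>\<close> cannot grow faster than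
  the identity. The extra \<open>1\<close> in the count accounts for the missing value \<open>0\<close>.
\<close>

lemma monotone_surjection_shift_bound:
  fixes \<sigma> :: "int \<Rightarrow> int"
  assumes maps: "\<And>p. p \<in> Zs \<Longrightarrow> \<sigma> p \<in> Zs"
    and mono: "\<And>p q. p \<in> Zs \<Longrightarrow> q \<in> Zs \<Longrightarrow> p \<le> q \<Longrightarrow> \<sigma> p \<le> \<sigma> q"
    and surj: "\<And>k. k \<in> Zs \<Longrightarrow> \<exists>p\<in>Zs. \<sigma> p = k"
  shows "\<exists>C::nat. \<forall>p\<in>Zs. \<bar>\<sigma> p\<bar> \<le> \<bar>p\<bar> + int C"
proof -
  define C where "C = nat (\<bar>\<sigma> 1\<bar> + \<bar>\<sigma> (-1)\<bar> + 1)"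
  have count: "\<sigma> q - \<sigma> p \<le> q - p + 1" if pq: "p \<in> Zs" "q \<in> Zs" "p \<le> q" for p q
  proof -
    have "{\<sigma> p..\<sigma> q} - {0} \<subseteq> \<sigma> ` {p..q}"
    proof
      fix k assume k: "k \<in> {\<sigma> p..\<sigma> q} - {0}"
      then obtain t where t: "t \<in> Zs" "\<sigma> t = k" using surj[of k] by (auto simp: Zs_def)
      show "k \<in> \<sigma> ` {p..q}"
      proof (cases "t \<in> {p..q}")
        case False
        then have "t \<le> p \<or> q \<le> t" by auto
        then have "k = \<sigma> p \<or> k = \<sigma> q" using mono[of t p] mono[of q t] t pq k by auto
        then show ?thesis using pq by auto
      qed (use t in auto)
    qed
    then have "card ({\<sigma> p..\<sigma> q} - {0}) \<le> card {p..q}"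
      by (meson card_image_le card_mono finite_atLeastAtMost_int finite_imageI order_trans)
    moreover have "card {\<sigma> p..\<sigma> q} \<le> card ({\<sigma> p..\<sigma> q} - {0}) + 1"
      by (simp add: card_Diff_singleton_if)
    ultimately show ?thesis using pq mono[OF pq] by auto
  qed
  have "\<bar>\<sigma> p\<bar> \<le> \<bar>p\<bar> + int C" if p: "p \<in> Zs" for p
  proof (cases "p > 0")
    case True
    then show ?thesis using count[of 1 p] mono[of 1 p] p by (auto simp: C_def Zs_def)
  next
    case False
    then show ?thesis using count[of p "-1"] mono[of p "-1"] p by (auto simp: C_def Zs_def)
  qed
  then show ?thesis by blast
qed

section \<open>Orthonormal bases indexed by the nonzero integers\<close>

locale orthonormal_basis =
  fixes e :: "int \<Rightarrow> 'a::complex_hilbert"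
  assumes ortho: "j \<in> Zs \<Longrightarrow> k \<in> Zs \<Longrightarrow> cinner (e j) (e k) = (if j = k then 1 else 0)"
    and total: "(\<And>k. k \<in> Zs \<Longrightarrow> cinner x (e k) = 0) \<Longrightarrow> x = 0"
begin

definition part :: "int set \<Rightarrow> 'a \<Rightarrow> 'a" where
  "part F x = (\<Sum>k\<in>F. cinner x (e k) *\<^sub>C e k)"

lemma norm_basis: "k \<in> Zs \<Longrightarrow> norm (e k) = 1"
proof -
  assume "k \<in> Zs"
  then have "complex_of_real ((norm (e k))\<^sup>2) = complex_of_real 1"
    using ortho[of k k] by (simp only: cinner_self) simp
  then show ?thesis unfolding of_real_eq_iff by (simp add: power2_eq_1_iff) (smt (verit) norm_ge_zero)
qed

lemma coeff_part:
  assumes "finite F" "F \<subseteq> Zs" "k \<in> Zs"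
  shows "cinner (part F x) (e k) = (if k \<in> F then cinner x (e k) else 0)"
proof -
  have "cinner (part F x) (e k) = (\<Sum>j\<in>F. if j = k then cinner x (e k) else 0)"
    unfolding part_def cinner_sum_left
    by (rule sum.cong) (use assms ortho in \<open>auto simp: cinner_scaleC_left\<close>)
  then show ?thesis using assms by simp
qed

lemma cinner_part:
  assumes "finite F" "F \<subseteq> Zs"
  shows "cinner (part F x) y = (\<Sum>k\<in>F. cinner x (e k) * cnj (cinner y (e k)))"
  unfolding part_def cinner_sum_left cinner_scaleC_left cinner_commute[of "e _" y] ..

lemma norm_part_sq:
  assumes "finite F" "F \<subseteq> Zs"
  shows "(norm (part F x))\<^sup>2 = (\<Sum>k\<in>F. (cmod (cinner x (e k)))\<^sup>2)"
proof -
  have "cinner (part F x) (part F x) = (\<Sum>k\<in>F. complex_of_real ((cmod (cinner x (e k)))\<^sup>2))"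
    unfolding cinner_part[OF assms, of x "part F x"] complex_norm_square
    by (rule sum.cong) (use assms in \<open>auto simp: coeff_part subsetD\<close>)
  then have "complex_of_real ((norm (part F x))\<^sup>2) = complex_of_real (\<Sum>k\<in>F. (cmod (cinner x (e k)))\<^sup>2)"
    by (simp add: cinner_self)
  then show ?thesis using of_real_eq_iff by blast
qed

lemma norm_diff_part_sq:
  assumes "finite F" "F \<subseteq> Zs"
  shows "(norm (x - part F x))\<^sup>2 = (norm x)\<^sup>2 - (norm (part F x))\<^sup>2"
proof -
  have "cinner (part F x) x = (\<Sum>k\<in>F. complex_of_real ((cmod (cinner x (e k)))\<^sup>2))"
    unfolding cinner_part[OF assms] complex_norm_square ..
  then have "inner (part F x) x = (norm (part F x))\<^sup>2"
    by (simp add: norm_part_sq[OF assms] flip: Re_cinner)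
  then show ?thesis
    by (simp add: power2_norm_eq_inner inner_diff_left inner_diff_right inner_commute[of x "part F x"])
qed

lemma bessel:
  assumes "finite F" "F \<subseteq> Zs"
  shows "(\<Sum>k\<in>F. (cmod (cinner x (e k)))\<^sup>2) \<le> (norm x)\<^sup>2"
  by (metis assms norm_diff_part_sq norm_part_sq zero_le_power2 diff_ge_0_iff_ge)

lemma norm_part_le:
  assumes "finite F" "F \<subseteq> Zs" shows "norm (part F x) \<le> norm x"
  by (rule power2_le_imp_le) (use bessel[OF assms, of x] in \<open>simp_all add: norm_part_sq[OF assms]\<close>)

lemma norm_diff_part_le:
  assumes "finite F" "F \<subseteq> Zs" shows "norm (x - part F x) \<le> norm x"
  by (rule power2_le_imp_le) (simp_all add: norm_diff_part_sq[OF assms])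

lemma summable_coeff: "(\<lambda>k. (cmod (cinner x (e k)))\<^sup>2) summable_on Zs"
  by (rule nonneg_bounded_partial_sums_imp_summable_on[where C = "(norm x)\<^sup>2"])
    (auto intro!: eventually_finite_subsets_at_top_weakI bessel)

lemma part_diff:
  assumes "finite F" "G \<subseteq> F"
  shows "part F x - part G x = part (F - G) x"
  unfolding part_def using assms by (simp add: sum_diff)

text \<open>
  Partial sums of the Fourier series are Cauchy by Bessel's inequality; their limit has the same
  coefficients as \<open>x\<close> and hence equals \<open>x\<close> by totality.
\<close>

lemma part_LIMSEQ: "(\<lambda>n. part (ZsN n) x) \<longlonglongrightarrow> x"
proof -
  define a where "a n = (norm (part (ZsN n) x))\<^sup>2" for n
  have sub: "ZsN m \<subseteq> ZsN n" if "m \<le> n" for m n using that by (auto simp: ZsN_def)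
  have a: "a n = (\<Sum>k\<in>ZsN n. (cmod (cinner x (e k)))\<^sup>2)" for n
    unfolding a_def by (rule norm_part_sq) (auto simp: ZsN_subset)
  have diff: "(norm (part (ZsN n) x - part (ZsN m) x))\<^sup>2 = a n - a m" if "m \<le> n" for m n
  proof -
    have "(norm (part (ZsN n) x - part (ZsN m) x))\<^sup>2 = (\<Sum>k\<in>ZsN n - ZsN m. (cmod (cinner x (e k)))\<^sup>2)"
      unfolding part_diff[OF finite_ZsN sub[OF that]]
      by (rule norm_part_sq) (use ZsN_subset in auto)
    then show ?thesis unfolding a using sub[OF that] by (simp add: sum_diff)
  qed
  have "incseq a"
    by (rule incseq_SucI) (use diff[of "_" "Suc _"] in \<open>metis diff le_add2 plus_1_eq_Suc zero_le_power2 diff_ge_0_iff_ge\<close>)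
  moreover have "\<And>n. a n \<le> (norm x)\<^sup>2" unfolding a by (rule bessel) (auto simp: ZsN_subset)
  ultimately obtain L where "a \<longlonglongrightarrow> L" using incseq_convergent by blast
  then have "Cauchy a" by (rule LIMSEQ_imp_Cauchy)
  have "Cauchy (\<lambda>n. part (ZsN n) x)"
  proof (rule CauchyI')
    fix d :: real assume "0 < d"
    then obtain M where M: "\<And>m n. M \<le> m \<Longrightarrow> M \<le> n \<Longrightarrow> norm (a m - a n) < d\<^sup>2"
      using CauchyD[OF \<open>Cauchy a\<close>, of "d\<^sup>2"] by auto
    have "norm (part (ZsN m) x - part (ZsN n) x) < d" if "M \<le> m" "m < n" for m n
    proof -
      have "(norm (part (ZsN n) x - part (ZsN m) x))\<^sup>2 < d\<^sup>2"
        using M[of m n] diff[of m n] that by auto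
      then show ?thesis using \<open>0 < d\<close> by (simp add: norm_minus_commute power_less_imp_less_base)
    qed
    then show "\<exists>M. \<forall>m\<ge>M. \<forall>n>m. dist (part (ZsN m) x) (part (ZsN n) x) < d"
      unfolding dist_norm by blast
  qed
  then obtain y where y: "(\<lambda>n. part (ZsN n) x) \<longlonglongrightarrow> y"
    using Cauchy_convergent convergent_def by blast
  have "x - y = 0"
  proof (rule total)
    fix k assume k: "k \<in> Zs"
    have "\<forall>\<^sub>F n in sequentially. cinner (part (ZsN n) x) (e k) = cinner x (e k)"
    proof (rule eventually_sequentiallyI)
      fix n assume "nat \<bar>k\<bar> \<le> n"
      then have "k \<in> ZsN n" using k by (auto simp: ZsN_def)
      then show "cinner (part (ZsN n) x) (e k) = cinner x (e k)"
        by (simp add: coeff_part ZsN_subset k)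
    qed
    then have "(\<lambda>n. cinner (part (ZsN n) x) (e k)) \<longlonglongrightarrow> cinner x (e k)"
      by (rule tendsto_eventually)
    then have "cinner y (e k) = cinner x (e k)"
      using tendsto_cinner_left[OF y, of "e k"] LIMSEQ_unique by blast
    then show "cinner (x - y) (e k) = 0" by (simp add: cinner_diff_left)
  qed
  then show ?thesis using y by simp
qed

lemma parseval: "((\<lambda>k. (cmod (cinner x (e k)))\<^sup>2) has_sum (norm x)\<^sup>2) Zs"
proof -
  let ?f = "\<lambda>k. (cmod (cinner x (e k)))\<^sup>2"
  have "infsum ?f Zs \<le> (norm x)\<^sup>2"
    by (rule infsum_le_finite_sums[OF summable_coeff]) (auto intro: bessel)
  moreover have "(norm x)\<^sup>2 \<le> infsum ?f Zs"
  proof (rule LIMSEQ_le_const2)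
    show "(\<lambda>n. (norm (part (ZsN n) x))\<^sup>2) \<longlonglongrightarrow> (norm x)\<^sup>2"
      by (intro tendsto_power tendsto_norm part_LIMSEQ)
    show "\<exists>N. \<forall>n\<ge>N. (norm (part (ZsN n) x))\<^sup>2 \<le> infsum ?f Zs"
      by (auto simp: norm_part_sq ZsN_subset intro!: exI[of _ 0] finite_sum_le_infsum summable_coeff
          subsetD[OF ZsN_subset])
  qed
  ultimately show ?thesis using has_sum_infsum[OF summable_coeff, of x] by simp
qed

lemma norm_le_if_coeff_le:
  assumes g: "0 \<le> g" and le: "\<And>k. k \<in> Zs \<Longrightarrow> g * cmod (cinner x (e k)) \<le> cmod (cinner y (e k))"
  shows "g * norm x \<le> norm y"
proof -
  have "g\<^sup>2 * (norm x)\<^sup>2 \<le> (norm y)\<^sup>2"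
  proof (rule has_sum_mono[OF has_sum_cmult_right[OF parseval] parseval])
    fix k assume "k \<in> Zs"
    show "g\<^sup>2 * (cmod (cinner x (e k)))\<^sup>2 \<le> (cmod (cinner y (e k)))\<^sup>2"
      using power_mono[OF le[OF \<open>k \<in> Zs\<close>], of 2] g by (simp add: power_mult_distrib)
  qed
  then show ?thesis using g by (simp add: power_mult_distrib[symmetric])
qed

text \<open>
  This locates eigenvalues: with \<open>y\<close> the image of an eigenvector under the perturbation, the
  coefficient found here singles out a mode whose eigenvalue is close. The coefficient of \<open>x\<close> is
  nonzero also when \<open>g = 0\<close>, which needs a strict comparison of the two series.
\<close>

lemma exists_coeff_le_if_norm_le:
  assumes g: "0 \<le> g" and x: "x \<noteq> 0" and le: "norm y \<le> g * norm x"
  shows "\<exists>k\<in>Zs. cinner x (e k) \<noteq> 0 \<and> cmod (cinner y (e k)) \<le> g * cmod (cinner x (e k))"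
proof (rule ccontr)
  assume "\<not> ?thesis"
  then have gt: "g * cmod (cinner x (e k)) < cmod (cinner y (e k))" if "k \<in> Zs" "cinner x (e k) \<noteq> 0" for k
    using that by auto
  let ?f = "\<lambda>k. (cmod (cinner y (e k)))\<^sup>2 - g\<^sup>2 * (cmod (cinner x (e k)))\<^sup>2"
  have pos: "0 < ?f k" if "k \<in> Zs" "cinner x (e k) \<noteq> 0" for k
    using power_strict_mono[OF gt[OF that], of 2] g by (simp add: power_mult_distrib)
  have nonneg: "0 \<le> ?f k" if "k \<in> Zs" for k
    using pos[OF that] by (cases "cinner x (e k) = 0") auto
  obtain k where k: "k \<in> Zs" "cinner x (e k) \<noteq> 0" using total x by blast
  have sum: "(?f has_sum ((norm y)\<^sup>2 - g\<^sup>2 * (norm x)\<^sup>2)) Zs"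
    using has_sum_add[OF parseval[of y] has_sum_cmult_right[OF parseval[of x], of "- (g\<^sup>2)"]] by simp
  have "sum ?f {k} \<le> (norm y)\<^sup>2 - g\<^sup>2 * (norm x)\<^sup>2"
    by (rule finite_sum_le_has_sum[OF sum]) (use k nonneg in auto)
  moreover have "(norm y)\<^sup>2 \<le> g\<^sup>2 * (norm x)\<^sup>2"
    using power_mono[OF le, of 2] by (simp add: power_mult_distrib)
  ultimately show False using pos[OF k] by simp
qed

lemma norm_diff_part_sq_le_infsum:
  "(norm (x - part (ZsN N) x))\<^sup>2 \<le> (\<Sum>\<^sub>\<infinity>k\<in>{k\<in>Zs. int N \<le> \<bar>k\<bar>}. (cmod (cinner x (e k)))\<^sup>2)"
proof -
  let ?d = "x - part (ZsN N) x"
  have c: "cinner ?d (e k) = (if k \<in> ZsN N then 0 else cinner x (e k))" if "k \<in> Zs" for k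
    using that by (simp add: cinner_diff_left coeff_part ZsN_subset)
  have "(norm ?d)\<^sup>2 = (\<Sum>\<^sub>\<infinity>k\<in>Zs. (cmod (cinner ?d (e k)))\<^sup>2)"
    using infsumI[OF parseval] by metis
  also have "\<dots> \<le> (\<Sum>\<^sub>\<infinity>k\<in>{k\<in>Zs. int N \<le> \<bar>k\<bar>}. (cmod (cinner x (e k)))\<^sup>2)"
  proof (rule infsum_mono_neutral)
    show "(\<lambda>k. (cmod (cinner x (e k)))\<^sup>2) summable_on {k\<in>Zs. int N \<le> \<bar>k\<bar>}"
      by (rule summable_on_subset_banach[OF summable_coeff]) auto
    show "(cmod (cinner ?d (e k)))\<^sup>2 \<le> (cmod (cinner x (e k)))\<^sup>2"
      if "k \<in> Zs \<inter> {k\<in>Zs. int N \<le> \<bar>k\<bar>}" for k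
      using that c[of k] by simp
    show "(cmod (cinner ?d (e k)))\<^sup>2 \<le> 0" if "k \<in> Zs - {k\<in>Zs. int N \<le> \<bar>k\<bar>}" for k
      using that c[of k] by (auto simp: ZsN_def)
  qed (auto intro: summable_coeff)
  finally show ?thesis .
qed

text \<open>
  The orthogonal projection to the modes in \<open>I\<close>, in the two cases that correspond to the full operator
  and to a Galerkin truncation.
\<close>

lemma exists_truncation:
  assumes "I = Zs \<or> finite I \<and> I \<subseteq> Zs"
  shows "\<exists>y. norm y \<le> norm x \<and> (\<forall>k\<in>Zs. cinner y (e k) = (if k \<in> I then cinner x (e k) else 0))"
proof (cases "I = Zs")
  case False
  then show ?thesis using assms norm_part_le[of I x] coeff_part[of I _ x] by blast
qed auto

lemma eq_if_coeff_eq: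
  assumes "\<And>k. k \<in> Zs \<Longrightarrow> cinner x (e k) = cinner y (e k)" shows "x = y"
  using total[of "x - y"] assms by (simp add: cinner_diff_left)

end

section \<open>Localisation of eigenvalues in discs\<close>

locale damped_modes = orthonormal_basis e for e :: "int \<Rightarrow> 'a::complex_hilbert" +
  fixes \<omega> :: "int \<Rightarrow> real" and B :: "'a \<Rightarrow> 'a" and \<beta> :: real
  assumes B_add: "B (x + y) = B x + B y" and B_scaleC: "B (a *\<^sub>C x) = a *\<^sub>C B x"
    and B_real: "cinner (B x) x \<in> \<real>" and B_nonneg: "0 \<le> Re (cinner (B x) x)"
    and B_bound: "norm (B x) \<le> \<beta> * norm x"
    and \<omega>_less: "k \<in> Zs \<Longrightarrow> \<omega> k < \<omega> (zsucc k)"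
    and \<omega>_gap: "k \<in> Zs \<Longrightarrow> 2 * \<beta> \<le> \<omega> (zsucc k) - \<omega> k"
begin

definition lam :: "int \<Rightarrow> complex" where
  "lam k = \<i> * complex_of_real (\<omega> k)"

text \<open>
  The centre is shifted by \<open>\<beta>/2\<close> because the damping has its numerical range in \<open>[0, \<beta>]\<close>. The radius
  \<open>3\<beta>/4\<close> exceeds the norm \<open>\<beta>/2\<close> of the centred damping and still leaves the discs disjoint.
\<close>

definition in_disc :: "int \<Rightarrow> complex \<Rightarrow> bool" where
  "in_disc k z \<longleftrightarrow> cmod (z - (lam k - complex_of_real (\<beta> / 2))) \<le> 3 / 4 * \<beta>"

text \<open>
  The next two notions express \<open>w\<close> as a member of the span of the modes in \<open>I\<close>, and \<open>y\<close> as the image of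
  \<open>w\<close> under the damped operator compressed to it, through coefficients alone. The index set \<open>ZsN N\<close>
  gives the Galerkin truncation and \<open>Zs\<close> the damped operator itself, so that both are treated at once.
\<close>

definition supported :: "int set \<Rightarrow> 'a \<Rightarrow> bool" where
  "supported I w \<longleftrightarrow> (\<forall>k\<in>Zs - I. cinner w (e k) = 0)"

definition maps_to :: "int set \<Rightarrow> 'a \<Rightarrow> 'a \<Rightarrow> bool" where
  "maps_to I w y \<longleftrightarrow> (\<forall>k\<in>I. lam k * cinner w (e k) - cinner (B w) (e k) = cinner y (e k))"

lemma \<beta>_nonneg: "0 \<le> \<beta>"
proof -
  have "1 \<in> Zs" by (simp add: Zs_def)
  then show ?thesis using B_bound[of "e 1"] norm_basis[of 1] order_trans[OF norm_ge_zero] by fastforce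
qed

lemma B_minus: "B (x - y) = B x - B y"
  by (metis B_add add_diff_cancel_right' diff_add_cancel)

text \<open>
  From \<open>\<parallel>Bx\<parallel>\<^sup>2 \<le> \<beta>\<langle>Bx, x\<rangle>\<close> by expanding the square.
\<close>

lemma centred_damping_bound: "norm (B x - complex_of_real (\<beta> / 2) *\<^sub>C x) \<le> \<beta> / 2 * norm x"
proof -
  have B_R: "B (r *\<^sub>R x) = r *\<^sub>R B x" for r x by (simp add: scaleR_scaleC B_scaleC)
  have "(norm (B x))\<^sup>2 \<le> \<beta> * inner (B x) x"
    by (rule norm_sq_le_psd_form[of UNIV])
      (use B_nonneg in \<open>auto simp: B_add B_R B_bound Re_cinner
          intro: inner_symmetric_if_real_form[OF B_add B_scaleC B_real]\<close>)
  moreover have "(norm (B x - (\<beta> / 2) *\<^sub>R x))\<^sup>2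
      = (norm (B x))\<^sup>2 - \<beta> * inner (B x) x + (\<beta> / 2)\<^sup>2 * (norm x)\<^sup>2"
    unfolding power2_norm_eq_inner
    by (simp add: inner_diff_left inner_diff_right inner_commute[of x "B x"] power2_eq_square field_simps)
  ultimately have "(norm (B x - (\<beta> / 2) *\<^sub>R x))\<^sup>2 \<le> (\<beta> / 2 * norm x)\<^sup>2"
    by (simp add: power_mult_distrib power_divide)
  then show ?thesis
    using \<beta>_nonneg power2_le_imp_le by (fastforce simp: scaleR_scaleC)
qed

text \<open>
  Each step of the successor adds at least \<open>2\<beta>\<close>, and one step is lost when \<open>0\<close> lies between the
  indices; the last estimate allows for this loss in all cases.
\<close>

lemma \<omega>_strict_mono:
  assumes jk: "j \<in> Zs" "k \<in> Zs" "j < k"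
  shows "\<omega> j < \<omega> k" "2 * \<beta> \<le> \<omega> k - \<omega> j"
    "2 * \<beta> * (real_of_int (k - j) - 1) \<le> \<omega> k - \<omega> j"
proof -
  have "\<omega> (zsucc j) \<le> \<omega> k"
    using jk zsucc_in_Zs[of j] zsucc_le[of k j] \<omega>_less
    by (intro monotone_from_zsucc[of "zsucc j" k \<omega>]) (auto intro: less_imp_le)
  then show "\<omega> j < \<omega> k" "2 * \<beta> \<le> \<omega> k - \<omega> j" using \<omega>_less[of j] \<omega>_gap[of j] jk by auto
  have "2 * \<beta> * real_of_int (k - j - (if j < 0 \<and> 0 < k then 1 else 0)) \<le> \<omega> k - \<omega> j"
    using jk(1) jk(2) less_imp_le[OF jk(3)]
  proof (induction rule: Zs_interval_induct)
    case (step i)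
    have count: "zsucc i - j - (if j < 0 \<and> 0 < zsucc i then 1 else 0)
        = i - j - (if j < 0 \<and> 0 < i then 1 else 0) + 1"
      using step(1,2) by (auto simp: zsucc_def Zs_def)
    have split: "2 * \<beta> * real_of_int (t + 1) = 2 * \<beta> * real_of_int t + 2 * \<beta>" for t :: int
      by (simp add: algebra_simps)
    show ?case unfolding count split using step(4) \<omega>_gap[OF step(1)] by linarith
  qed auto
  moreover have "2 * \<beta> * (real_of_int (k - j) - 1)
      \<le> 2 * \<beta> * real_of_int (k - j - (if j < 0 \<and> 0 < k then 1 else 0))"
    using \<beta>_nonneg by (intro mult_left_mono) auto
  ultimately show "2 * \<beta> * (real_of_int (k - j) - 1) \<le> \<omega> k - \<omega> j" by linarith
qed

lemma \<omega>_separation: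
  assumes "j \<in> Zs" "k \<in> Zs" "j \<noteq> k"
  shows "0 < \<bar>\<omega> j - \<omega> k\<bar>" "2 * \<beta> \<le> \<bar>\<omega> j - \<omega> k\<bar>"
    "2 * \<beta> * (real_of_int \<bar>j - k\<bar> - 1) \<le> \<bar>\<omega> j - \<omega> k\<bar>"
  using \<omega>_strict_mono[of j k] \<omega>_strict_mono[of k j] assms by (cases "j < k"; simp)+

text \<open>
  A positive gap around each single frequency, also when \<open>\<beta> = 0\<close>.
\<close>

lemma exists_isolation_gap:
  assumes k: "k \<in> Zs"
  shows "\<exists>g>0. 2 * \<beta> \<le> g \<and> (\<forall>j\<in>Zs. j \<noteq> k \<longrightarrow> g \<le> \<bar>\<omega> j - \<omega> k\<bar>)"
proof -
  define m where "m = - zsucc (- k)"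
  have m: "m \<in> Zs" "zsucc m = k" "m < k" and le_m: "\<And>j. j \<in> Zs \<Longrightarrow> j < k \<Longrightarrow> j \<le> m"
    using k by (auto simp: m_def zsucc_def Zs_def)
  have mono: "\<omega> i \<le> \<omega> j" if "i \<in> Zs" "j \<in> Zs" "i \<le> j" for i j
    using \<omega>_strict_mono(1)[of i j] that by (cases "i = j") auto
  define g where "g = min (\<omega> (zsucc k) - \<omega> k) (\<omega> k - \<omega> m)"
  have "g \<le> \<bar>\<omega> j - \<omega> k\<bar>" if "j \<in> Zs" "j \<noteq> k" for j
  proof (cases "j < k")
    case True
    then show ?thesis using mono[of j m] le_m[of j] m that by (auto simp: g_def)
  next
    case False
    then show ?thesis using mono[of "zsucc k" j] zsucc_le[of j k] zsucc_in_Zs[OF k] that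
      by (auto simp: g_def)
  qed
  then show ?thesis using \<omega>_less[OF k] \<omega>_less[OF m(1)] \<omega>_gap[OF k] \<omega>_gap[OF m(1)] m
    by (intro exI[of _ g]) (auto simp: g_def)
qed

lemma cmod_lam_diff: "cmod (lam j - lam k) = \<bar>\<omega> j - \<omega> k\<bar>"
  unfolding lam_def by (simp add: norm_mult flip: right_diff_distrib of_real_diff)

lemma in_disc_Im: "in_disc k z \<Longrightarrow> \<bar>Im z - \<omega> k\<bar> \<le> 3 / 4 * \<beta>"
  using abs_Im_le_cmod[of "z - (lam k - complex_of_real (\<beta> / 2))"]
  by (simp add: in_disc_def lam_def)

lemma discs_far_apart:
  assumes "in_disc j z" "in_disc k z'" "j \<in> Zs" "k \<in> Zs" "j \<noteq> k"
  shows "\<beta> / 2 \<le> cmod (z - z')"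
  using abs_Im_le_cmod[of "z - z'"] in_disc_Im[OF assms(1)] in_disc_Im[OF assms(2)] \<omega>_separation(2)[OF assms(3-5)]
  by (simp add: abs_if split: if_splits)

text \<open>
  For \<open>\<beta> = 0\<close> the discs are points and closeness means equality, so the strict separation of the
  frequencies suffices.
\<close>

lemma same_disc_if_close:
  assumes "in_disc j z" "in_disc k z'" "j \<in> Zs" "k \<in> Zs" "cmod (z - z') \<le> \<beta> / 4"
  shows "j = k"
proof (rule ccontr)
  assume jk: "j \<noteq> k"
  then have "\<beta> = 0" using discs_far_apart[OF assms(1-4)] assms(5) \<beta>_nonneg by simp
  then show False using \<omega>_separation(1)[OF assms(3,4) jk] assms(5) in_disc_Im[OF assms(1)] in_disc_Im[OF assms(2)]
    by simp
qed

lemma disc_index_mono: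
  assumes "in_disc j z" "in_disc k z'" "j \<in> Zs" "k \<in> Zs" "Im z \<le> Im z'"
  shows "j \<le> k"
proof (rule ccontr)
  assume "\<not> j \<le> k"
  then show False
    using \<omega>_strict_mono(1,2)[of k j] assms(3-5) in_disc_Im[OF assms(1)] in_disc_Im[OF assms(2)] \<beta>_nonneg
    by linarith
qed

text \<open>
  The eigenvalue equation says that the coefficients of the centred damping applied to \<open>w\<close> are those of
  \<open>w\<close> multiplied by the distances of \<open>z\<close> to the centres. These multipliers cannot all exceed
  \<open>3\<beta>/4\<close>, as the centred damping has norm at most \<open>\<beta>/2\<close>.
\<close>

lemma eigenvalue_in_disc:
  assumes I: "I \<subseteq> Zs" and w: "w \<noteq> 0" "supported I w" and eig: "maps_to I w (z *\<^sub>C w)"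
  shows "\<exists>k\<in>I. in_disc k z"
proof -
  have "norm (B w - complex_of_real (\<beta> / 2) *\<^sub>C w) \<le> 3 / 4 * \<beta> * norm w"
    using centred_damping_bound[of w] mult_nonneg_nonneg[OF \<beta>_nonneg norm_ge_zero[of w]] by simp
  then obtain k where k: "k \<in> Zs" "cinner w (e k) \<noteq> 0" and
    le: "cmod (cinner (B w - complex_of_real (\<beta> / 2) *\<^sub>C w) (e k)) \<le> 3 / 4 * \<beta> * cmod (cinner w (e k))"
    using exists_coeff_le_if_norm_le[of "3 / 4 * \<beta>" w] w \<beta>_nonneg by auto
  have kI: "k \<in> I" using k w by (auto simp: supported_def)
  then have "cinner (B w) (e k) = (lam k - z) * cinner w (e k)"
    using eig by (simp add: maps_to_def cinner_scaleC_left algebra_simps)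
  then have "cinner (B w - complex_of_real (\<beta> / 2) *\<^sub>C w) (e k)
      = - (z - (lam k - complex_of_real (\<beta> / 2))) * cinner w (e k)"
    by (simp add: cinner_diff_left cinner_scaleC_left algebra_simps)
  then have "in_disc k z" using le k unfolding in_disc_def by (simp add: norm_mult norm_minus_commute)
  then show ?thesis using kI by blast
qed

lemma eigenvectors_independent:
  assumes w: "w \<noteq> 0" "supported I w" "maps_to I w (z *\<^sub>C w)"
    and w': "w' \<noteq> 0" "supported I w'" "maps_to I w' (z' *\<^sub>C w')" and ne: "z \<noteq> z'"
  shows "w' \<notin> cspan {w}"
proof
  assume "w' \<in> cspan {w}"
  then obtain a where a: "w' = a *\<^sub>C w" by (auto simp: complex_vector.span_singleton)
  obtain k where k: "k \<in> Zs" "cinner w' (e k) \<noteq> 0" using total w'(1) by blast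
  then have kI: "k \<in> I" using w' by (auto simp: supported_def)
  have "z' * cinner w' (e k) = a * (lam k * cinner w (e k) - cinner (B w) (e k))"
    using w'(3) kI by (simp add: maps_to_def a B_scaleC cinner_scaleC_left algebra_simps)
  also have "\<dots> = z * cinner w' (e k)"
    using w(3) kI by (simp add: maps_to_def a cinner_scaleC_left)
  finally show False using k ne by simp
qed

text \<open>
  After subtracting the centre of the disc the eigenvalues have modulus at most \<open>3\<beta>/4 \<le> 3g/8 < g/2\<close>,
  where \<open>g\<close> is the gap around \<open>\<omega> k\<close>, while the operator expands the cone form at \<open>e k\<close> by more than
  \<open>(g/2)\<^sup>2\<close>. The term \<open>c *\<^sub>C w1\<close> covers Jordan blocks, so that multiplicities are controlled.
\<close>

lemma at_most_one_eigenvalue_per_disc: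
  assumes I: "I = Zs \<or> finite I \<and> I \<subseteq> Zs"
    and k: "k \<in> Zs" and z1: "in_disc k z1" and z2: "in_disc k z2"
    and w1: "w1 \<noteq> 0" "supported I w1" and w2: "w2 \<notin> cspan {w1}" "supported I w2"
    and eq1: "maps_to I w1 (z1 *\<^sub>C w1)" and eq2: "maps_to I w2 (z2 *\<^sub>C w2 + c *\<^sub>C w1)"
  shows False
proof -
  obtain g where g: "g > 0" "2 * \<beta> \<le> g" "\<And>j. j \<in> Zs \<Longrightarrow> j \<noteq> k \<Longrightarrow> g \<le> \<bar>\<omega> j - \<omega> k\<bar>"
    using exists_isolation_gap[OF k] by blast
  define \<gamma> where "\<gamma> = complex_of_real (\<beta> / 2) - lam k"
  have l: "cmod (z + \<gamma>) \<le> g / 2" if "in_disc k z" for z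
    using that g(1,2) unfolding in_disc_def \<gamma>_def by (simp add: algebra_simps)
  show False
  proof (rule no_slow_plane[OF w1(1) w2(1) l[OF z1] l[OF z2]])
    fix a b assume x0: "a *\<^sub>C w1 + b *\<^sub>C w2 \<noteq> 0"
    define x where "x = a *\<^sub>C w1 + b *\<^sub>C w2"
    define y where "y = a *\<^sub>C (z1 + \<gamma>) *\<^sub>C w1 + b *\<^sub>C ((z2 + \<gamma>) *\<^sub>C w2 + c *\<^sub>C w1)"
    obtain d where d: "norm d \<le> norm (B x - complex_of_real (\<beta> / 2) *\<^sub>C x)"
      and dc: "\<And>j. j \<in> Zs \<Longrightarrow> cinner d (e j) = (if j \<in> I then cinner (B x - complex_of_real (\<beta> / 2) *\<^sub>C x) (e j) else 0)"
      using exists_truncation[OF I] by blast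
    have zc: "cinner (y + d) (e j) = (lam j - lam k) * cinner x (e j)" if j: "j \<in> Zs" for j
    proof (cases "j \<in> I")
      case True
      have *: "cinner (B w1) (e j) = lam j * cinner w1 (e j) - z1 * cinner w1 (e j)"
        "cinner (B w2) (e j) = lam j * cinner w2 (e j) - z2 * cinner w2 (e j) - c * cinner w1 (e j)"
        using eq1 eq2 True by (simp_all add: maps_to_def cinner_add_left cinner_scaleC_left algebra_simps)
      show ?thesis
        using True by (simp add: y_def x_def dc[OF j] B_add B_scaleC \<gamma>_def cinner_add_left
            cinner_diff_left cinner_scaleC_left * algebra_simps)
    next
      case False
      then have "cinner w1 (e j) = 0" "cinner w2 (e j) = 0"
        using w1 w2 j by (auto simp: supported_def)
      then show ?thesis
        using False by (simp add: y_def x_def dc[OF j] cinner_add_left cinner_scaleC_left)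
    qed
    have "(g / 2)\<^sup>2 * cone_form (e k) x < cone_form (e k) (y + d - d)"
    proof (rule cone_form_expansion[OF norm_basis[OF k] g(1)])
      show "x \<noteq> 0" using x0 by (simp add: x_def)
      show "cinner (y + d) (e k) = 0" using zc[OF k] by simp
      show "g * norm (x - cinner x (e k) *\<^sub>C e k) \<le> norm (y + d)"
      proof (rule norm_le_if_coeff_le)
        fix j assume j: "j \<in> Zs"
        show "g * cmod (cinner (x - cinner x (e k) *\<^sub>C e k) (e j)) \<le> cmod (cinner (y + d) (e j))"
          using g(3)[OF j] ortho[OF k j] ortho[OF k k]
          by (cases "j = k")
            (simp_all add: zc[OF j] cinner_diff_left cinner_scaleC_left norm_mult cmod_lam_diff mult_right_mono)
      qed (use g in simp)
      have "norm d \<le> \<beta> / 2 * norm x" using d centred_damping_bound[of x] by linarith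
      also have "\<dots> \<le> g / 4 * norm x" using g(2) by (intro mult_right_mono) auto
      finally show "norm d \<le> g / 4 * norm x" .
    qed
    then show "(g / 2)\<^sup>2 * cone_form (e k) (a *\<^sub>C w1 + b *\<^sub>C w2)
        < cone_form (e k) (a *\<^sub>C (z1 + \<gamma>) *\<^sub>C w1 + b *\<^sub>C ((z2 + \<gamma>) *\<^sub>C w2 + c *\<^sub>C w1))"
      by (simp add: x_def y_def)
  qed
qed

text \<open>
  The second conjunct is what counting with algebraic multiplicity amounts to for pairs of indices:
  two indices with the same value still come with a plane, spanned by an eigenvector and either a
  second eigenvector or a generalized one.
\<close>

definition galerkin_eigenvalues :: "nat \<Rightarrow> (int \<Rightarrow> complex) \<Rightarrow> bool" where
  "galerkin_eigenvalues N \<eta> \<longleftrightarrow>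
    (\<forall>p\<in>ZsN N. \<exists>w. w \<noteq> 0 \<and> supported (ZsN N) w \<and> maps_to (ZsN N) w (\<eta> p *\<^sub>C w)) \<and>
    (\<forall>p\<in>ZsN N. \<forall>q\<in>ZsN N. p \<noteq> q \<longrightarrow> (\<exists>w1 w2 c. w1 \<noteq> 0 \<and> w2 \<notin> cspan {w1} \<and>
       supported (ZsN N) w1 \<and> supported (ZsN N) w2 \<and>
       maps_to (ZsN N) w1 (\<eta> p *\<^sub>C w1) \<and> maps_to (ZsN N) w2 (\<eta> q *\<^sub>C w2 + c *\<^sub>C w1))) \<and>
    (\<forall>k\<in>ZsN N. zsucc k \<in> ZsN N \<longrightarrow> Im (\<eta> k) \<le> Im (\<eta> (zsucc k)))"

text \<open>
  Sending each index to the index of its disc is injective since a disc holds one eigenvalue, and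
  monotone since both families are ordered by imaginary part. On a finite set this leaves the identity.
\<close>

lemma galerkin_eigenvalue_in_disc:
  assumes G: "galerkin_eigenvalues N \<eta>" and p: "p \<in> ZsN N"
  shows "in_disc p (\<eta> p)"
proof -
  have "\<exists>k\<in>ZsN N. in_disc k (\<eta> q)" if q: "q \<in> ZsN N" for q
  proof -
    obtain w where "w \<noteq> 0" "supported (ZsN N) w" "maps_to (ZsN N) w (\<eta> q *\<^sub>C w)"
      using G q unfolding galerkin_eigenvalues_def by blast
    then show ?thesis by (rule eigenvalue_in_disc[OF ZsN_subset])
  qed
  then obtain \<tau> where \<tau>: "\<And>q. q \<in> ZsN N \<Longrightarrow> \<tau> q \<in> ZsN N" "\<And>q. q \<in> ZsN N \<Longrightarrow> in_disc (\<tau> q) (\<eta> q)"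
    by metis
  have Zs: "q \<in> Zs" if "q \<in> ZsN N" for q using that ZsN_subset by auto
  have inj: "\<tau> p \<noteq> \<tau> q" if pq: "p \<in> ZsN N" "q \<in> ZsN N" "p \<noteq> q" for p q
  proof
    assume eq: "\<tau> p = \<tau> q"
    obtain w1 w2 c where w: "w1 \<noteq> 0" "w2 \<notin> cspan {w1}" "supported (ZsN N) w1" "supported (ZsN N) w2"
       "maps_to (ZsN N) w1 (\<eta> p *\<^sub>C w1)" "maps_to (ZsN N) w2 (\<eta> q *\<^sub>C w2 + c *\<^sub>C w1)"
      using G pq unfolding galerkin_eigenvalues_def by metis
    show False
      by (rule at_most_one_eigenvalue_per_disc[OF _ _ \<tau>(2)[OF pq(1)] \<tau>(2)[OF pq(2), folded eq] w(1,3,2,4-6)])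
        (use \<tau>(1) pq(1) Zs ZsN_subset in auto)
  qed
  have "\<tau> p = p"
  proof (rule strict_mono_self_map_eq_id[of "ZsN N"])
    fix p q assume pq: "p \<in> ZsN N" "q \<in> ZsN N" "p < q"
    have "Im (\<eta> p) \<le> Im (\<eta> q)"
    proof (rule monotone_from_zsucc)
      fix i assume i: "i \<in> Zs" "p \<le> i" "i < q"
      then have "i \<in> ZsN N" "zsucc i \<in> ZsN N"
        using pq zsucc_le[of q i] zsucc_in_Zs[of i] zsucc_gt[of i] by (auto simp: ZsN_def)
      then show "Im (\<eta> i) \<le> Im (\<eta> (zsucc i))" using G unfolding galerkin_eigenvalues_def by blast
    qed (use pq Zs in auto)
    then have "\<tau> p \<le> \<tau> q" using pq \<tau> Zs by (intro disc_index_mono[of "\<tau> p" "\<eta> p" "\<tau> q" "\<eta> q"]) auto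
    then show "\<tau> p < \<tau> q" using inj[of p q] pq by auto
  qed (use \<tau> p in auto)
  then show ?thesis using \<tau>(2)[OF p] by simp
qed

end

section \<open>Smallness of the Galerkin residual\<close>

context damped_modes
begin

text \<open>
  The part of \<open>B w\<close> that the truncation discards.
\<close>

definition residual :: "nat \<Rightarrow> 'a \<Rightarrow> 'a" where
  "residual N w = B w - part (ZsN N) (B w)"

lemma part_add: "part F (x + y) = part F x + part F y"
  unfolding part_def
  by (simp add: cinner_add_left complex_vector.scale_left_distrib sum.distrib)

lemma part_scaleC: "part F (a *\<^sub>C x) = a *\<^sub>C part F x"
  unfolding part_def
  by (simp add: cinner_scaleC_left complex_vector.scale_sum_right scaleC_scaleC)

lemma residual_add: "residual N (x + y) = residual N x + residual N y"
  by (simp add: residual_def B_add part_add)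

lemma residual_scaleC: "residual N (a *\<^sub>C x) = a *\<^sub>C residual N x"
  by (simp add: residual_def B_scaleC part_scaleC complex_vector.scale_right_diff_distrib)

lemma residual_zero [simp]: "residual N 0 = 0"
  using residual_scaleC[of N 0 0] by simp

lemma norm_residual_le: "norm (residual N x) \<le> \<beta> * norm x"
  unfolding residual_def
  using norm_diff_part_le[OF finite_ZsN ZsN_subset, of "B x" N] B_bound[of x] by linarith

lemma residual_sum: "residual N (\<Sum>k\<in>F. f k) = (\<Sum>k\<in>F. residual N (f k))"
  by (induction F rule: infinite_finite_induct) (auto simp: residual_add)

lemma supported_eq_part:
  assumes "supported (ZsN N) w" shows "w = part (ZsN N) w"
proof (rule eq_if_coeff_eq)
  fix k assume "k \<in> Zs"
  then show "cinner w (e k) = cinner (part (ZsN N) w) (e k)"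
    using assms by (simp add: coeff_part ZsN_subset supported_def)
qed

lemma cmod_coeff_le: "k \<in> Zs \<Longrightarrow> cmod (cinner w (e k)) \<le> norm w"
  using cmod_cinner_le[of w "e k"] by (simp add: norm_basis)

text \<open>
  For modes more than \<open>s\<close> steps away from \<open>p\<close> the eigenvalue is at distance at least
  \<open>2s\<beta> - 3\<beta>/4\<close> from the frequency, whereas the centred damping contributes at most
  \<open>\<beta>/2\<close>.
\<close>

lemma galerkin_eigenvector_tail:
  assumes p: "p \<in> Zs" "in_disc p z" and s: "s \<ge> 1"
    and w: "supported (ZsN N) w" "maps_to (ZsN N) w (z *\<^sub>C w)"
  shows "(2 * real s - 1) * \<beta> * norm (part {k\<in>ZsN N. int s < \<bar>k - p\<bar>} w) \<le> \<beta> / 2 * norm w"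
proof -
  let ?F = "{k\<in>ZsN N. int s < \<bar>k - p\<bar>}"
  have F: "finite ?F" "?F \<subseteq> Zs" using ZsN_subset by auto
  let ?y = "B w - complex_of_real (\<beta> / 2) *\<^sub>C w"
  have "(2 * real s - 1) * \<beta> * norm (part ?F w) \<le> norm (part ?F ?y)"
  proof (rule norm_le_if_coeff_le)
    fix k assume k: "k \<in> Zs"
    show "(2 * real s - 1) * \<beta> * cmod (cinner (part ?F w) (e k)) \<le> cmod (cinner (part ?F ?y) (e k))"
    proof (cases "k \<in> ?F")
      case True
      then have "cinner ?y (e k) = (lam k - z - complex_of_real (\<beta> / 2)) * cinner w (e k)"
        using w(2) by (simp add: maps_to_def cinner_diff_left cinner_scaleC_left algebra_simps)
      moreover have "(2 * real s - 1) * \<beta> \<le> cmod (lam k - z - complex_of_real (\<beta> / 2))"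
      proof -
        have "2 * \<beta> * real s \<le> 2 * \<beta> * (real_of_int \<bar>k - p\<bar> - 1)"
          using True \<beta>_nonneg by (intro mult_left_mono) auto
        also have "\<dots> \<le> \<bar>\<omega> k - \<omega> p\<bar>" using True k p s by (intro \<omega>_separation(3)) auto
        finally have "(2 * real s - 1) * \<beta> \<le> \<bar>\<omega> k - Im z\<bar>"
          using in_disc_Im[OF p(2)] \<beta>_nonneg abs_triangle_ineq[of "\<omega> k - Im z" "Im z - \<omega> p"]
          by (simp add: algebra_simps)
        also have "\<dots> \<le> cmod (lam k - z - complex_of_real (\<beta> / 2))"
          using abs_Im_le_cmod[of "lam k - z - complex_of_real (\<beta> / 2)"] by (simp add: lam_def)
        finally show ?thesis .
      qed
      ultimately show ?thesis using True by (simp add: coeff_part[OF F k] norm_mult mult_right_mono)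
    next
      case False
      then have "cinner (part ?F w) (e k) = 0" by (simp only: coeff_part[OF F k] if_False)
      then show ?thesis by simp
    qed
  qed (use s \<beta>_nonneg in auto)
  also have "\<dots> \<le> \<beta> / 2 * norm w"
    using norm_part_le[OF F, of ?y] centred_damping_bound[of w] by linarith
  finally show ?thesis .
qed

text \<open>
  Split the eigenvector into modes within distance \<open>s\<close> of \<open>p\<close> and the rest. The rest is small for large
  \<open>s\<close>. The near part has at most \<open>2s + 1\<close> modes, all of index at most \<open>N - r1\<close> in modulus when
  \<open>r = s + r1\<close>, so the decay of the damping makes each of their residuals small. The choice of \<open>s\<close>
  precedes that of \<open>r1\<close>, and neither depends on \<open>N\<close>.
\<close>

lemma galerkin_residual_small:
  assumes decay: "\<And>d::real. d > 0 \<Longrightarrow> \<exists>r1::nat. r1 > 0 \<and> (\<forall>P::nat. P > 0 \<longrightarrow> (\<forall>i\<in>ZsN P.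
      (\<Sum>\<^sub>\<infinity>j\<in>{j\<in>Zs. \<bar>j\<bar> \<ge> int P + int r1}. (cmod (cinner (B (e i)) (e j)))\<^sup>2) < d))"
    and \<delta>: "\<delta> > 0"
  shows "\<exists>r::nat. r > 0 \<and> (\<forall>N>r. \<forall>p\<in>Zs. \<bar>p\<bar> \<le> int N - int r \<longrightarrow>
    (\<forall>z w. in_disc p z \<longrightarrow> supported (ZsN N) w \<longrightarrow> maps_to (ZsN N) w (z *\<^sub>C w) \<longrightarrow>
      norm (residual N w) \<le> \<delta> * \<beta> * norm w))"
proof (cases "\<beta> = 0")
  case True
  then show ?thesis using norm_residual_le by (intro exI[of _ 1]) auto
next
  case False
  then have \<beta>: "\<beta> > 0" using \<beta>_nonneg by simp
  obtain s :: nat where s: "1 / \<delta> + 1 < real s" using reals_Archimedean2 by blast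
  have "1 / \<delta> > 0" using \<delta> by simp
  then have s1: "s \<ge> 1" using s by linarith
  have s\<delta>: "1 \<le> \<delta> * (2 * real s - 1)"
  proof -
    have "1 = \<delta> * (1 / \<delta>)" using \<delta> by simp
    also have "\<dots> \<le> \<delta> * (2 * real s - 1)" using \<delta> s s1 by (intro mult_left_mono) auto
    finally show ?thesis .
  qed
  define c where "c = \<delta> * \<beta> / 2 / (2 * real s + 1)"
  have c: "c > 0" using \<delta> \<beta> by (simp add: c_def)
  obtain r1 :: nat where r1: "r1 > 0" "\<And>P i. P > 0 \<Longrightarrow> i \<in> ZsN P \<Longrightarrow>
      (\<Sum>\<^sub>\<infinity>j\<in>{j\<in>Zs. \<bar>j\<bar> \<ge> int P + int r1}. (cmod (cinner (B (e i)) (e j)))\<^sup>2) < c\<^sup>2"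
    using decay[of "c\<^sup>2"] c by auto
  have "norm (residual N w) \<le> \<delta> * \<beta> * norm w"
    if N: "N > s + r1" and p: "p \<in> Zs" "\<bar>p\<bar> \<le> int N - int (s + r1)" and z: "in_disc p z"
      and w: "supported (ZsN N) w" "maps_to (ZsN N) w (z *\<^sub>C w)" for N p z w
  proof -
    define F where "F = {k\<in>ZsN N. int s < \<bar>k - p\<bar>}"
    define G where "G = ZsN N - F"
    have FZ: "F \<subseteq> ZsN N" "finite F" by (auto simp: F_def)
    have w_eq: "w = part F w + part G w"
      using supported_eq_part[OF w(1)] part_diff[OF finite_ZsN FZ(1), of w] by (simp add: G_def algebra_simps)
    have "norm (part F w) \<le> \<delta> / 2 * norm w"
    proof -
      have "((2 * real s - 1) * norm (part F w)) * \<beta> \<le> norm w / 2 * \<beta>"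
        using galerkin_eigenvector_tail[OF p(1) z s1 w] by (simp add: F_def mult_ac)
      then have "(2 * real s - 1) * norm (part F w) \<le> norm w / 2"
        using \<beta> by (rule mult_right_le_imp_le)
      then have "\<delta> * ((2 * real s - 1) * norm (part F w)) \<le> \<delta> * (norm w / 2)"
        using \<delta> by (intro mult_left_mono) auto
      moreover have "1 * norm (part F w) \<le> \<delta> * (2 * real s - 1) * norm (part F w)"
        using s\<delta> by (intro mult_right_mono) auto
      ultimately show ?thesis by (simp add: mult.assoc)
    qed
    then have 1: "norm (residual N (part F w)) \<le> \<delta> * \<beta> / 2 * norm w"
      using norm_residual_le[of N "part F w"] mult_left_mono[of _ _ \<beta>] \<beta>
      by (smt (verit) mult.assoc mult.commute times_divide_eq_right)
    have res_e: "norm (residual N (e k)) \<le> c" if k: "k \<in> G" for k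
    proof -
      have "k \<in> ZsN (N - r1)" using k p N by (auto simp: G_def F_def ZsN_def)
      then have "(\<Sum>\<^sub>\<infinity>j\<in>{j\<in>Zs. \<bar>j\<bar> \<ge> int (N - r1) + int r1}. (cmod (cinner (B (e k)) (e j)))\<^sup>2) < c\<^sup>2"
        using N by (intro r1(2)) auto
      moreover have "int (N - r1) + int r1 = int N" using N by auto
      ultimately have "(norm (residual N (e k)))\<^sup>2 < c\<^sup>2"
        using norm_diff_part_sq_le_infsum[of "B (e k)" N] by (simp add: residual_def)
      then show ?thesis using c power_less_imp_less_base by fastforce
    qed
    have "card G \<le> card {p - int s..p + int s}"
      by (rule card_mono) (auto simp: G_def F_def)
    then have cardG: "real (card G) \<le> 2 * real s + 1" by simp
    have "residual N (part G w) = (\<Sum>k\<in>G. cinner w (e k) *\<^sub>C residual N (e k))"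
      by (simp add: part_def residual_sum residual_scaleC)
    also have "norm \<dots> \<le> (\<Sum>k\<in>G. norm w * c)"
      by (rule sum_norm_le)
        (use ZsN_subset[of N] in \<open>auto simp: norm_scaleC G_def intro!: mult_mono cmod_coeff_le res_e[unfolded G_def]\<close>)
    also have "\<dots> = real (card G) * (norm w * c)" by simp
    also have "\<dots> \<le> (2 * real s + 1) * (norm w * c)"
      using c cardG by (intro mult_right_mono) auto
    also have "\<dots> = ((2 * real s + 1) * c) * norm w" by simp
    also have "(2 * real s + 1) * c = \<delta> * \<beta> / 2"
      unfolding c_def by (rule nonzero_mult_div_cancel_left[THEN trans[OF times_divide_eq_right]]) simp
    finally have 2: "norm (residual N (part G w)) \<le> \<delta> * \<beta> / 2 * norm w" .
    have "norm (residual N w) \<le> norm (residual N (part F w)) + norm (residual N (part G w))"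
      using norm_triangle_ineq[of "residual N (part F w)" "residual N (part G w)"]
      by (simp flip: residual_add w_eq)
    also have "\<dots> \<le> \<delta> * \<beta> * norm w" using 1 2 by simp
    finally show ?thesis .
  qed
  then show ?thesis using r1(1) by (intro exI[of _ "s + r1"]) blast
qed

end

section \<open>Resolvent bound from a Riesz basis of eigenvectors\<close>

lemma cspan_image_eq_sum:
  fixes U :: "'i \<Rightarrow> 'a::complex_vector"
  assumes "x \<in> cspan (U ` J)"
  obtains F c where "finite F" "F \<subseteq> J" "x = (\<Sum>j\<in>F. c j *\<^sub>C U j)"
proof -
  obtain t r where t: "finite t" "t \<subseteq> U ` J" "x = (\<Sum>a\<in>t. r a *\<^sub>C a)"
    using assms unfolding complex_vector.span_explicit by blast
  obtain F where F: "F \<subseteq> J" "inj_on U F" "t = U ` F"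
    using subset_image_inj[of t U J] t by blast
  show ?thesis
    by (rule that[of F "\<lambda>j. r (U j)"]) (use t F in \<open>auto simp: sum.reindex finite_image_iff\<close>)
qed

text \<open>
  On finite combinations of eigenvectors the resolvent acts on coefficients, so it is bounded by
  \<open>sqrt (M / m) / d\<close>, and these combinations are carried onto themselves. To reach an arbitrary \<open>w\<close> of the
  domain, approximate \<open>T w - z w\<close> by images of finite combinations \<open>X n\<close>. By the bound they form a Cauchy
  sequence, and since \<open>T\<close> is closed and \<open>z\<close> is no eigenvalue the limit is \<open>w\<close>.
\<close>

lemma resolvent_bound_riesz_basis:
  fixes T :: "'a::complex_hilbert \<Rightarrow> 'a" and U :: "'i \<Rightarrow> 'a" and m M :: real
  assumes Dom: "csubspace Dom"
    and add: "\<And>x y. x \<in> Dom \<Longrightarrow> y \<in> Dom \<Longrightarrow> T (x + y) = T x + T y"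
    and scale: "\<And>a x. x \<in> Dom \<Longrightarrow> T (a *\<^sub>C x) = a *\<^sub>C T x"
    and closed: "\<And>X x y. (\<And>n. X n \<in> Dom) \<Longrightarrow> X \<longlonglongrightarrow> x \<Longrightarrow> (\<lambda>n. T (X n)) \<longlonglongrightarrow> y \<Longrightarrow> x \<in> Dom \<and> T x = y"
    and U: "\<And>j. j \<in> J \<Longrightarrow> U j \<in> Dom" "\<And>j. j \<in> J \<Longrightarrow> T (U j) = \<nu> j *\<^sub>C U j"
    and dense: "\<And>x d. d > 0 \<Longrightarrow> \<exists>y\<in>cspan (U ` J). norm (x - y) < d"
    and riesz: "m > 0" "M > 0"
      "\<And>F c. finite F \<Longrightarrow> F \<subseteq> J \<Longrightarrow> m * (\<Sum>j\<in>F. (cmod (c j))\<^sup>2) \<le> (norm (\<Sum>j\<in>F. c j *\<^sub>C U j))\<^sup>2"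
      "\<And>F c. finite F \<Longrightarrow> F \<subseteq> J \<Longrightarrow> (norm (\<Sum>j\<in>F. c j *\<^sub>C U j))\<^sup>2 \<le> M * (\<Sum>j\<in>F. (cmod (c j))\<^sup>2)"
    and d: "d > 0" "\<And>j. j \<in> J \<Longrightarrow> d \<le> cmod (z - \<nu> j)"
    and inj: "\<And>x. x \<in> Dom \<Longrightarrow> T x = z *\<^sub>C x \<Longrightarrow> x = 0"
    and w: "w \<in> Dom"
  shows "d * norm w \<le> sqrt (M / m) * norm (T w - z *\<^sub>C w)"
proof -
  let ?L = "\<lambda>x. T x - z *\<^sub>C x"
  have span_Dom: "x \<in> Dom" if "x \<in> cspan (U ` J)" for x
    using that complex_vector.span_minimal[OF _ Dom, of "U ` J"] U by auto
  have T_zero: "T 0 = 0"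
    using scale[OF complex_vector.subspace_0[OF Dom], of 0] by simp
  have L_sum: "?L (\<Sum>j\<in>F. c j *\<^sub>C U j) = (\<Sum>j\<in>F. (c j * (\<nu> j - z)) *\<^sub>C U j)"
    if "finite F" "F \<subseteq> J" for F c
    using that
  proof (induction F rule: finite_induct)
    case (insert a F)
    have "(\<Sum>j\<in>F. c j *\<^sub>C U j) \<in> Dom" "c a *\<^sub>C U a \<in> Dom"
      using insert U Dom by (auto intro!: complex_vector.subspace_sum complex_vector.subspace_scale)
    then show ?case
      using insert U
      by (simp add: add scale algebra_simps scaleC_scaleC complex_vector.scale_left_diff_distrib
          complex_vector.scale_right_distrib)
  qed (simp add: T_zero)
  have bound: "d * norm x \<le> sqrt (M / m) * norm (?L x)" if x: "x \<in> cspan (U ` J)" for x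
  proof -
    obtain F c where F: "finite F" "F \<subseteq> J" "x = (\<Sum>j\<in>F. c j *\<^sub>C U j)"
      using cspan_image_eq_sum[OF x] by metis
    have "d\<^sup>2 * (norm x)\<^sup>2 \<le> d\<^sup>2 * (M * (\<Sum>j\<in>F. (cmod (c j))\<^sup>2))"
      unfolding F(3) by (intro mult_left_mono riesz F) auto
    also have "\<dots> = M * (\<Sum>j\<in>F. d\<^sup>2 * (cmod (c j))\<^sup>2)" by (simp add: sum_distrib_left mult_ac)
    also have "\<dots> \<le> M * (\<Sum>j\<in>F. (cmod (c j * (\<nu> j - z)))\<^sup>2)"
    proof (intro mult_left_mono sum_mono)
      fix j assume "j \<in> F"
      then have "d\<^sup>2 \<le> (cmod (\<nu> j - z))\<^sup>2"
        using d F by (intro power_mono) (auto simp: norm_minus_commute)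
      then show "d\<^sup>2 * (cmod (c j))\<^sup>2 \<le> (cmod (c j * (\<nu> j - z)))\<^sup>2"
        by (simp add: norm_mult power_mult_distrib mult.commute[of "(cmod (c j))\<^sup>2"] mult_right_mono)
    qed (use riesz in auto)
    also have "\<dots> \<le> M * ((norm (?L x))\<^sup>2 / m)"
      using riesz(1,2) riesz(3)[OF F(1,2), of "\<lambda>j. c j * (\<nu> j - z)"]
      unfolding F(3) L_sum[OF F(1,2)] by (intro mult_left_mono) (auto simp: field_simps)
    finally have "(d * norm x)\<^sup>2 \<le> (sqrt (M / m) * norm (?L x))\<^sup>2"
      using riesz(1,2) by (simp add: power_mult_distrib)
    then show ?thesis by (rule power2_le_imp_le) (use riesz(1,2) in simp)
  qed
  have onto: "\<exists>x\<in>cspan (U ` J). ?L x = y" if y: "y \<in> cspan (U ` J)" for y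
  proof -
    obtain F c where F: "finite F" "F \<subseteq> J" "y = (\<Sum>j\<in>F. c j *\<^sub>C U j)"
      using cspan_image_eq_sum[OF y] by metis
    let ?x = "\<Sum>j\<in>F. (c j / (\<nu> j - z)) *\<^sub>C U j"
    have ne: "\<nu> j \<noteq> z" if "j \<in> F" for j using d F that by fastforce
    have "?x \<in> cspan (U ` J)"
      using F by (intro complex_vector.span_sum complex_vector.span_scale) (auto intro: complex_vector.span_base)
    moreover have "?L ?x = y" unfolding L_sum[OF F(1,2)] F(3) by (rule sum.cong) (use ne in auto)
    ultimately show ?thesis by blast
  qed
  have "\<exists>x\<in>cspan (U ` J). norm (?L w - ?L x) < inverse (real (Suc n))" for n
    using dense[of "inverse (real (Suc n))" "?L w"] onto by force
  then obtain X where X: "\<And>n. X n \<in> cspan (U ` J)"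
    and Xw: "\<And>n. norm (?L w - ?L (X n)) < inverse (real (Suc n))" by metis
  have lim: "(\<lambda>n. ?L (X n)) \<longlonglongrightarrow> ?L w"
  proof -
    have "(\<lambda>n. ?L (X n) - ?L w) \<longlonglongrightarrow> 0"
      by (rule Lim_null_comparison[OF _ LIMSEQ_inverse_real_of_nat])
        (use Xw in \<open>auto simp: norm_minus_commute less_imp_le\<close>)
    then show ?thesis by (rule LIM_zero_cancel)
  qed
  have L_diff: "?L (x - y) = ?L x - ?L y" if "x \<in> Dom" "y \<in> Dom" for x y
    using add[OF that(1) complex_vector.subspace_scale[OF Dom that(2), of "-1"]] scale[OF that(2), of "-1"]
    by (simp add: complex_vector.scale_right_diff_distrib)
  have "Cauchy X"
  proof (rule CauchyI)
    fix t :: real assume t: "0 < t"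
    define K where "K = sqrt (M / m) + 1"
    have K: "K > 0" "sqrt (M / m) \<le> K" using riesz by (auto simp: K_def add_nonneg_pos)
    obtain n0 where n0: "\<And>i j. i \<ge> n0 \<Longrightarrow> j \<ge> n0 \<Longrightarrow> norm (?L (X i) - ?L (X j)) < d * t / K"
      using CauchyD[OF LIMSEQ_imp_Cauchy[OF lim], of "d * t / K"] d(1) t K by auto
    have "norm (X i - X j) < t" if "i \<ge> n0" "j \<ge> n0" for i j
    proof -
      have "d * norm (X i - X j) \<le> sqrt (M / m) * norm (?L (X i - X j))"
        by (intro bound complex_vector.span_diff X)
      also have "\<dots> \<le> K * norm (?L (X i) - ?L (X j))"
        unfolding L_diff[OF span_Dom[OF X] span_Dom[OF X]] using K by (intro mult_right_mono) auto
      also have "\<dots> < K * (d * t / K)" using n0[OF that] K by (intro mult_strict_left_mono) auto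
      finally show ?thesis using K d(1) by simp
    qed
    then show "\<exists>n0. \<forall>i\<ge>n0. \<forall>j\<ge>n0. norm (X i - X j) < t" by blast
  qed
  then obtain x where x: "X \<longlonglongrightarrow> x" using Cauchy_convergent convergent_def by blast
  have "(\<lambda>n. z *\<^sub>C X n) \<longlonglongrightarrow> z *\<^sub>C x"
  proof -
    have "(\<lambda>n. z *\<^sub>C X n - z *\<^sub>C x) \<longlonglongrightarrow> 0"
      by (rule Lim_null_comparison[OF _ tendsto_mult_right_zero[where c = "cmod z", OF tendsto_norm_zero[OF LIM_zero[OF x]]]])
        (auto simp: norm_scaleC simp flip: complex_vector.scale_right_diff_distrib)
    then show ?thesis by (rule LIM_zero_cancel)
  qed
  from tendsto_add[OF lim this] have "(\<lambda>n. T (X n)) \<longlonglongrightarrow> ?L w + z *\<^sub>C x" by simp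
  from closed[OF span_Dom[OF X] x this] have xD: "x \<in> Dom" "?L x = ?L w" by auto
  then have "x - w = 0"
    using L_diff[OF xD(1) w] w Dom by (intro inj) (auto intro: complex_vector.subspace_diff)
  then have "X \<longlonglongrightarrow> w" using x by simp
  then show ?thesis
    by (intro LIMSEQ_le[OF tendsto_mult[OF tendsto_const tendsto_norm] tendsto_mult[OF tendsto_const tendsto_norm[OF lim]]])
      (use bound[OF X] in auto)
qed

section \<open>Galerkin approximation of the spectrum of a damped system\<close>

locale damped_system = damped_modes +
  fixes Dom :: "'a::complex_hilbert set" and A0 :: "'a \<Rightarrow> 'a"
  assumes Dom: "csubspace Dom" and e_in_Dom: "k \<in> Zs \<Longrightarrow> e k \<in> Dom"
    and A0_add: "x \<in> Dom \<Longrightarrow> y \<in> Dom \<Longrightarrow> A0 (x + y) = A0 x + A0 y"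
    and A0_scaleC: "x \<in> Dom \<Longrightarrow> A0 (a *\<^sub>C x) = a *\<^sub>C A0 x"
    and A0_coeff: "x \<in> Dom \<Longrightarrow> k \<in> Zs \<Longrightarrow> cinner (A0 x) (e k) = lam k * cinner x (e k)"
    and A0_closed: "(\<And>n. X n \<in> Dom) \<Longrightarrow> X \<longlonglongrightarrow> x \<Longrightarrow> (\<lambda>n. A0 (X n)) \<longlonglongrightarrow> y \<Longrightarrow> x \<in> Dom \<and> A0 x = y"
begin

lemma supported_in_Dom:
  assumes "supported (ZsN N) w" shows "w \<in> Dom"
proof -
  have "part (ZsN N) w \<in> Dom"
    unfolding part_def using Dom ZsN_subset[of N]
    by (intro complex_vector.subspace_sum complex_vector.subspace_scale e_in_Dom) auto
  then show ?thesis using supported_eq_part[OF assms] by simp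
qed

text \<open>
  As an approximate eigenvector of the damped operator, a Galerkin eigenvector fails exactly by its
  residual.
\<close>

lemma galerkin_defect:
  assumes w: "supported (ZsN N) w" and eig: "maps_to (ZsN N) w (z *\<^sub>C w)"
  shows "A0 w - B w - z *\<^sub>C w = - residual N w"
proof (rule eq_if_coeff_eq)
  fix k assume k: "k \<in> Zs"
  show "cinner (A0 w - B w - z *\<^sub>C w) (e k) = cinner (- residual N w) (e k)"
  proof (cases "k \<in> ZsN N")
    case True
    then have "lam k * cinner w (e k) - cinner (B w) (e k) = z * cinner w (e k)"
      using eig by (simp add: maps_to_def cinner_scaleC_left)
    then show ?thesis
      using True k by (simp add: residual_def cinner_minus_left cinner_diff_left cinner_scaleC_left
          coeff_part ZsN_subset A0_coeff[OF supported_in_Dom[OF w]])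
  next
    case False
    then have "cinner w (e k) = 0" using w k by (simp add: supported_def)
    then show ?thesis
      using False k by (simp add: residual_def cinner_minus_left cinner_diff_left cinner_scaleC_left
          coeff_part ZsN_subset A0_coeff[OF supported_in_Dom[OF w]])
  qed
qed

lemma maps_to_Zs:
  assumes "x \<in> Dom" "A0 x - B x = y" shows "maps_to Zs x y"
  using assms by (auto simp: maps_to_def A0_coeff cinner_diff_left)

lemma B_LIMSEQ:
  assumes "X \<longlonglongrightarrow> x" shows "(\<lambda>n. B (X n)) \<longlonglongrightarrow> B x"
proof -
  have "(\<lambda>n. B (X n) - B x) \<longlonglongrightarrow> 0"
    by (rule Lim_null_comparison[OF _ tendsto_mult_right_zero[where c = \<beta>, OF tendsto_norm_zero[OF LIM_zero[OF assms]]]])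
      (auto simp: B_bound simp flip: B_minus)
  then show ?thesis by (rule LIM_zero_cancel)
qed

lemma damped_closed:
  assumes "\<And>n. X n \<in> Dom" "X \<longlonglongrightarrow> x" "(\<lambda>n. A0 (X n) - B (X n)) \<longlonglongrightarrow> y"
  shows "x \<in> Dom \<and> A0 x - B x = y"
proof -
  have "(\<lambda>n. A0 (X n)) \<longlonglongrightarrow> y + B x"
    using tendsto_add[OF assms(3) B_LIMSEQ[OF assms(2)]] by simp
  then show ?thesis using A0_closed[OF assms(1,2)] by auto
qed

context
  fixes \<nu> :: "int \<Rightarrow> complex" and U :: "int \<Rightarrow> 'a" and m M :: real
  assumes spectrum: "\<And>x z. x \<in> Dom \<Longrightarrow> A0 x - B x = z *\<^sub>C x \<Longrightarrow> x \<noteq> 0 \<Longrightarrow> z \<in> \<nu> ` Zs"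
    and U_Dom: "\<And>j. j \<in> Zs \<Longrightarrow> U j \<in> Dom" and U_eig: "\<And>j. j \<in> Zs \<Longrightarrow> A0 (U j) - B (U j) = \<nu> j *\<^sub>C U j"
    and \<nu>_order: "\<And>j. j \<in> Zs \<Longrightarrow> Im (\<nu> j) \<le> Im (\<nu> (zsucc j))"
    and U_dense: "\<And>x d. d > 0 \<Longrightarrow> \<exists>y\<in>cspan (U ` Zs). norm (x - y) < d"
    and m: "m > 0" and M: "M > 0"
    and riesz_lower: "\<And>F c. finite F \<Longrightarrow> F \<subseteq> Zs \<Longrightarrow>
      m * (\<Sum>j\<in>F. (cmod (c j))\<^sup>2) \<le> (norm (\<Sum>j\<in>F. c j *\<^sub>C U j))\<^sup>2"
    and riesz_upper: "\<And>F c. finite F \<Longrightarrow> F \<subseteq> Zs \<Longrightarrow>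
      (norm (\<Sum>j\<in>F. c j *\<^sub>C U j))\<^sup>2 \<le> M * (\<Sum>j\<in>F. (cmod (c j))\<^sup>2)"
begin

lemma U_nonzero: "j \<in> Zs \<Longrightarrow> U j \<noteq> 0"
  using riesz_lower[of "{j}" "\<lambda>_. 1"] m by auto

lemma damped_eigenvalue_in_disc: "j \<in> Zs \<Longrightarrow> \<exists>k\<in>Zs. in_disc k (\<nu> j)"
  by (rule eigenvalue_in_disc[of Zs "U j"])
    (auto simp: U_nonzero supported_def intro: maps_to_Zs U_Dom U_eig)

text \<open>
  The family \<open>\<nu>\<close> may repeat a value at several indices; within one disc only its values are unique.
\<close>

lemma damped_eigenvalue_unique:
  assumes "i \<in> Zs" "j \<in> Zs" "k \<in> Zs" "in_disc k (\<nu> i)" "in_disc k (\<nu> j)"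
  shows "\<nu> i = \<nu> j"
proof (rule ccontr)
  assume ne: "\<nu> i \<noteq> \<nu> j"
  have "U j \<notin> cspan {U i}"
    by (rule eigenvectors_independent[where I = Zs and w = "U i" and z = "\<nu> i" and z' = "\<nu> j"])
      (use assms ne in \<open>auto simp: U_nonzero supported_def intro: maps_to_Zs U_Dom U_eig\<close>)
  then show False
    by (intro at_most_one_eigenvalue_per_disc[of Zs k "\<nu> i" "\<nu> j" "U i" "U j" 0])
      (use assms in \<open>auto simp: U_nonzero supported_def intro: maps_to_Zs U_Dom U_eig\<close>)
qed

text \<open>
  The residual bound is taken proportional to \<open>\<beta>\<close>: without damping \<open>w\<close> is a true eigenvector, and the
  conclusion becomes an equality.
\<close>

lemma galerkin_eigenvalue_near_spectrum:
  assumes \<delta>: "\<delta> > 0" and w: "w \<noteq> 0" "supported (ZsN N) w" "maps_to (ZsN N) w (z *\<^sub>C w)"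
    and small: "norm (residual N w) \<le> \<delta> / (2 * sqrt (M / m)) * \<beta> * norm w"
  shows "\<exists>j\<in>Zs. cmod (z - \<nu> j) \<le> \<delta> * \<beta>"
proof (rule ccontr)
  assume "\<not> ?thesis"
  then have far: "\<delta> * \<beta> < cmod (z - \<nu> j)" if "j \<in> Zs" for j using that by auto
  have "\<delta> * \<beta> \<ge> 0" using \<delta> \<beta>_nonneg by simp
  then have not_eig: "z \<notin> \<nu> ` Zs" using far by fastforce
  have def: "A0 w - B w - z *\<^sub>C w = - residual N w" by (rule galerkin_defect[OF w(2,3)])
  have wD: "w \<in> Dom" by (rule supported_in_Dom[OF w(2)])
  show False
  proof (cases "\<beta> = 0")
    case True
    then have "A0 w - B w = z *\<^sub>C w" using small def by simp
    then show False using spectrum[OF wD] w(1) not_eig by blast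
  next
    case False
    then have d: "\<delta> * \<beta> > 0" using \<delta> \<beta>_nonneg by simp
    have "\<delta> * \<beta> * norm w \<le> sqrt (M / m) * norm (A0 w - B w - z *\<^sub>C w)"
      by (rule resolvent_bound_riesz_basis[where T = "\<lambda>x. A0 x - B x" and Dom = Dom and U = U
            and J = Zs and \<nu> = \<nu>, OF Dom _ _ damped_closed])
        (use far not_eig spectrum in \<open>auto simp: Dom A0_add A0_scaleC B_add B_scaleC U_Dom U_eig m M d wD
            riesz_lower riesz_upper complex_vector.scale_right_diff_distrib U_dense less_imp_le\<close>)
    also have "\<dots> \<le> sqrt (M / m) * (\<delta> / (2 * sqrt (M / m)) * \<beta> * norm w)"
      unfolding def norm_minus_cancel using small m M by (intro mult_left_mono) auto
    also have "\<dots> = \<delta> * \<beta> * norm w / 2" using m M by (simp add: field_simps)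
    finally have "\<delta> * \<beta> * norm w \<le> \<delta> * \<beta> * norm w / 2" .
    moreover have "0 < \<delta> * \<beta> * norm w" using d w(1) by simp
    ultimately show False by linarith
  qed
qed

theorem galerkin_spectrum_approximation:
  assumes decay: "\<And>d::real. d > 0 \<Longrightarrow> \<exists>r1::nat. r1 > 0 \<and> (\<forall>P::nat. P > 0 \<longrightarrow> (\<forall>i\<in>ZsN P.
      (\<Sum>\<^sub>\<infinity>j\<in>{j\<in>Zs. \<bar>j\<bar> \<ge> int P + int r1}. (cmod (cinner (B (e i)) (e j)))\<^sup>2) < d))"
    and G: "\<And>N. N \<ge> 1 \<Longrightarrow> galerkin_eigenvalues N (\<eta> N)" and \<epsilon>: "\<epsilon> > 0"
  shows "\<exists>r::nat. r > 0 \<and> (\<forall>N::nat. N > r \<longrightarrow>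
    (\<forall>p\<in>Zs. \<bar>p\<bar> \<le> int N - int r \<longrightarrow>
       (\<exists>j\<in>Zs. (\<forall>i\<in>Zs. cmod (\<eta> N p - \<nu> j) \<le> cmod (\<eta> N p - \<nu> i)) \<and>
               cmod (\<eta> N p - \<nu> j) \<le> 2 * \<epsilon>)) \<and>
    (\<forall>p\<in>Zs. \<bar>p\<bar> \<le> int N - int r \<longrightarrow>
       Min ((\<lambda>j. cmod (\<eta> N j - \<nu> p)) ` ZsN N) \<le> 2 * \<epsilon>))"
proof -
  \<comment> \<open>The bound \<open>1/4\<close> keeps approximation within one disc; the denominator \<open>\<beta> + 1\<close> cannot vanish.\<close>
  define \<delta> where "\<delta> = min (1 / 4) (2 * \<epsilon> / (\<beta> + 1))"
  have \<delta>: "\<delta> > 0" "\<delta> * \<beta> \<le> \<beta> / 4" "\<delta> * \<beta> \<le> 2 * \<epsilon>"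
  proof -
    show "\<delta> > 0" using \<epsilon> \<beta>_nonneg by (simp add: \<delta>_def add_nonneg_pos)
    show "\<delta> * \<beta> \<le> \<beta> / 4" using mult_right_mono[of \<delta> "1 / 4" \<beta>] \<beta>_nonneg by (simp add: \<delta>_def)
    have "\<delta> * \<beta> \<le> 2 * \<epsilon> / (\<beta> + 1) * (\<beta> + 1)"
      using \<epsilon> \<beta>_nonneg by (intro mult_mono) (auto simp: \<delta>_def)
    then show "\<delta> * \<beta> \<le> 2 * \<epsilon>" using \<beta>_nonneg by simp
  qed
  obtain r0 :: nat where r0: "r0 > 0" and res: "\<And>N p z w. N > r0 \<Longrightarrow> p \<in> Zs \<Longrightarrow> \<bar>p\<bar> \<le> int N - int r0 \<Longrightarrow>
      in_disc p z \<Longrightarrow> supported (ZsN N) w \<Longrightarrow> maps_to (ZsN N) w (z *\<^sub>C w) \<Longrightarrow>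
      norm (residual N w) \<le> \<delta> / (2 * sqrt (M / m)) * \<beta> * norm w"
    using galerkin_residual_small[OF decay, of "\<delta> / (2 * sqrt (M / m))"] \<delta>(1) m M by auto
  obtain \<sigma> where \<sigma>: "\<And>j. j \<in> Zs \<Longrightarrow> \<sigma> j \<in> Zs" "\<And>j. j \<in> Zs \<Longrightarrow> in_disc (\<sigma> j) (\<nu> j)"
    using damped_eigenvalue_in_disc by metis
  have disc: "in_disc p (\<eta> N p)" if "N > r0" "p \<in> Zs" "\<bar>p\<bar> \<le> int N - int r0" for N p
    using that by (intro galerkin_eigenvalue_in_disc[OF G]) (auto simp: ZsN_def)
  have near: "\<exists>j\<in>Zs. cmod (\<eta> N p - \<nu> j) \<le> \<delta> * \<beta> \<and> \<sigma> j = p"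
    if N: "N > r0" and p: "p \<in> Zs" "\<bar>p\<bar> \<le> int N - int r0" for N p
  proof -
    have "p \<in> ZsN N" using p by (auto simp: ZsN_def)
    then obtain w where w: "w \<noteq> 0" "supported (ZsN N) w" "maps_to (ZsN N) w (\<eta> N p *\<^sub>C w)"
      using G[of N] N unfolding galerkin_eigenvalues_def by fastforce
    obtain j where j: "j \<in> Zs" "cmod (\<eta> N p - \<nu> j) \<le> \<delta> * \<beta>"
      using galerkin_eigenvalue_near_spectrum[OF \<delta>(1) w res[OF N p disc[OF N p] w(2,3)]] by blast
    have "p = \<sigma> j"
      by (rule same_disc_if_close[OF disc[OF N p] \<sigma>(2)[OF j(1)] p(1) \<sigma>(1)[OF j(1)]]) (use j \<delta> in simp)
    then show ?thesis using j by auto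
  qed
  have "\<exists>C::nat. \<forall>p\<in>Zs. \<bar>\<sigma> p\<bar> \<le> \<bar>p\<bar> + int C"
  proof (rule monotone_surjection_shift_bound)
    fix p q :: int assume pq: "p \<in> Zs" "q \<in> Zs" "p \<le> q"
    then have "Im (\<nu> p) \<le> Im (\<nu> q)" by (intro monotone_from_zsucc[of p q "\<lambda>i. Im (\<nu> i)"]) (auto intro: \<nu>_order)
    then show "\<sigma> p \<le> \<sigma> q" using \<sigma> pq by (intro disc_index_mono[of "\<sigma> p" "\<nu> p" "\<sigma> q" "\<nu> q"]) auto
  next
    fix k assume k: "k \<in> Zs"
    show "\<exists>p\<in>Zs. \<sigma> p = k" using near[of "nat \<bar>k\<bar> + r0" k] k by (auto simp: Zs_def)
  qed (use \<sigma> in auto)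
  then obtain C :: nat where C: "\<And>p. p \<in> Zs \<Longrightarrow> \<bar>\<sigma> p\<bar> \<le> \<bar>p\<bar> + int C" by blast
  \<comment> \<open>The minimum is attained inside the disc: any \<open>\<nu> i\<close> of another disc is at distance \<open>\<beta>/2\<close> or more.\<close>
  have nearest: "\<exists>j\<in>Zs. (\<forall>i\<in>Zs. cmod (\<eta> N p - \<nu> j) \<le> cmod (\<eta> N p - \<nu> i)) \<and> cmod (\<eta> N p - \<nu> j) \<le> 2 * \<epsilon>"
    if N: "N > r0" and p: "p \<in> Zs" "\<bar>p\<bar> \<le> int N - int r0" for N p
  proof -
    obtain j where j: "j \<in> Zs" "cmod (\<eta> N p - \<nu> j) \<le> \<delta> * \<beta>" "\<sigma> j = p" using near[OF N p] by blast
    have "cmod (\<eta> N p - \<nu> j) \<le> cmod (\<eta> N p - \<nu> i)" if i: "i \<in> Zs" for i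
    proof (cases "\<sigma> i = p")
      case True
      then have "\<nu> i = \<nu> j" using damped_eigenvalue_unique[of i j p] i j p \<sigma>(2)[of i] \<sigma>(2)[of j] by simp
      then show ?thesis by simp
    next
      case False
      then have "\<beta> / 2 \<le> cmod (\<eta> N p - \<nu> i)"
        using discs_far_apart[OF disc[OF N p] \<sigma>(2)[OF i] p(1) \<sigma>(1)[OF i]] by auto
      then show ?thesis using j(2) \<delta>(2) \<beta>_nonneg by linarith
    qed
    then show ?thesis using j \<delta>(3) by (intro bexI[of _ j]) auto
  qed
  \<comment> \<open>The partner of \<open>\<nu> p\<close> is the Galerkin eigenvalue of the disc that contains \<open>\<nu> p\<close>.\<close>
  have attained: "Min ((\<lambda>j. cmod (\<eta> N j - \<nu> p)) ` ZsN N) \<le> 2 * \<epsilon>"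
    if N: "N > r0 + C" and p: "p \<in> Zs" "\<bar>p\<bar> \<le> int N - int (r0 + C)" for N p
  proof -
    define q where "q = \<sigma> p"
    have q: "q \<in> Zs" "\<bar>q\<bar> \<le> int N - int r0" using \<sigma>(1)[OF p(1)] C[OF p(1)] p(2) by (auto simp: q_def)
    obtain j where j: "j \<in> Zs" "cmod (\<eta> N q - \<nu> j) \<le> \<delta> * \<beta>" "\<sigma> j = q"
      using near[of N q] N q by auto
    have "\<nu> j = \<nu> p"
      using damped_eigenvalue_unique[of j p q] j p q \<sigma>(2)[of j] \<sigma>(2)[of p] by (simp add: q_def)
    then have "cmod (\<eta> N q - \<nu> p) \<le> 2 * \<epsilon>" using j(2) \<delta>(3) by simp
    moreover have "Min ((\<lambda>j. cmod (\<eta> N j - \<nu> p)) ` ZsN N) \<le> cmod (\<eta> N q - \<nu> p)"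
      using q by (intro Min_le finite_imageI finite_ZsN) (auto simp: ZsN_def)
    ultimately show ?thesis by linarith
  qed
  show ?thesis
    by (rule exI[of _ "r0 + C"]) (use r0 nearest attained in auto)
qed

end

end

section \<open>Completeness of the eigenvectors of an operator with compact inverse\<close>

lemma self_adjoint_op_swap:
  assumes "self_adjoint_op X ip D T" "x \<in> D" "y \<in> D"
  shows "ip (T x) y = ip x (T y)"
proof -
  have "(y, T y) \<in> adjoint_graph X ip D T" using assms unfolding self_adjoint_op_def by blast
  then show ?thesis using assms(2) by (simp add: adjoint_graph_def)
qed

text \<open>
  Two orthogonal eigenvectors would be independent in a one-dimensional generalized eigenspace.
\<close>

lemma simple_eigenvalue_orthogonal_eigenvector:
  fixes x y :: "'h::complex_inner"
  assumes "alg_mult D T z = 1" "csubspace D" and x: "x \<in> D" "T x = z *\<^sub>C x" "x \<noteq> 0"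
    and y: "y \<in> D" "T y = z *\<^sub>C y" and ort: "cinner x y = 0"
  shows "y = 0"
proof (rule ccontr)
  assume y0: "y \<noteq> 0"
  define E where "E = (\<Union>n. gen_kernel D T z n)"
  obtain b where b: "complex_vector.independent b" "E \<subseteq> cspan b" "card b = 1"
    using complex_vector.basis_exists[of E] assms(1) unfolding alg_mult_def E_def by metis
  have "finite b" using b(3) by (auto intro: card_ge_0_finite)
  have in_E: "u \<in> E" if "u \<in> D" "T u = z *\<^sub>C u" for u
    unfolding E_def using that by (auto intro!: exI[of _ 1])
  have xy: "x \<noteq> y" using ort x(3) by (auto simp: cinner_self)
  have "x \<notin> cspan {y}"
  proof
    assume "x \<in> cspan {y}"
    then obtain a where a: "x = a *\<^sub>C y" by (auto simp: complex_vector.span_singleton)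
    then have "a * cinner y y = 0" using ort by (simp add: cinner_scaleC_left)
    then show False using a x(3) y0 by (auto simp: cinner_self)
  qed
  then have "complex_vector.independent {x, y}"
    using y0 xy by (simp add: complex_vector.independent_insert)
  then have "card {x, y} \<le> card b"
    using complex_vector.independent_span_bound[OF \<open>finite b\<close>, of "{x, y}"] in_E[OF x(1,2)] in_E[OF y] b(2) by auto
  then show False using b(3) xy by simp
qed

text \<open>
  The inverse \<open>K\<close> of \<open>A\<close> maps the orthogonal complement \<open>M\<close> of the eigenvectors into itself. If \<open>M\<close> were
  nonzero, the supremum \<open>q\<close> of \<open>\<langle>Kx, x\<rangle>\<close> over unit vectors of \<open>M\<close> would be positive and, by compactness,
  an eigenvalue of \<open>K\<close> with an eigenvector in \<open>M\<close>. But \<open>1/q\<close> is then one of the simple eigenvalues of \<open>A\<close>,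
  whose eigenvector is orthogonal to \<open>M\<close>.
\<close>

lemma eigen_sequence_total:
  fixes A :: "'h::complex_hilbert \<Rightarrow> 'h"
  assumes sa: "self_adjoint_op UNIV cinner D A" and pos: "positive_op cinner D A"
    and cinv: "compact_inverse D A" and eig: "eigen_sequence D A \<mu> v"
    and g: "\<And>k. k \<ge> 1 \<Longrightarrow> cinner g (v k) = 0"
  shows "g = 0"
proof (rule ccontr)
  assume g0: "g \<noteq> 0"
  define K where "K = inv_into D A"
  have D: "csubspace D" and A_add: "\<And>x y. x \<in> D \<Longrightarrow> y \<in> D \<Longrightarrow> A (x + y) = A x + A y"
    and A_scale: "\<And>a x. x \<in> D \<Longrightarrow> A (a *\<^sub>C x) = a *\<^sub>C A x"
    using sa by (auto simp: self_adjoint_op_def linear_op_def)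
  have bij: "bij_betw A D UNIV" and cpt: "compact (closure (K ` cball 0 1))"
    using cinv by (auto simp: compact_inverse_def K_def)
  have KD: "K x \<in> D" and AK: "A (K x) = x" for x
    using bij by (auto simp: K_def bij_betw_def intro: inv_into_into f_inv_into_f)
  have KA: "K (A x) = x" if "x \<in> D" for x
    using bij that by (auto simp: K_def bij_betw_def intro: inv_into_f_f)
  have K_add: "K (x + y) = K x + K y" for x y
    using KA[of "K x + K y"] KD AK A_add D by (simp add: complex_vector.subspace_add)
  have K_scaleC: "K (a *\<^sub>C x) = a *\<^sub>C K x" for a x
    using KA[of "a *\<^sub>C K x"] KD AK A_scale D by (simp add: complex_vector.subspace_scale)
  have K_scaleR: "K (r *\<^sub>R x) = r *\<^sub>R K x" for r x by (simp add: scaleR_scaleC K_scaleC)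
  have K_swap: "cinner (K x) y = cinner x (K y)" for x y
    using self_adjoint_op_swap[OF sa KD KD, of x y] by (simp add: AK)
  have K_sym: "inner (K x) y = inner x (K y)" for x y
    using K_swap[of x y] by (metis Re_cinner)
  have K_pos: "0 \<le> inner (K x) x" for x
  proof -
    have "0 \<le> inner (A (K x)) (K x)" using pos KD[of x] by (simp add: positive_op_def Re_cinner)
    then show ?thesis by (simp add: AK inner_commute)
  qed
  obtain C where C: "C > 0" "\<And>x. norm (K x) \<le> C * norm x"
  proof -
    have "bounded (K ` cball 0 1)"
      using cpt by (meson bounded_closure_image compact_imp_bounded bounded_subset closure_subset)
    then obtain c where c: "c > 0" "\<And>x. norm x \<le> 1 \<Longrightarrow> norm (K x) \<le> c"
      unfolding bounded_pos by auto
    have "norm (K x) \<le> c * norm x" for x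
    proof (cases "x = 0")
      case True
      then show ?thesis using K_scaleC[of 0 0] by simp
    next
      case False
      then have "norm (K ((1 / norm x) *\<^sub>R x)) \<le> c" by (intro c(2)) simp
      then show ?thesis using False by (simp add: K_scaleR field_simps)
    qed
    then show ?thesis using that c(1) by blast
  qed
  define M where "M = {x. \<forall>k\<ge>1. cinner x (v k) = 0}"
  have M_sub: "subspace M"
    by (auto simp: subspace_def M_def cinner_add_left scaleR_scaleC cinner_scaleC_left)
  have vD: "v k \<in> D" "norm (v k) = 1" "A (v k) = complex_of_real (\<mu> k) *\<^sub>C v k" "\<mu> k > 0" if "k \<ge> 1" for k
  proof -
    show "v k \<in> D" "norm (v k) = 1" "A (v k) = complex_of_real (\<mu> k) *\<^sub>C v k"
      using eig that by (auto simp: eigen_sequence_def)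
    have "\<mu> 1 \<le> \<mu> k" using eig that strict_mono_on_leD[of "{1..}" \<mu> 1 k] by (auto simp: eigen_sequence_def)
    then show "\<mu> k > 0" using eig by (auto simp: eigen_sequence_def)
  qed
  have KM: "K x \<in> M" if "x \<in> M" for x
    unfolding M_def
  proof clarify
    fix k :: nat assume k: "k \<ge> 1"
    have "cinner (K x) (A (v k)) = cinner x (v k)" using K_swap[of x "A (v k)"] KA[of "v k"] vD[OF k] by simp
    also have "\<dots> = 0" using that k by (simp add: M_def)
    finally show "cinner (K x) (v k) = 0" using vD[OF k] by (simp add: cinner_scaleC_right)
  qed
  define Q where "Q = (\<lambda>x. inner (K x) x) ` {x\<in>M. norm x = 1}"
  define q where "q = Sup Q"
  have bdd: "bdd_above Q"
  proof (rule bdd_aboveI[of _ C])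
    fix t assume "t \<in> Q"
    then obtain x where x: "norm x = 1" "t = inner (K x) x" by (auto simp: Q_def)
    then show "t \<le> C" using norm_cauchy_schwarz[of "K x" x] C(2)[of x] by simp
  qed
  define u where "u = (1 / norm g) *\<^sub>R g"
  have u: "u \<in> M" "norm u = 1"
    using g g0 by (auto simp: u_def M_def scaleR_scaleC cinner_scaleC_left norm_scaleC norm_divide)
  then have uQ: "inner (K u) u \<in> Q" by (auto simp: Q_def)
  have "inner (K u) u \<noteq> 0"
  proof
    assume "inner (K u) u = 0"
    moreover have "(norm (K u))\<^sup>2 \<le> C * inner (K u) u"
      by (rule norm_sq_le_psd_form[of UNIV]) (auto simp: K_add K_scaleR K_pos C intro: K_sym)
    ultimately have "K u = 0" by simp
    then have "u = A 0" using AK[of u] by simp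
    then show False using A_scale[of 0 0] complex_vector.subspace_0[OF D] u(2) by simp
  qed
  then have q: "q > 0" using cSup_upper[OF uQ bdd] K_pos[of u] by (simp add: q_def)
  define T where "T x = q *\<^sub>R x - K x" for x
  have T_pos: "0 \<le> inner (T x) x" if x: "x \<in> M" for x
  proof (cases "x = 0")
    case False
    let ?x = "(1 / norm x) *\<^sub>R x"
    have "inner (K ?x) ?x \<in> Q" unfolding Q_def
      by (rule imageI) (use False x M_sub in \<open>auto simp: subspace_scale\<close>)
    then have "inner (K ?x) ?x \<le> q" using cSup_upper[OF _ bdd] by (simp add: q_def)
    then have "inner (K x) x \<le> q * (norm x)\<^sup>2"
      using False by (simp add: K_scaleR field_simps power2_eq_square)
    then show ?thesis by (simp add: T_def inner_diff_left power2_norm_eq_inner)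
  qed simp
  have T_bound: "(norm (T x))\<^sup>2 \<le> (q + C) * inner (T x) x" if "x \<in> M" for x
  proof (rule norm_sq_le_psd_form[OF M_sub _ _ _ _ T_pos _ that])
    fix y assume y: "y \<in> M"
    then show "T y \<in> M" using KM M_sub by (simp add: T_def subspace_diff subspace_scale)
    show "norm (T y) \<le> (q + C) * norm y"
      using norm_triangle_ineq4[of "q *\<^sub>R y" "K y"] C(2)[of y] q by (simp add: T_def algebra_simps)
  qed (auto simp: T_def K_add K_scaleR algebra_simps inner_diff_left inner_diff_right K_sym)
  have "\<exists>x\<in>M. norm x = 1 \<and> q - inverse (real (Suc n)) < inner (K x) x" for n
  proof -
    have "\<exists>t\<in>Q. q - inverse (real (Suc n)) < t"
      using less_cSupE[of "q - inverse (real (Suc n))" Q] uQ by (auto simp: q_def)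
    then show ?thesis by (auto simp: Q_def)
  qed
  then obtain X where X: "\<And>n. X n \<in> M" "\<And>n. norm (X n) = 1"
    "\<And>n. q - inverse (real (Suc n)) < inner (K (X n)) (X n)" by metis
  \<comment> \<open>A maximising sequence consists of approximate eigenvectors, as \<open>q - K\<close> is nonnegative on \<open>M\<close>.\<close>
  have TX: "(\<lambda>n. T (X n)) \<longlonglongrightarrow> 0"
  proof -
    have "(\<lambda>n. (q + C) * inverse (real (Suc n))) \<longlonglongrightarrow> 0"
      by (rule tendsto_mult_right_zero[OF LIMSEQ_inverse_real_of_nat])
    then have "(\<lambda>n. (norm (T (X n)))\<^sup>2) \<longlonglongrightarrow> 0"
    proof (rule Lim_null_comparison[rotated], intro always_eventually allI)
      fix n
      have "inner (T (X n)) (X n) \<le> inverse (real (Suc n))"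
        using X(2,3)[of n] by (simp add: T_def inner_diff_left dot_square_norm)
      then have "(q + C) * inner (T (X n)) (X n) \<le> (q + C) * inverse (real (Suc n))"
        using q C by (intro mult_left_mono) auto
      then show "norm ((norm (T (X n)))\<^sup>2) \<le> (q + C) * inverse (real (Suc n))"
        using T_bound[OF X(1)[of n]] by simp
    qed
    then have "(\<lambda>n. sqrt ((norm (T (X n)))\<^sup>2)) \<longlonglongrightarrow> sqrt 0" by (rule tendsto_real_sqrt)
    then show ?thesis by (simp add: tendsto_norm_zero_iff)
  qed
  have "\<forall>n. K (X n) \<in> closure (K ` cball 0 1)"
    using X(2) closure_subset[of "K ` cball 0 1"] by auto
  then obtain l and r :: "nat \<Rightarrow> nat" where r: "strict_mono r" and l: "((\<lambda>n. K (X n)) \<circ> r) \<longlonglongrightarrow> l"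
    using cpt unfolding compact_def by metis
  define x where "x = (1 / q) *\<^sub>R l"
  have Xr: "(\<lambda>n. X (r n)) \<longlonglongrightarrow> x"
  proof -
    have "(\<lambda>n. T (X (r n))) \<longlonglongrightarrow> 0" using LIMSEQ_subseq_LIMSEQ[OF TX r] by (simp add: o_def)
    from tendsto_add[OF this l[unfolded o_def]] have "(\<lambda>n. q *\<^sub>R X (r n)) \<longlonglongrightarrow> l" by (simp add: T_def)
    from tendsto_scaleR[OF tendsto_const[of "1 / q"] this] show ?thesis using q by (simp add: x_def)
  qed
  have x1: "norm x = 1" using LIMSEQ_unique[OF tendsto_norm[OF Xr]] X(2) by simp
  have xM: "cinner x (v k) = 0" if "k \<ge> 1" for k
    using LIMSEQ_unique[OF tendsto_cinner_left[OF Xr, of "v k"]] X(1) that by (simp add: M_def)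
  have "(\<lambda>n. K (X (r n)) - K x) \<longlonglongrightarrow> 0"
  proof (rule Lim_null_comparison[OF _ tendsto_mult_right_zero[where c = C, OF tendsto_norm_zero[OF LIM_zero[OF Xr]]]])
    have K_diff: "K y - K x = K (y - x)" for y using K_add[of "y - x" x] by simp
    show "\<forall>\<^sub>F n in sequentially. norm (K (X (r n)) - K x) \<le> C * norm (X (r n) - x)"
      unfolding K_diff using C(2) by simp
  qed
  from LIMSEQ_unique[OF LIM_zero_cancel[OF this] l[unfolded o_def]] have "K x = l" .
  then have Kx: "K x = complex_of_real q *\<^sub>C x" using q by (simp add: x_def flip: scaleR_scaleC)
  have x_eq: "x = complex_of_real (1 / q) *\<^sub>C K x"
    unfolding Kx scaleC_scaleC using q by (simp add: scaleC_one)
  have xD: "x \<in> D" by (subst x_eq) (intro complex_vector.subspace_scale D KD)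
  have Ax: "A x = complex_of_real (1 / q) *\<^sub>C x"
    using A_scale[OF KD, of "complex_of_real (1 / q)" x] unfolding x_eq[symmetric] AK .
  have "x \<noteq> 0" using x1 by auto
  then have "complex_of_real (1 / q) \<in> eigvals D A" using xD Ax by (auto simp: eigvals_def)
  then obtain k where k: "k \<ge> 1" "complex_of_real (1 / q) = complex_of_real (\<mu> k)"
    using eig unfolding eigen_sequence_def by (metis (no_types, lifting) imageE atLeast_iff)
  have "x = 0"
  proof (rule simple_eigenvalue_orthogonal_eigenvector)
    show "alg_mult D A (complex_of_real (\<mu> k)) = 1" using eig k by (auto simp: eigen_sequence_def)
    show "cinner (v k) x = 0" using xM[OF k(1)] cinner_commute[of "v k" x] by simp
    show "v k \<noteq> 0" using vD[OF k(1)] by auto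
  qed (use D vD[OF k(1)] xD Ax k(2) in \<open>auto simp del: of_real_divide\<close>)
  then show False using x1 by simp
qed

text \<open>
  Some power of \<open>T - z\<close> has a kernel that is not contained in the span of \<open>F\<close>; take the first one. With
  \<open>F = {}\<close> this yields an eigenvector, and with \<open>F\<close> an eigenvector it yields the second vector of a
  plane on which \<open>T\<close> is triangular.
\<close>

lemma exists_generalized_eigenvector:
  assumes F: "finite F" "card F < alg_mult G T z"
  shows "\<exists>x\<in>G. x \<notin> cspan F \<and> T x - z *\<^sub>C x \<in> cspan F"
proof -
  have "\<not> (\<Union>n. gen_kernel G T z n) \<subseteq> cspan F"
    using complex_vector.dim_le_card[OF _ F(1)] F(2) unfolding alg_mult_def by (meson not_le)
  then have ex: "\<exists>n. \<not> gen_kernel G T z n \<subseteq> cspan F" by blast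
  define n where "n = (LEAST n. \<not> gen_kernel G T z n \<subseteq> cspan F)"
  have n: "\<not> gen_kernel G T z n \<subseteq> cspan F" unfolding n_def using ex by (rule LeastI_ex)
  then obtain k where k: "n = Suc k" by (cases n) (auto simp: complex_vector.span_zero)
  have "gen_kernel G T z k \<subseteq> cspan F"
    using not_less_Least[of k "\<lambda>n. \<not> gen_kernel G T z n \<subseteq> cspan F"] k n_def by auto
  then show ?thesis using n unfolding k by auto
qed

section \<open>The energy space in isometric coordinates\<close>

locale energy_setting =
  fixes D DS :: "'h::complex_hilbert set" and A S :: "'h \<Rightarrow> 'h"
    and \<mu> :: "nat \<Rightarrow> real" and v :: "nat \<Rightarrow> 'h" and B :: "'h \<times> 'h \<Rightarrow> 'h \<times> 'h"
  assumes A_self_adjoint: "self_adjoint_op UNIV cinner D A"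
    and A_positive: "positive_op cinner D A"
    and A_compact_inverse: "compact_inverse D A"
    and A_eigen: "eigen_sequence D A \<mu> v"
    and S_sqrt: "is_sqrt_op DS S D A"
    and B_bounded: "bounded_op (energy_space DS) (energy_ip S) B"
    and B_positive: "positive_op (energy_ip S) (energy_space DS) B"
    and H1_skew: "skew_adjoint_op (energy_space DS) (energy_ip S) (wave_dom D DS) (wave_op A)"
    and H2: "\<And>j. j \<in> Zs \<Longrightarrow> j + 1 \<in> Zs \<Longrightarrow>
      cmod (freq \<mu> (j + 1) - freq \<mu> j) > 2 * op_norm (energy_space DS) (energy_ip S) B"
    and H3: "op_norm (energy_space DS) (energy_ip S) B \<le> cmod (freq \<mu> 1)"
begin

abbreviation "X \<equiv> energy_space DS"
abbreviation "ip \<equiv> energy_ip S"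
abbreviation "W \<equiv> wave_dom D DS"
abbreviation "V \<equiv> wave_mode \<mu> v"

text \<open>
  The isometry from the energy space onto \<open>H \<times> H\<close>, followed by its inverse.
\<close>

definition \<Phi> :: "'h \<times> 'h \<Rightarrow> 'h \<times> 'h" where
  "\<Phi> Y = (S (fst Y), snd Y)"

definition \<Psi> :: "'h \<times> 'h \<Rightarrow> 'h \<times> 'h" where
  "\<Psi> Z = (inv_into DS S (fst Z), snd Z)"

lemma S_self_adjoint: "self_adjoint_op UNIV cinner DS S"
  and D_eq: "D = {x\<in>DS. S x \<in> DS}" and A_eq: "x \<in> D \<Longrightarrow> A x = S (S x)"
  using S_sqrt by (auto simp: is_sqrt_op_def)

lemma DS: "csubspace DS" and S_add: "x \<in> DS \<Longrightarrow> y \<in> DS \<Longrightarrow> S (x + y) = S x + S y"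
  and S_scaleC: "x \<in> DS \<Longrightarrow> S (a *\<^sub>C x) = a *\<^sub>C S x"
  using S_self_adjoint by (auto simp: self_adjoint_op_def linear_op_def)

text \<open>
  The square root inherits bijectivity from \<open>A\<close>, which is its square.
\<close>

lemma S_bij: "bij_betw S DS UNIV"
proof -
  have bij: "bij_betw A D UNIV" using A_compact_inverse by (simp add: compact_inverse_def)
  have S0: "S 0 = 0" using S_scaleC[of 0 0] complex_vector.subspace_0[OF DS] by simp
  have D0: "0 \<in> D" using complex_vector.subspace_0[OF DS] S0 by (simp add: D_eq)
  have inj0: "x = 0" if "x \<in> DS" "S x = 0" for x
  proof -
    have "x \<in> D" using that complex_vector.subspace_0[OF DS] by (simp add: D_eq)
    moreover from this have "A x = A 0" using A_eq[of x] A_eq[OF D0] that S0 by simp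
    ultimately show ?thesis using bij D0 by (auto simp: bij_betw_def inj_on_def)
  qed
  have "inj_on S DS"
  proof (rule inj_onI)
    fix x y assume xy: "x \<in> DS" "y \<in> DS" "S x = S y"
    have y: "(-1) *\<^sub>C y \<in> DS" by (rule complex_vector.subspace_scale[OF DS xy(2)])
    have "S (x + (-1) *\<^sub>C y) = S x + (-1) *\<^sub>C S y"
      by (simp only: S_add[OF xy(1) y] S_scaleC[OF xy(2)])
    also have "\<dots> = 0" using xy by (simp add: scaleC_one)
    finally have "x + (-1) *\<^sub>C y = 0" by (rule inj0[OF complex_vector.subspace_add[OF DS xy(1) y]])
    then show "x = y" by (simp add: scaleC_one)
  qed
  moreover have "y \<in> S ` DS" for y
  proof -
    obtain x where "x \<in> D" "A x = y" using bij by (metis UNIV_I bij_betw_imp_surj_on imageE)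
    then show ?thesis using A_eq[of x] by (auto simp: D_eq intro!: image_eqI[of _ _ "S x"])
  qed
  ultimately show ?thesis by (auto simp: bij_betw_def)
qed

lemma X: "csubspace X"
  using DS by (auto simp: complex_vector.subspace_def energy_space_def scaleC_prod_def zero_prod_def)

lemma \<Psi>_in_X [simp]: "\<Psi> Z \<in> X"
  using S_bij by (auto simp: \<Psi>_def energy_space_def bij_betw_def intro: inv_into_into)

lemma \<Phi>_\<Psi> [simp]: "\<Phi> (\<Psi> Z) = Z"
  using S_bij by (simp add: \<Phi>_def \<Psi>_def bij_betw_def f_inv_into_f)

lemma \<Psi>_\<Phi> [simp]: "Y \<in> X \<Longrightarrow> \<Psi> (\<Phi> Y) = Y"
  using S_bij by (auto simp: \<Phi>_def \<Psi>_def energy_space_def bij_betw_def inv_into_f_f)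

lemma \<Phi>_add: "Y \<in> X \<Longrightarrow> Z \<in> X \<Longrightarrow> \<Phi> (Y + Z) = \<Phi> Y + \<Phi> Z"
  by (auto simp: \<Phi>_def energy_space_def S_add)

lemma \<Phi>_scaleC: "Y \<in> X \<Longrightarrow> \<Phi> (a *\<^sub>C Y) = a *\<^sub>C \<Phi> Y"
  by (auto simp: \<Phi>_def energy_space_def S_scaleC scaleC_prod_def)

lemma \<Phi>_zero [simp]: "\<Phi> 0 = 0"
  using \<Phi>_scaleC[OF complex_vector.subspace_0[OF X], of 0] by simp

lemma \<Phi>_minus: "Y \<in> X \<Longrightarrow> \<Phi> (- Y) = - \<Phi> Y"
  using \<Phi>_scaleC[of Y "-1"] by (simp add: scaleC_one)

lemma \<Phi>_diff: "Y \<in> X \<Longrightarrow> Z \<in> X \<Longrightarrow> \<Phi> (Y - Z) = \<Phi> Y - \<Phi> Z"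
  using \<Phi>_add[of Y "- Z"] \<Phi>_minus[of Z] complex_vector.subspace_neg[OF X, of Z] by simp

lemma \<Phi>_sum: "(\<And>i. i \<in> I \<Longrightarrow> f i \<in> X) \<Longrightarrow> \<Phi> (\<Sum>i\<in>I. f i) = (\<Sum>i\<in>I. \<Phi> (f i))"
  by (induction I rule: infinite_finite_induct)
    (auto simp: \<Phi>_add complex_vector.subspace_sum[OF X])

lemma \<Phi>_eq_0_iff: "Y \<in> X \<Longrightarrow> \<Phi> Y = 0 \<longleftrightarrow> Y = 0"
  by (metis \<Psi>_\<Phi> \<Phi>_zero complex_vector.subspace_0[OF X])

lemma \<Psi>_add: "\<Psi> (Y + Z) = \<Psi> Y + \<Psi> Z"
  using \<Psi>_\<Phi>[of "\<Psi> Y + \<Psi> Z"] X by (simp add: \<Phi>_add complex_vector.subspace_add)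

lemma \<Psi>_scaleC: "\<Psi> (a *\<^sub>C Y) = a *\<^sub>C \<Psi> Y"
  using \<Psi>_\<Phi>[of "a *\<^sub>C \<Psi> Y"] X by (simp add: \<Phi>_scaleC complex_vector.subspace_scale)

lemma ip_eq: "ip Y Z = cinner (\<Phi> Y) (\<Phi> Z)"
  by (simp add: energy_ip_def \<Phi>_def cinner_prod_def)

lemma ip_norm_eq: "ip_norm ip Y = norm (\<Phi> Y)"
  by (simp add: ip_norm_def ip_eq cinner_self)

lemma B_X: "Y \<in> X \<Longrightarrow> B Y \<in> X" and B_add: "Y \<in> X \<Longrightarrow> Z \<in> X \<Longrightarrow> B (Y + Z) = B Y + B Z"
  and B_scaleC: "Y \<in> X \<Longrightarrow> B (a *\<^sub>C Y) = a *\<^sub>C B Y"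
  using B_bounded by (auto simp: bounded_op_def linear_op_def)

lemma W: "csubspace W" and W_X: "Y \<in> W \<Longrightarrow> Y \<in> X" and wave_X: "Y \<in> W \<Longrightarrow> wave_op A Y \<in> X"
  and wave_add: "Y \<in> W \<Longrightarrow> Z \<in> W \<Longrightarrow> wave_op A (Y + Z) = wave_op A Y + wave_op A Z"
  and wave_scaleC: "Y \<in> W \<Longrightarrow> wave_op A (a *\<^sub>C Y) = a *\<^sub>C wave_op A Y"
  using H1_skew by (auto simp: skew_adjoint_op_def linear_op_def)

lemma skew_graph: "adjoint_graph X ip W (wave_op A) = {(x, - wave_op A x) |x. x \<in> W}"
  using H1_skew by (simp add: skew_adjoint_op_def)

lemma wave_skew:
  assumes "Y \<in> W" "Z \<in> W" shows "ip (wave_op A Y) Z = ip Y (- wave_op A Z)"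
proof -
  have "(Z, - wave_op A Z) \<in> adjoint_graph X ip W (wave_op A)"
    using assms unfolding skew_graph by blast
  then show ?thesis using assms by (simp add: adjoint_graph_def)
qed

text \<open>
  The imaginary part of the frequency, which is what orders and separates the modes.
\<close>

definition freq_im :: "int \<Rightarrow> real" where
  "freq_im k = of_int (sgn k) * sqrt (\<mu> (nat \<bar>k\<bar>))"

lemma freq_eq: "freq \<mu> k = \<i> * complex_of_real (freq_im k)"
  by (simp add: freq_def freq_im_def)

abbreviation "op_B \<equiv> op_norm X ip B"

lemma \<mu>_pos: "k \<ge> 1 \<Longrightarrow> \<mu> k > 0" and \<mu>_mono: "1 \<le> j \<Longrightarrow> j < k \<Longrightarrow> \<mu> j < \<mu> k"
proof -
  have mono: "strict_mono_on {1..} \<mu>" using A_eigen by (simp add: eigen_sequence_def)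
  then show "1 \<le> j \<Longrightarrow> j < k \<Longrightarrow> \<mu> j < \<mu> k" by (auto simp: strict_mono_on_def)
  show "k \<ge> 1 \<Longrightarrow> \<mu> k > 0"
    using A_eigen strict_mono_on_leD[OF mono, of 1 k] by (auto simp: eigen_sequence_def)
qed

lemma v_props:
  assumes "k \<ge> 1"
  shows "v k \<in> D" "norm (v k) = 1" "A (v k) = complex_of_real (\<mu> k) *\<^sub>C v k" "v k \<in> DS"
  using A_eigen assms D_eq by (auto simp: eigen_sequence_def)

lemma freq_im_less: "k \<in> Zs \<Longrightarrow> freq_im k < freq_im (zsucc k)"
proof -
  assume k: "k \<in> Zs"
  consider "k = -1" | "k \<ge> 1" | "k \<le> -2" using k by (force simp: Zs_def)
  then show ?thesis
  proof cases
    case 1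
    then show ?thesis using \<mu>_pos[of 1] by (simp add: freq_im_def zsucc_def)
  next
    case 2
    then show ?thesis using \<mu>_mono[of "nat k" "nat (k + 1)"] by (simp add: freq_im_def zsucc_def)
  next
    case 3
    then have "\<mu> (nat (- 1 - k)) < \<mu> (nat (- k))" by (intro \<mu>_mono) auto
    then show ?thesis using 3 by (simp add: freq_im_def zsucc_def algebra_simps)
  qed
qed

text \<open>
  The step from \<open>-1\<close> to \<open>1\<close> has length twice the modulus of the first frequency, which the bound of the
  damping by that modulus makes large enough.
\<close>

lemma freq_im_gap: "k \<in> Zs \<Longrightarrow> 2 * op_B \<le> freq_im (zsucc k) - freq_im k"
proof -
  assume k: "k \<in> Zs"
  have cmod_freq: "cmod (freq \<mu> j - freq \<mu> i) = \<bar>freq_im j - freq_im i\<bar>" for i j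
    unfolding freq_eq by (simp add: norm_mult flip: right_diff_distrib of_real_diff)
  show ?thesis
  proof (cases "k = -1")
    case True
    then show ?thesis using H3 \<mu>_pos[of 1]
      by (simp add: zsucc_def freq_eq norm_mult) (simp add: freq_im_def)
  next
    case False
    then have "zsucc k = k + 1" "k + 1 \<in> Zs" using k by (auto simp: zsucc_def Zs_def)
    then show ?thesis using H2[OF k] freq_im_less[OF k] by (simp add: cmod_freq)
  qed
qed

lemma freq_neq_0: "k \<in> Zs \<Longrightarrow> freq \<mu> k \<noteq> 0"
proof -
  assume k: "k \<in> Zs"
  then have "1 \<le> nat \<bar>k\<bar>" by (auto simp: Zs_def)
  from \<mu>_pos[OF this] k show ?thesis by (auto simp: freq_def Zs_def sgn_if)
qed

lemma freq_square: "k \<in> Zs \<Longrightarrow> freq \<mu> k * freq \<mu> k = - complex_of_real (\<mu> (nat \<bar>k\<bar>))"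
  and freq_cnj: "cnj (freq \<mu> k) = - freq \<mu> k"
proof -
  show "cnj (freq \<mu> k) = - freq \<mu> k" by (simp add: freq_eq)
  assume k: "k \<in> Zs"
  have "freq_im k * freq_im k = \<mu> (nat \<bar>k\<bar>)"
  proof -
    have "1 \<le> nat \<bar>k\<bar>" using k by (auto simp: Zs_def)
    from \<mu>_pos[OF this] k show ?thesis by (auto simp: freq_im_def Zs_def sgn_if)
  qed
  then have "complex_of_real (freq_im k) * complex_of_real (freq_im k) = complex_of_real (\<mu> (nat \<bar>k\<bar>))"
    by (metis of_real_mult)
  then show "freq \<mu> k * freq \<mu> k = - complex_of_real (\<mu> (nat \<bar>k\<bar>))"
    by (simp add: freq_eq) (metis (no_types) i_squared mult.assoc mult.left_commute mult_minus1)
qed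

lemma V_W: "k \<in> Zs \<Longrightarrow> V k \<in> W"
proof -
  assume "k \<in> Zs"
  then have "nat \<bar>k\<bar> \<ge> 1" by (auto simp: Zs_def)
  then have "((1 / freq \<mu> k) *\<^sub>C v (nat \<bar>k\<bar>), v (nat \<bar>k\<bar>)) \<in> W"
    using v_props[of "nat \<bar>k\<bar>"] A_self_adjoint
    by (auto simp: wave_dom_def self_adjoint_op_def linear_op_def complex_vector.subspace_scale)
  then show ?thesis unfolding wave_mode_def by (rule complex_vector.subspace_scale[OF W])
qed

lemma V_X: "k \<in> Zs \<Longrightarrow> V k \<in> X"
  using V_W W_X by blast

lemma wave_V: "k \<in> Zs \<Longrightarrow> wave_op A (V k) = freq \<mu> k *\<^sub>C V k"
proof -
  assume k: "k \<in> Zs"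
  define n where "n = nat \<bar>k\<bar>"
  have n: "n \<ge> 1" using k by (auto simp: n_def Zs_def)
  let ?Y = "((1 / freq \<mu> k) *\<^sub>C v n, v n)"
  have Y: "?Y \<in> W"
    using v_props[OF n] A_self_adjoint
    by (auto simp: wave_dom_def self_adjoint_op_def linear_op_def complex_vector.subspace_scale)
  have "A ((1 / freq \<mu> k) *\<^sub>C v n) = (1 / freq \<mu> k) *\<^sub>C complex_of_real (\<mu> n) *\<^sub>C v n"
    using v_props[OF n] A_self_adjoint by (auto simp: self_adjoint_op_def linear_op_def)
  also have "\<dots> = - (freq \<mu> k *\<^sub>C v n)"
    using freq_square[OF k] freq_neq_0[OF k]
    by (simp add: scaleC_scaleC n_def nonzero_divide_eq_eq flip: complex_vector.scale_minus_left)
  finally have "wave_op A ?Y = freq \<mu> k *\<^sub>C ?Y"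
    using freq_neq_0[OF k] by (simp add: wave_op_def scaleC_prod_def scaleC_scaleC scaleC_one)
  then show ?thesis
    unfolding wave_mode_def n_def[symmetric] wave_scaleC[OF Y]
    by (simp add: scaleC_scaleC mult.commute)
qed

lemma cinner_v:
  assumes "j \<ge> 1" "k \<ge> 1" shows "cinner (v j) (v k) = (if j = k then 1 else 0)"
proof (cases "j = k")
  case True
  then show ?thesis using v_props(2)[OF assms(2)] by (simp add: cinner_self)
next
  case False
  have "complex_of_real (\<mu> j) * cinner (v j) (v k) = complex_of_real (\<mu> k) * cinner (v j) (v k)"
    using self_adjoint_op_swap[OF A_self_adjoint v_props(1)[OF assms(1)] v_props(1)[OF assms(2)]]
    by (simp add: v_props(3)[OF assms(1)] v_props(3)[OF assms(2)] cinner_scaleC_left cinner_scaleC_right)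
  moreover have "\<mu> j \<noteq> \<mu> k"
    using \<mu>_mono[of j k] \<mu>_mono[of k j] assms False by (cases "j < k") auto
  ultimately show ?thesis using False by simp
qed

lemma cinner_S_v:
  assumes "x \<in> DS" "k \<ge> 1"
  shows "cinner (S x) (S (v k)) = complex_of_real (\<mu> k) * cinner x (v k)"
proof -
  have "S (v k) \<in> DS" "S (S (v k)) = complex_of_real (\<mu> k) *\<^sub>C v k"
    using v_props[OF assms(2)] D_eq A_eq[of "v k"] by auto
  then show ?thesis
    using self_adjoint_op_swap[OF S_self_adjoint assms(1), of "S (v k)"] by (simp add: cinner_scaleC_right)
qed

lemma ip_V:
  assumes "Y \<in> X" "k \<in> Zs"
  shows "ip Y (V k) = complex_of_real (1 / sqrt 2)
    * (freq \<mu> k * cinner (fst Y) (v (nat \<bar>k\<bar>)) + cinner (snd Y) (v (nat \<bar>k\<bar>)))"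
proof -
  define n where "n = nat \<bar>k\<bar>"
  have n: "n \<ge> 1" using assms(2) by (auto simp: n_def Zs_def)
  have Y: "fst Y \<in> DS" using assms(1) by (auto simp: energy_space_def)
  have sV: "S (fst (V k)) = complex_of_real (1 / sqrt 2) *\<^sub>C (1 / freq \<mu> k) *\<^sub>C S (v n)"
    using v_props(4)[OF n] DS
    by (simp add: wave_mode_def scaleC_prod_def n_def S_scaleC complex_vector.subspace_scale)
  have "cnj (1 / freq \<mu> k) * complex_of_real (\<mu> n) = freq \<mu> k"
    using freq_square[OF assms(2)] freq_neq_0[OF assms(2)]
    by (simp add: freq_cnj n_def field_simps) 
  then have "cinner (S (fst Y)) (S (fst (V k))) = complex_of_real (1 / sqrt 2) * (freq \<mu> k * cinner (fst Y) (v n))"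
    unfolding sV cinner_scaleC_right cinner_S_v[OF Y n] by (simp add: mult.assoc[symmetric])
  moreover have "cinner (snd Y) (snd (V k)) = complex_of_real (1 / sqrt 2) * cinner (snd Y) (v n)"
    by (simp add: wave_mode_def scaleC_prod_def n_def cinner_scaleC_right)
  ultimately show ?thesis
    unfolding energy_ip_def n_def[symmetric] by (simp add: distrib_left)
qed

lemma ip_V_V:
  assumes "j \<in> Zs" "k \<in> Zs" shows "ip (V j) (V k) = (if j = k then 1 else 0)"
proof -
  define m n where "m = nat \<bar>j\<bar>" and "n = nat \<bar>k\<bar>"
  have mn: "m \<ge> 1" "n \<ge> 1" using assms by (auto simp: m_def n_def Zs_def)
  define c where "c = complex_of_real (1 / sqrt 2)"
  have cc: "c * c = 1 / 2" unfolding c_def by (simp flip: of_real_mult)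
  have "fst (V j) = (c / freq \<mu> j) *\<^sub>C v m" "snd (V j) = c *\<^sub>C v m"
    by (simp_all add: wave_mode_def scaleC_prod_def scaleC_scaleC m_def c_def)
  then have "ip (V j) (V k) = c * c * (freq \<mu> k / freq \<mu> j + 1) * cinner (v m) (v n)"
    unfolding ip_V[OF V_X[OF assms(1)] assms(2)] c_def[symmetric] n_def[symmetric]
    by (simp add: cinner_scaleC_left algebra_simps)
  also have "\<dots> = (if j = k then 1 else 0)"
  proof (cases "m = n")
    case True
    then have "j = k \<or> j = - k" by (auto simp: m_def n_def)
    moreover have "freq \<mu> (- k) = - freq \<mu> k" by (simp add: freq_def)
    ultimately show ?thesis
      using True cc freq_neq_0[OF assms(2)] assms(2) mn by (auto simp: cinner_v Zs_def)
  next
    case False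
    then show ?thesis using mn by (auto simp: cinner_v m_def n_def)
  qed
  finally show ?thesis .
qed

text \<open>
  The modes \<open>n\<close> and \<open>-n\<close> together determine the two coefficients of \<open>Y\<close> along \<open>v n\<close>.
\<close>

lemma ip_V_total:
  assumes Y: "Y \<in> X" and zero: "\<And>k. k \<in> Zs \<Longrightarrow> ip Y (V k) = 0"
  shows "Y = 0"
proof -
  have "cinner (fst Y) (v n) = 0 \<and> cinner (snd Y) (v n) = 0" if n: "n \<ge> 1" for n
  proof -
    have k: "int n \<in> Zs" "- int n \<in> Zs" using n by (auto simp: Zs_def)
    have "freq \<mu> (- int n) = - freq \<mu> (int n)" by (simp add: freq_def)
    then have "freq \<mu> (int n) * cinner (fst Y) (v n) + cinner (snd Y) (v n) = 0"
      "- freq \<mu> (int n) * cinner (fst Y) (v n) + cinner (snd Y) (v n) = 0"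
      using zero[OF k(1)] zero[OF k(2)] by (simp_all add: ip_V[OF Y] k)
    then have "cinner (snd Y) (v n) = 0" "freq \<mu> (int n) * cinner (fst Y) (v n) = 0"
      by (simp_all add: eq_neg_iff_add_eq_0[symmetric] add_eq_0_iff)
    then show ?thesis using freq_neq_0[OF k(1)] by simp
  qed
  then have "fst Y = 0" "snd Y = 0"
    using eigen_sequence_total[OF A_self_adjoint A_positive A_compact_inverse A_eigen] by blast+
  then show ?thesis by (simp add: prod_eq_iff)
qed

text \<open>
  The modes, the damping, the wave operator and its domain in isometric coordinates.
\<close>

definition E :: "int \<Rightarrow> 'h \<times> 'h" where "E k = \<Phi> (V k)"

definition B' :: "'h \<times> 'h \<Rightarrow> 'h \<times> 'h" where "B' Z = \<Phi> (B (\<Psi> Z))"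

definition A0' :: "'h \<times> 'h \<Rightarrow> 'h \<times> 'h" where "A0' Z = \<Phi> (wave_op A (\<Psi> Z))"

definition W' :: "('h \<times> 'h) set" where "W' = {Z. \<Psi> Z \<in> W}"

lemma cinner_E: "cinner Z (E k) = ip (\<Psi> Z) (V k)"
  by (simp add: ip_eq E_def)

lemma B'_bound: "norm (B' Z) \<le> op_B * norm Z"
proof (cases "Z = 0")
  case True
  have "\<Psi> 0 = 0" using \<Psi>_scaleC[of 0 0] by simp
  then have "B (\<Psi> 0) = 0" using B_scaleC[OF complex_vector.subspace_0[OF X], of 0] by simp
  then show ?thesis using True by (simp add: B'_def)
next
  case False
  obtain K where K: "\<And>Y. Y \<in> X \<Longrightarrow> norm (\<Phi> (B Y)) \<le> K * norm (\<Phi> Y)"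
    using B_bounded by (auto simp: bounded_op_def ip_norm_eq)
  have bdd: "bdd_above ((\<lambda>x. ip_norm ip (B x)) ` {x\<in>X. ip_norm ip x \<le> 1})"
  proof (rule bdd_aboveI2)
    fix x assume x: "x \<in> {x\<in>X. ip_norm ip x \<le> 1}"
    then have "norm (\<Phi> (B x)) \<le> \<bar>K\<bar> * norm (\<Phi> x)"
      using K[of x] by (smt (verit) mem_Collect_eq mult_right_mono norm_ge_zero abs_ge_self)
    also have "\<dots> \<le> \<bar>K\<bar>" using x by (simp add: ip_norm_eq mult_left_le)
    finally show "ip_norm ip (B x) \<le> \<bar>K\<bar>" by (simp add: ip_norm_eq)
  qed
  define a where "a = complex_of_real (1 / norm Z)"
  have "ip_norm ip (B (\<Psi> (a *\<^sub>C Z))) \<le> op_B"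
    unfolding op_norm_def by (rule cSUP_upper[OF _ bdd])
      (use False in \<open>simp add: ip_norm_eq norm_scaleC a_def norm_divide\<close>)
  then have "cmod a * norm (B' Z) \<le> op_B"
    by (simp add: ip_norm_eq \<Psi>_scaleC B_scaleC \<Phi>_scaleC B_X norm_scaleC B'_def)
  then show ?thesis using False by (simp add: a_def norm_divide field_simps)
qed

text \<open>
  The graph of a skew-adjoint operator is, up to sign, that of an adjoint, and adjoint graphs are
  closed because the pairing is continuous.
\<close>

lemma A0'_closed:
  assumes "\<And>n. F n \<in> W'" and lim: "F \<longlonglongrightarrow> x" and lim': "(\<lambda>n. A0' (F n)) \<longlonglongrightarrow> y"
  shows "x \<in> W' \<and> A0' x = y"
proof -
  have FW: "\<Psi> (F n) \<in> W" for n using assms(1) by (simp add: W'_def)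
  have "ip (wave_op A Y) (\<Psi> x) = ip Y (- \<Psi> y)" if Y: "Y \<in> W" for Y
  proof -
    have "cinner (\<Phi> (wave_op A Y)) (F n) = - cinner (\<Phi> Y) (A0' (F n))" for n
      using wave_skew[OF Y FW[of n]]
      by (simp add: ip_eq \<Phi>_minus wave_X[OF FW] cinner_minus_right A0'_def)
    moreover have "(\<lambda>n. cinner (\<Phi> (wave_op A Y)) (F n)) \<longlonglongrightarrow> cinner (\<Phi> (wave_op A Y)) x"
      by (rule tendsto_cinner_right[OF lim])
    moreover have "(\<lambda>n. - cinner (\<Phi> Y) (A0' (F n))) \<longlonglongrightarrow> - cinner (\<Phi> Y) y"
      by (intro tendsto_minus tendsto_cinner_right lim')
    ultimately have "cinner (\<Phi> (wave_op A Y)) x = - cinner (\<Phi> Y) y"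
      using LIMSEQ_unique by auto
    then show ?thesis by (simp add: ip_eq \<Phi>_minus cinner_minus_right)
  qed
  then have "(\<Psi> x, - \<Psi> y) \<in> adjoint_graph X ip W (wave_op A)"
    using X by (simp add: adjoint_graph_def complex_vector.subspace_neg)
  then have "\<Psi> x \<in> W" "wave_op A (\<Psi> x) = \<Psi> y" unfolding skew_graph by auto
  then show ?thesis by (simp add: W'_def A0'_def)
qed

sublocale damped_modes E freq_im B' op_B
proof
  show "cinner (E j) (E k) = (if j = k then 1 else 0)" if "j \<in> Zs" "k \<in> Zs" for j k
    using ip_V_V[OF that] by (simp add: E_def ip_eq)
  show "x = 0" if "\<And>k. k \<in> Zs \<Longrightarrow> cinner x (E k) = 0" for x
  proof -
    have "\<Psi> x = 0" by (rule ip_V_total) (use that in \<open>simp_all add: cinner_E\<close>)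
    then have "\<Phi> (\<Psi> x) = \<Phi> 0" by simp
    then show ?thesis by (simp only: \<Phi>_\<Psi> \<Phi>_zero)
  qed
  show "B' (x + y) = B' x + B' y" for x y by (simp add: B'_def \<Psi>_add B_add \<Phi>_add B_X)
  show "B' (a *\<^sub>C x) = a *\<^sub>C B' x" for a x by (simp add: B'_def \<Psi>_scaleC B_scaleC \<Phi>_scaleC B_X)
  have "cinner (B' x) x = ip (B (\<Psi> x)) (\<Psi> x)" for x by (simp add: B'_def ip_eq)
  then show "cinner (B' x) x \<in> \<real>" "0 \<le> Re (cinner (B' x) x)" for x
    using B_positive by (simp_all add: positive_op_def)
  show "norm (B' x) \<le> op_B * norm x" for x by (rule B'_bound)
  show "freq_im k < freq_im (zsucc k)" "2 * op_B \<le> freq_im (zsucc k) - freq_im k" if "k \<in> Zs" for k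
    using freq_im_less[OF that] freq_im_gap[OF that] by auto
qed

sublocale damped_system E freq_im B' op_B W' A0'
proof
  have \<Psi>0: "\<Psi> 0 = 0" using \<Psi>_scaleC[of 0 0] by simp
  show "csubspace W'"
    using W by (simp add: complex_vector.subspace_def W'_def \<Psi>_add \<Psi>_scaleC \<Psi>0)
  show "E k \<in> W'" if "k \<in> Zs" for k using V_W[OF that] V_X[OF that] by (simp add: W'_def E_def)
  show "A0' (x + y) = A0' x + A0' y" if "x \<in> W'" "y \<in> W'" for x y
    using that by (simp add: W'_def A0'_def \<Psi>_add wave_add \<Phi>_add wave_X)
  show "A0' (a *\<^sub>C x) = a *\<^sub>C A0' x" if "x \<in> W'" for a x
    using that by (simp add: W'_def A0'_def \<Psi>_scaleC wave_scaleC \<Phi>_scaleC wave_X)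
  show "cinner (A0' x) (E k) = lam k * cinner x (E k)" if x: "x \<in> W'" and k: "k \<in> Zs" for x k
  proof -
    have "cinner (A0' x) (E k) = ip (wave_op A (\<Psi> x)) (V k)" by (simp add: A0'_def ip_eq E_def)
    also have "\<dots> = ip (\<Psi> x) (- (freq \<mu> k *\<^sub>C V k))"
      using wave_skew[OF _ V_W[OF k], of "\<Psi> x"] x by (simp add: W'_def wave_V[OF k])
    also have "\<dots> = lam k * cinner x (E k)"
      using X V_X[OF k]
      by (simp add: ip_eq E_def \<Phi>_minus \<Phi>_scaleC complex_vector.subspace_scale cinner_minus_right
          cinner_scaleC_right freq_cnj) (simp add: lam_def freq_eq)
    finally show ?thesis .
  qed
  show "x \<in> W' \<and> A0' x = y" if "\<And>n. F n \<in> W'" "F \<longlonglongrightarrow> x" "(\<lambda>n. A0' (F n)) \<longlonglongrightarrow> y" for F x y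
    by (rule A0'_closed[OF that])
qed


subsection \<open>Galerkin truncation and Riesz basis in isometric coordinates\<close>

abbreviation "G \<equiv> galerkin_space \<mu> v"

lemma G_subspace: "csubspace (G N)"
  unfolding galerkin_space_def by (rule complex_vector.subspace_span)

lemma V_in_G: "k \<in> ZsN N \<Longrightarrow> V k \<in> G N"
  unfolding galerkin_space_def by (auto intro: complex_vector.span_base)

lemma G_minimal: "csubspace L \<Longrightarrow> (\<And>k. k \<in> ZsN N \<Longrightarrow> V k \<in> L) \<Longrightarrow> G N \<subseteq> L"
  unfolding galerkin_space_def by (rule complex_vector.span_minimal) auto

lemma G_W: "G N \<subseteq> W" and G_X: "G N \<subseteq> X"
proof -
  show "G N \<subseteq> W" using W V_W ZsN_subset by (intro G_minimal) auto
  then show "G N \<subseteq> X" using W_X by blast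
qed

lemma galerkin_supported:
  assumes "w \<in> G N" shows "supported (ZsN N) (\<Phi> w)"
proof -
  let ?L = "{w\<in>X. supported (ZsN N) (\<Phi> w)}"
  have "csubspace ?L"
    using X unfolding complex_vector.subspace_def
    by (auto simp: supported_def \<Phi>_add \<Phi>_scaleC cinner_add_left cinner_scaleC_left)
  moreover have "V k \<in> ?L" if "k \<in> ZsN N" for k
    using that ZsN_subset[of N] V_X[of k] ortho[of k] by (auto simp: supported_def E_def[symmetric])
  ultimately show ?thesis using G_minimal[of ?L N] assms by blast
qed

text \<open>
  The projection is the partial Fourier sum, by uniqueness of the orthogonal decomposition.
\<close>

lemma ortho_proj_galerkin:
  assumes Y: "Y \<in> X"
  shows "ortho_proj ip (G N) Y \<in> G N \<and>
    (\<forall>k\<in>ZsN N. cinner (\<Phi> (ortho_proj ip (G N) Y)) (E k) = cinner (\<Phi> Y) (E k))"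
proof -
  define P where "P = (\<Sum>k\<in>ZsN N. ip Y (V k) *\<^sub>C V k)"
  have PG: "P \<in> G N" unfolding P_def
    by (intro complex_vector.subspace_sum[OF G_subspace] complex_vector.subspace_scale[OF G_subspace] V_in_G)
  have "\<Phi> P = (\<Sum>k\<in>ZsN N. ip Y (V k) *\<^sub>C E k)"
    unfolding P_def using ZsN_subset[of N] X V_X
    by (subst \<Phi>_sum) (auto simp: \<Phi>_scaleC E_def complex_vector.subspace_scale intro!: sum.cong)
  then have \<Phi>P: "\<Phi> P = part (ZsN N) (\<Phi> Y)"
    by (simp add: part_def cinner_E Y)
  have coeff: "cinner (\<Phi> P) (E k) = cinner (\<Phi> Y) (E k)" if "k \<in> ZsN N" for k
    using that ZsN_subset[of N] by (auto simp: \<Phi>P coeff_part[OF finite_ZsN ZsN_subset])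
  let ?L = "{z\<in>X. ip (Y - P) z = 0}"
  have "csubspace ?L"
    using X unfolding complex_vector.subspace_def
    by (auto simp: ip_eq \<Phi>_add \<Phi>_scaleC cinner_add_right cinner_scaleC_right)
  moreover have "V k \<in> ?L" if "k \<in> ZsN N" for k
    using that ZsN_subset[of N] V_X[of k] coeff[OF that] subsetD[OF G_X PG] Y
    by (auto simp: ip_eq \<Phi>_diff cinner_diff_left E_def)
  ultimately have ort: "\<forall>z\<in>G N. ip (Y - P) z = 0" using G_minimal[of ?L N] by blast
  have "ortho_proj ip (G N) Y = P"
    unfolding ortho_proj_def
  proof (rule the_equality)
    fix y assume y: "y \<in> G N \<and> (\<forall>z\<in>G N. ip (Y - y) z = 0)"
    have yP: "y - P \<in> G N" using y PG G_subspace by (intro complex_vector.subspace_diff) auto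
    have X': "y \<in> X" "P \<in> X" using y PG G_X by auto
    have "ip (Y - P) (y - P) = 0" "ip (Y - y) (y - P) = 0" using ort y yP by auto
    then have "cinner (\<Phi> y - \<Phi> P) (\<Phi> y - \<Phi> P) = 0"
      using X' Y by (simp add: ip_eq \<Phi>_diff cinner_diff_left)
    then have "\<Phi> y = \<Phi> P" by (simp add: cinner_self)
    then show "y = P" by (metis X' \<Psi>_\<Phi>)
  qed (use PG ort in blast)
  then show ?thesis using PG coeff by simp
qed

lemma galerkin_op_maps_to:
  assumes w: "w \<in> G N" shows "maps_to (ZsN N) (\<Phi> w) (\<Phi> (galerkin_op A S B \<mu> v N w))"
  unfolding maps_to_def
proof
  fix k assume k: "k \<in> ZsN N"
  then have kZ: "k \<in> Zs" using ZsN_subset by auto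
  have wW: "w \<in> W" and wX: "w \<in> X" using w G_W G_X by auto
  have X': "wave_op A w \<in> X" "B w \<in> X" using wave_X[OF wW] B_X[OF wX] by auto
  have "damped_op A B w \<in> X" unfolding damped_op_def using X X' by (rule complex_vector.subspace_diff)
  then have "cinner (\<Phi> (galerkin_op A S B \<mu> v N w)) (E k) = cinner (\<Phi> (damped_op A B w)) (E k)"
    using ortho_proj_galerkin k unfolding galerkin_op_def by blast
  also have "\<dots> = cinner (A0' (\<Phi> w)) (E k) - cinner (B' (\<Phi> w)) (E k)"
    using wX X' by (simp add: damped_op_def \<Phi>_diff cinner_diff_left A0'_def B'_def)
  also have "cinner (A0' (\<Phi> w)) (E k) = lam k * cinner (\<Phi> w) (E k)"
    using wW wX kZ by (intro A0_coeff) (auto simp: W'_def)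
  finally show "lam k * cinner (\<Phi> w) (E k) - cinner (B' (\<Phi> w)) (E k)
    = cinner (\<Phi> (galerkin_op A S B \<mu> v N w)) (E k)" by simp
qed

lemma \<Phi>_notin_span:
  assumes "w \<in> X" "w' \<in> X" "w' \<notin> cspan {w}" shows "\<Phi> w' \<notin> cspan {\<Phi> w}"
proof
  assume "\<Phi> w' \<in> cspan {\<Phi> w}"
  then obtain a where "\<Phi> w' = \<Phi> (a *\<^sub>C w)"
    using assms(1) by (auto simp: complex_vector.span_singleton \<Phi>_scaleC)
  then have "w' = a *\<^sub>C w"
    using assms X by (metis \<Psi>_\<Phi> complex_vector.subspace_scale)
  then show False using assms(3) by (auto simp: complex_vector.span_singleton)
qed

text \<open>
  Equal values at two indices mean algebraic multiplicity at least two, hence a generalized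
  eigenvector outside the first eigenline. Different values have independent eigenvectors.
\<close>

lemma galerkin_eigenvalues_if_spectrum:
  assumes spec: "galerkin_spectrum A S B \<mu> v N \<eta>"
  shows "galerkin_eigenvalues N \<eta>"
proof -
  let ?T = "galerkin_op A S B \<mu> v N"
  have mult: "card {k\<in>ZsN N. \<eta> k = z} = alg_mult (G N) ?T z" for z
    using spec by (simp add: galerkin_spectrum_def)
  have eigvec: "\<exists>w\<in>G N. w \<noteq> 0 \<and> maps_to (ZsN N) (\<Phi> w) (\<eta> p *\<^sub>C \<Phi> w)" if p: "p \<in> ZsN N" for p
  proof -
    have "card {} < card {k\<in>ZsN N. \<eta> k = \<eta> p}" using p by (auto simp: card_gt_0_iff)
    then obtain w where w: "w \<in> G N" "w \<notin> cspan {}" "?T w - \<eta> p *\<^sub>C w \<in> cspan {}"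
      using exists_generalized_eigenvector[of "{}" "G N" ?T "\<eta> p"] unfolding mult by auto
    then have "w \<noteq> 0" "?T w = \<eta> p *\<^sub>C w" by auto
    moreover have "w \<in> X" using w(1) G_X by blast
    ultimately show ?thesis using galerkin_op_maps_to[OF w(1)] w(1) by (auto simp: \<Phi>_scaleC)
  qed
  have nz: "\<Phi> w \<noteq> 0" if "w \<in> G N" "w \<noteq> 0" for w
    using that \<Phi>_eq_0_iff G_X by blast
  have jordan: "\<exists>w1 w2 c. w1 \<noteq> 0 \<and> w2 \<notin> cspan {w1} \<and> supported (ZsN N) w1 \<and> supported (ZsN N) w2 \<and>
       maps_to (ZsN N) w1 (\<eta> p *\<^sub>C w1) \<and> maps_to (ZsN N) w2 (\<eta> q *\<^sub>C w2 + c *\<^sub>C w1)"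
    if p: "p \<in> ZsN N" and q: "q \<in> ZsN N" and pq: "p \<noteq> q" for p q
  proof -
    obtain w where w: "w \<in> G N" "w \<noteq> 0" "maps_to (ZsN N) (\<Phi> w) (\<eta> p *\<^sub>C \<Phi> w)"
      using eigvec[OF p] by blast
    have "\<exists>w'\<in>G N. \<exists>c. \<Phi> w' \<notin> cspan {\<Phi> w} \<and> maps_to (ZsN N) (\<Phi> w') (\<eta> q *\<^sub>C \<Phi> w' + c *\<^sub>C \<Phi> w)"
    proof (cases "\<eta> p = \<eta> q")
      case True
      have "card {p, q} \<le> card {k\<in>ZsN N. \<eta> k = \<eta> q}" using p q True by (intro card_mono) auto
      then have "card {w} < alg_mult (G N) ?T (\<eta> q)" using pq mult[of "\<eta> q"] by simp
      then obtain w' where w': "w' \<in> G N" "w' \<notin> cspan {w}" "?T w' - \<eta> q *\<^sub>C w' \<in> cspan {w}"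
        using exists_generalized_eigenvector[of "{w}" "G N" ?T "\<eta> q"] by auto
      then obtain c where "?T w' - \<eta> q *\<^sub>C w' = c *\<^sub>C w" by (auto simp: complex_vector.span_singleton)
      then have "?T w' = \<eta> q *\<^sub>C w' + c *\<^sub>C w" by (simp add: algebra_simps)
      then have "\<Phi> (?T w') = \<eta> q *\<^sub>C \<Phi> w' + c *\<^sub>C \<Phi> w"
        using subsetD[OF G_X w(1)] subsetD[OF G_X w'(1)] X
        by (simp add: \<Phi>_add \<Phi>_scaleC complex_vector.subspace_scale)
      then show ?thesis
        using galerkin_op_maps_to[OF w'(1)] \<Phi>_notin_span[of w w'] w(1) w' G_X by (metis subsetD)
    next
      case False
      obtain w' where w': "w' \<in> G N" "w' \<noteq> 0" "maps_to (ZsN N) (\<Phi> w') (\<eta> q *\<^sub>C \<Phi> w')"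
        using eigvec[OF q] by blast
      have "\<Phi> w' \<notin> cspan {\<Phi> w}"
        using w w' nz galerkin_supported False by (intro eigenvectors_independent[OF _ _ w(3) _ _ w'(3)]) auto
      then show ?thesis using w' by (intro bexI[of _ w'] exI[of _ 0]) auto
    qed
    then show ?thesis using w nz galerkin_supported by blast
  qed
  have eig: "\<forall>p\<in>ZsN N. \<exists>w. w \<noteq> 0 \<and> supported (ZsN N) w \<and> maps_to (ZsN N) w (\<eta> p *\<^sub>C w)"
    using eigvec nz galerkin_supported by blast
  have "\<forall>k\<in>ZsN N. zsucc k \<in> ZsN N \<longrightarrow> Im (\<eta> k) \<le> Im (\<eta> (zsucc k))"
    using spec by (simp add: galerkin_spectrum_def)
  then show ?thesis
    unfolding galerkin_eigenvalues_def by (intro conjI eig ballI[OF ballI[OF impI[OF jordan]]])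
qed

text \<open>
  The net of partial sums of a finitely supported series is eventually constant.
\<close>

lemma riesz_finite_sum:
  assumes "ip_has_sum X ip (\<lambda>j. c j *\<^sub>C U j) Zs Y" and F: "finite F" "F \<subseteq> Zs"
    and U: "\<And>j. j \<in> Zs \<Longrightarrow> U j \<in> X" and zero: "\<And>j. j \<notin> F \<Longrightarrow> c j = 0"
  shows "\<Phi> Y = (\<Sum>j\<in>F. c j *\<^sub>C \<Phi> (U j))"
proof -
  let ?s = "\<lambda>F. \<Sum>j\<in>F. c j *\<^sub>C U j"
  have Y: "Y \<in> X" and lim: "((\<lambda>F. ip_norm ip (Y - ?s F)) \<longlongrightarrow> 0) (finite_subsets_at_top Zs)"
    using assms(1) by (auto simp: ip_has_sum_def)
  have sX: "?s F \<in> X" using F U X by (auto intro!: complex_vector.subspace_sum complex_vector.subspace_scale)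
  have "\<forall>\<^sub>F F' in finite_subsets_at_top Zs. ip_norm ip (Y - ?s F') = ip_norm ip (Y - ?s F)"
  proof -
    have "?s F' = ?s F" if "finite F'" "F \<subseteq> F'" for F'
      using that zero by (intro sum.mono_neutral_right) auto
    then show ?thesis
      unfolding eventually_finite_subsets_at_top using F by (intro exI[of _ F]) metis
  qed
  then have "((\<lambda>F. ip_norm ip (Y - ?s F)) \<longlongrightarrow> ip_norm ip (Y - ?s F)) (finite_subsets_at_top Zs)"
    by (rule tendsto_eventually)
  then have "ip_norm ip (Y - ?s F) = 0"
    using tendsto_unique[OF finite_subsets_at_top_neq_bot _ lim] by blast
  then have "\<Phi> Y = \<Phi> (?s F)" using Y sX by (simp add: ip_norm_eq \<Phi>_diff)
  also have "\<dots> = (\<Sum>j\<in>F. c j *\<^sub>C \<Phi> (U j))"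
    using F U X by (subst \<Phi>_sum) (auto simp: \<Phi>_scaleC subsetD intro!: complex_vector.subspace_scale sum.cong)
  finally show ?thesis .
qed

lemma riesz_basis_isometry:
  assumes "riesz_basis X ip Zs U"
  obtains m M where "m > 0" "M > 0"
    "\<And>F c. finite F \<Longrightarrow> F \<subseteq> Zs \<Longrightarrow>
      m * (\<Sum>j\<in>F. (cmod (c j))\<^sup>2) \<le> (norm (\<Sum>j\<in>F. c j *\<^sub>C \<Phi> (U j)))\<^sup>2"
    "\<And>F c. finite F \<Longrightarrow> F \<subseteq> Zs \<Longrightarrow>
      (norm (\<Sum>j\<in>F. c j *\<^sub>C \<Phi> (U j)))\<^sup>2 \<le> M * (\<Sum>j\<in>F. (cmod (c j))\<^sup>2)"
proof -
  have U: "U j \<in> X" if "j \<in> Zs" for j using assms that by (auto simp: riesz_basis_def)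
  obtain m M where mM: "m > 0" "M > 0" and R: "\<And>c::int \<Rightarrow> complex. (\<lambda>j. (cmod (c j))\<^sup>2) summable_on Zs \<Longrightarrow>
        (\<exists>Y. ip_has_sum X ip (\<lambda>j. c j *\<^sub>C U j) Zs Y \<and>
             m * (\<Sum>\<^sub>\<infinity>j\<in>Zs. (cmod (c j))\<^sup>2) \<le> (ip_norm ip Y)\<^sup>2 \<and>
             (ip_norm ip Y)\<^sup>2 \<le> M * (\<Sum>\<^sub>\<infinity>j\<in>Zs. (cmod (c j))\<^sup>2))"
    using assms unfolding riesz_basis_def by blast
  have main: "m * (\<Sum>j\<in>F. (cmod (c j))\<^sup>2) \<le> (norm (\<Sum>j\<in>F. c j *\<^sub>C \<Phi> (U j)))\<^sup>2 \<and>
      (norm (\<Sum>j\<in>F. c j *\<^sub>C \<Phi> (U j)))\<^sup>2 \<le> M * (\<Sum>j\<in>F. (cmod (c j))\<^sup>2)"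
    if F: "finite F" "F \<subseteq> Zs" for F c
  proof -
    define d where "d j = (if j \<in> F then c j else 0)" for j
    have hs: "((\<lambda>j. (cmod (d j))\<^sup>2) has_sum (\<Sum>j\<in>F. (cmod (c j))\<^sup>2)) Zs"
    proof -
      have "((\<lambda>j. (cmod (d j))\<^sup>2) has_sum (\<Sum>j\<in>F. (cmod (d j))\<^sup>2)) F" using F(1) by (rule has_sum_finite)
      then have "((\<lambda>j. (cmod (d j))\<^sup>2) has_sum (\<Sum>j\<in>F. (cmod (d j))\<^sup>2)) Zs"
        by (rule has_sum_cong_neutral[THEN iffD1, rotated -1]) (use F in \<open>auto simp: d_def\<close>)
      then show ?thesis by (simp add: d_def)
    qed
    obtain Y where Y: "ip_has_sum X ip (\<lambda>j. d j *\<^sub>C U j) Zs Y"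
      "m * (\<Sum>j\<in>F. (cmod (c j))\<^sup>2) \<le> (ip_norm ip Y)\<^sup>2" "(ip_norm ip Y)\<^sup>2 \<le> M * (\<Sum>j\<in>F. (cmod (c j))\<^sup>2)"
      using R[OF has_sum_imp_summable[OF hs]] unfolding infsumI[OF hs] by blast
    have "\<Phi> Y = (\<Sum>j\<in>F. d j *\<^sub>C \<Phi> (U j))"
      by (rule riesz_finite_sum[OF Y(1) F U]) (auto simp: d_def)
    then have "\<Phi> Y = (\<Sum>j\<in>F. c j *\<^sub>C \<Phi> (U j))" by (simp add: d_def)
    then show ?thesis using Y(2,3) by (simp add: ip_norm_eq)
  qed
  show ?thesis using that[of m M] mM main by blast
qed

lemma riesz_basis_span_dense:
  assumes "riesz_basis X ip Zs U" and d: "d > 0"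
  shows "\<exists>y\<in>cspan ((\<lambda>j. \<Phi> (U j)) ` Zs). norm (x - y) < d"
proof -
  have U: "U j \<in> X" if "j \<in> Zs" for j using assms that by (auto simp: riesz_basis_def)
  have "dense_in X ip (cspan (U ` Zs))" using assms(1) by (simp add: riesz_basis_def)
  then obtain y where y: "y \<in> cspan (U ` Zs)" "y \<in> X" "norm (\<Phi> (\<Psi> x - y)) < d"
    using d unfolding dense_in_def ip_norm_eq by (meson \<Psi>_in_X subsetD)
  obtain F c where F: "finite F" "F \<subseteq> Zs" "y = (\<Sum>j\<in>F. c j *\<^sub>C U j)"
    using cspan_image_eq_sum[OF y(1)] by metis
  have "\<Phi> y = (\<Sum>j\<in>F. c j *\<^sub>C \<Phi> (U j))"
    unfolding F(3) using F U X
    by (subst \<Phi>_sum) (auto simp: \<Phi>_scaleC subsetD intro!: complex_vector.subspace_scale sum.cong)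
  then have "\<Phi> y \<in> cspan ((\<lambda>j. \<Phi> (U j)) ` Zs)"
    using F by (auto intro!: complex_vector.span_sum complex_vector.span_scale intro: complex_vector.span_base)
  moreover have "norm (x - \<Phi> y) < d" using y by (simp add: \<Phi>_diff)
  ultimately show ?thesis by blast
qed

lemma damped_eigen_iff:
  assumes "x \<in> W" shows "A0' (\<Phi> x) - B' (\<Phi> x) = \<Phi> (damped_op A B x)"
  using W_X[OF assms] wave_X[OF assms] B_X
  by (simp add: damped_op_def \<Phi>_diff A0'_def B'_def)

end

section \<open>Spectral approximation for the damped wave system\<close>

theorem theorem3p1:
  fixes D DS :: "'h::complex_hilbert set" and A S :: "'h \<Rightarrow> 'h"
    and \<mu> :: "nat \<Rightarrow> real" and v :: "nat \<Rightarrow> 'h"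
    and B :: "'h \<times> 'h \<Rightarrow> 'h \<times> 'h"
    and \<nu> :: "int \<Rightarrow> complex" and U :: "int \<Rightarrow> 'h \<times> 'h"
    and \<eta> :: "nat \<Rightarrow> int \<Rightarrow> complex"
  assumes infinite_dim: "\<not> (\<exists>F::'h set. finite F \<and> cspan F = UNIV)"
    and A_unbounded: "unbounded_op D A"
    and A_self_adjoint: "self_adjoint_op UNIV cinner D A"
    and A_positive: "positive_op cinner D A"
    and A_compact_inverse: "compact_inverse D A"
    and A_eigen: "eigen_sequence D A \<mu> v"
    and S_sqrt: "is_sqrt_op DS S D A"
    and B_bounded: "bounded_op (energy_space DS) (energy_ip S) B"
    and B_positive: "positive_op (energy_ip S) (energy_space DS) B"
    and nu_U: "damped_spectrum D A DS S B \<nu> U"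
    and eta: "\<And>N. N \<ge> 1 \<Longrightarrow> galerkin_spectrum A S B \<mu> v N (\<eta> N)"
    and H1_skew: "skew_adjoint_op (energy_space DS) (energy_ip S) (wave_dom D DS) (wave_op A)"
    and H1_eigvals: "eigvals (wave_dom D DS) (wave_op A) = freq \<mu> ` Zs"
    and H1_simple: "\<And>n. n \<in> Zs \<Longrightarrow> alg_mult (wave_dom D DS) (wave_op A) (freq \<mu> n) = 1"
    and H2: "\<And>j. j \<in> Zs \<Longrightarrow> j + 1 \<in> Zs \<Longrightarrow>
      cmod (freq \<mu> (j + 1) - freq \<mu> j) > 2 * op_norm (energy_space DS) (energy_ip S) B"
    and H3: "op_norm (energy_space DS) (energy_ip S) B \<le> cmod (freq \<mu> 1)"
    and H4: "riesz_basis (energy_space DS) (energy_ip S) Zs U"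
    and H5: "\<And>e::real. e > 0 \<Longrightarrow> \<exists>r1::nat. r1 > 0 \<and> (\<forall>p::nat. p > 0 \<longrightarrow>
      Max ((\<lambda>i. \<Sum>\<^sub>\<infinity>j\<in>{j\<in>Zs. \<bar>j\<bar> \<ge> int p + int r1}.
                  (cmod (energy_ip S (B (wave_mode \<mu> v i)) (wave_mode \<mu> v j)))\<^sup>2) ` ZsN p) < e)"
    and eps: "(\<epsilon>::real) > 0"
  shows "\<exists>r::nat. r > 0 \<and> (\<forall>N::nat. N > r \<longrightarrow>
    (\<forall>p\<in>Zs. \<bar>p\<bar> \<le> int N - int r \<longrightarrow>
       (\<exists>j\<in>Zs. (\<forall>i\<in>Zs. cmod (\<eta> N p - \<nu> j) \<le> cmod (\<eta> N p - \<nu> i)) \<and>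
               cmod (\<eta> N p - \<nu> j) \<le> 2 * \<epsilon>)) \<and>
    (\<forall>p\<in>Zs. \<bar>p\<bar> \<le> int N - int r \<longrightarrow>
       Min ((\<lambda>j. cmod (\<eta> N j - \<nu> p)) ` ZsN N) \<le> 2 * \<epsilon>))"
proof -
  interpret energy_setting D DS A S \<mu> v B
    using A_self_adjoint A_positive A_compact_inverse A_eigen S_sqrt B_bounded B_positive H1_skew H2 H3
    by unfold_locales auto
  obtain m M where mM: "m > 0" "M > 0"
    and lower: "\<And>F c. finite F \<Longrightarrow> F \<subseteq> Zs \<Longrightarrow>
      m * (\<Sum>j\<in>F. (cmod (c j))\<^sup>2) \<le> (norm (\<Sum>j\<in>F. c j *\<^sub>C \<Phi> (U j)))\<^sup>2"
    and upper: "\<And>F c. finite F \<Longrightarrow> F \<subseteq> Zs \<Longrightarrow>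
      (norm (\<Sum>j\<in>F. c j *\<^sub>C \<Phi> (U j)))\<^sup>2 \<le> M * (\<Sum>j\<in>F. (cmod (c j))\<^sup>2)"
    using riesz_basis_isometry[OF H4] by blast
  have U: "U j \<in> W" "damped_op A B (U j) = \<nu> j *\<^sub>C U j" if "j \<in> Zs" for j
    using nu_U that by (auto simp: damped_spectrum_def)
  show ?thesis
  proof (rule galerkin_spectrum_approximation[where U = "\<lambda>j. \<Phi> (U j)" and m = m and M = M])
    fix x z assume x: "x \<in> W'" "A0' x - B' x = z *\<^sub>C x" "x \<noteq> 0"
    then have xW: "\<Psi> x \<in> W" by (simp add: W'_def)
    have "damped_op A B (\<Psi> x) \<in> X"
      unfolding damped_op_def by (rule complex_vector.subspace_diff[OF X wave_X[OF xW] B_X]) simp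
    then have "damped_op A B (\<Psi> x) = \<Psi> (z *\<^sub>C x)"
      using damped_eigen_iff[OF xW] x(2) by (metis \<Phi>_\<Psi> \<Psi>_\<Phi>)
    then have "damped_op A B (\<Psi> x) = z *\<^sub>C \<Psi> x" by (simp add: \<Psi>_scaleC)
    moreover have "\<Psi> x \<noteq> 0" using x(3) by (metis \<Phi>_\<Psi> \<Phi>_zero)
    ultimately have "z \<in> eigvals W (damped_op A B)" using xW by (auto simp: eigvals_def)
    then show "z \<in> \<nu> ` Zs" using nu_U by (simp add: damped_spectrum_def)
  next
    fix j assume j: "j \<in> Zs"
    show "\<Phi> (U j) \<in> W'" using U[OF j] W_X by (simp add: W'_def)
    show "A0' (\<Phi> (U j)) - B' (\<Phi> (U j)) = \<nu> j *\<^sub>C \<Phi> (U j)"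
      using damped_eigen_iff[OF U(1)[OF j]] U[OF j] W_X by (simp add: \<Phi>_scaleC)
    show "Im (\<nu> j) \<le> Im (\<nu> (zsucc j))" using nu_U j by (simp add: damped_spectrum_def)
  next
    fix d :: real assume d: "d > 0"
    show "\<exists>r1::nat. r1 > 0 \<and> (\<forall>P::nat. P > 0 \<longrightarrow> (\<forall>i\<in>ZsN P.
      (\<Sum>\<^sub>\<infinity>j\<in>{j\<in>Zs. \<bar>j\<bar> \<ge> int P + int r1}. (cmod (cinner (B' (E i)) (E j)))\<^sup>2) < d))"
    proof -
      define s where "s P r i = (\<Sum>\<^sub>\<infinity>j\<in>{j\<in>Zs. \<bar>j\<bar> \<ge> int P + int r}.
                  (cmod (energy_ip S (B (wave_mode \<mu> v i)) (wave_mode \<mu> v j)))\<^sup>2)" for P r :: nat and i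
      obtain r1 :: nat where r1: "r1 > 0" "\<And>P::nat. P > 0 \<Longrightarrow> Max (s P r1 ` ZsN P) < d"
        using H5[OF d] unfolding s_def by blast
      have "s P r1 i < d" if "P > 0" "i \<in> ZsN P" for P i
        using Max_ge[OF finite_imageI[OF finite_ZsN] imageI[OF that(2)], of "s P r1"] r1(2)[OF that(1)]
        by linarith
      moreover have "cinner (B' (E i)) (E j) = energy_ip S (B (V i)) (V j)" if "i \<in> ZsN P" for i j P
        using V_X[OF subsetD[OF ZsN_subset that]] by (simp add: B'_def E_def ip_eq)
      then have "(\<Sum>\<^sub>\<infinity>j\<in>{j\<in>Zs. \<bar>j\<bar> \<ge> int P + int r1}. (cmod (cinner (B' (E i)) (E j)))\<^sup>2) = s P r1 i"
        if "i \<in> ZsN P" for i P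
        unfolding s_def using that by (intro infsum_cong) simp
      ultimately show ?thesis using r1(1) by (intro exI[of _ r1]) simp
    qed
  qed (use riesz_basis_span_dense[OF H4] mM lower upper eps galerkin_eigenvalues_if_spectrum eta in auto)
qed

end
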